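(* Let $G$ be a maximal triangle-free graph with vertex set $\mathbb N=\{1,2,3,\dots\}$. If $\inf\{\underline{\deg}(v): v\in\mathbb N\}>1/3$, then $G$ is a blow-up of either an Andrásfai graph $\Gamma_k$ ($k\ge1$) or a Vega graph $\Upsilon_i^{\mu\nu}$ ($i\ge2$, $\mu,\nu\in\{0,1\}$).
   Context: For $v\in\mathbb N$, $\underline{\deg}(v)=\liminf_{n\to\infty}\frac{|\{1,\dots,n\}\cap\mathrm N(v)|}{n}$, where $\mathrm N(v)$ is the neighbourhood of $v$. A graph is maximal triangle-free if it contains no triangle but adding any new edge creates a triangle. A blow-up of $H$ is any graph obtained by replacing each vertex of $H$ by a non-empty (possibly infinite) independent set and each edge of $H$ by the complete bipartite graph between the corresponding sets, with no further edges. Andrásfai graph $\Gamma_k$: vertex set $\mathbb Z/(3k-1)\mathbb Z$, $ij$ an edge iff $i-j\in\{k,\dots,2k-1\}$ mod $3k-1$. Vega graphs: for $i\ge2$, $\Upsilon_i^{00}$ has vertex set $\mathbb Z/(3i-1)\mathbb Z\cup\{a,b,c,u,v,w,x,y\}$; edges: those of $\Gamma_i$; the hexagon $av,vc,cu,ub,bw,wa$; all edges from $a,u$ to $\{0,\dots,i-1\}$; from $b,v$ to $\{i,\dots,2i-1\}$; from $c,w$ to $\{2i,\dots,3i-2\}$; and $xa,xb,xc,yu,yv,yw,xy$. Further $\Upsilon_i^{10}=\Upsilon_i^{00}-y$, $\Upsilon_i^{01}=\Upsilon_i^{00}-(2i-1)$, $\Upsilon_i^{11}=\Upsilon_i^{00}-\{y,2i-1\}$.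 *)

theory Defs
  imports Complex_Main "HOL-Library.Liminf_Limsup" "HOL-Library.Extended_Real"
begin

definition pos_graph :: "(nat \<Rightarrow> nat \<Rightarrow> bool) \<Rightarrow> bool" where
  "pos_graph E \<longleftrightarrow> (\<forall>u v. E u v \<longrightarrow> E v u) \<and> (\<forall>v. \<not> E v v)
     \<and> (\<forall>u v. E u v \<longrightarrow> 1 \<le> u \<and> 1 \<le> v)"

definition maximal_triangle_free :: "(nat \<Rightarrow> nat \<Rightarrow> bool) \<Rightarrow> bool" where
  "maximal_triangle_free E \<longleftrightarrow>
     (\<forall>u v w. \<not> (E u v \<and> E v w \<and> E u w)) \<and>
     (\<forall>u v. 1 \<le> u \<longrightarrow> 1 \<le> v \<longrightarrow> u \<noteq> v \<longrightarrow> \<not> E u v \<longrightarrow>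
        (\<exists>w. 1 \<le> w \<and> E u w \<and> E v w))"

definition lower_deg :: "(nat \<Rightarrow> nat \<Rightarrow> bool) \<Rightarrow> nat \<Rightarrow> ereal" where
  "lower_deg E v = liminf (\<lambda>n. ereal (real (card {w. 1 \<le> w \<and> w \<le> n \<and> E v w}) / real n))"

text \<open>G (on vertex set V) is a blow-up of H (vertex set VH, adjacency EH):
  a surjection f : V \<rightarrow> VH such that u,v adjacent iff f u, f v adjacent.
  Parts f^{-1}(x) are nonempty (surjectivity) and independent (EH irreflexive).\<close>
definition blow_up :: "('a \<Rightarrow> 'a \<Rightarrow> bool) \<Rightarrow> 'a set \<Rightarrow> ('b \<Rightarrow> 'b \<Rightarrow> bool) \<Rightarrow> 'b set \<Rightarrow> bool" where
  "blow_up E V EH VH \<longleftrightarrow> (\<exists>f. (\<forall>v\<in>V. f v \<in> VH) \<and> (\<forall>x\<in>VH. \<exists>v\<in>V. f v = x) \<and>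
      (\<forall>u\<in>V. \<forall>v\<in>V. E u v \<longleftrightarrow> EH (f u) (f v)))"

definition andrasfai_verts :: "nat \<Rightarrow> int set" where
  "andrasfai_verts k = {0..<3 * int k - 1}"

definition andrasfai_adj :: "nat \<Rightarrow> int \<Rightarrow> int \<Rightarrow> bool" where
  "andrasfai_adj k i j \<longleftrightarrow> (i - j) mod (3 * int k - 1) \<in> {int k .. 2 * int k - 1}"

datatype vega_vertex = Cyc int | Va | Vb | Vc | Vu | Vv | Vw | Vx | Vy

fun vega_adj0 :: "nat \<Rightarrow> vega_vertex \<Rightarrow> vega_vertex \<Rightarrow> bool" where
  "vega_adj0 i (Cyc p) (Cyc q) = andrasfai_adj i p q"
| "vega_adj0 i Va (Cyc q) = (0 \<le> q \<and> q \<le> int i - 1)"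
| "vega_adj0 i Vu (Cyc q) = (0 \<le> q \<and> q \<le> int i - 1)"
| "vega_adj0 i Vb (Cyc q) = (int i \<le> q \<and> q \<le> 2 * int i - 1)"
| "vega_adj0 i Vv (Cyc q) = (int i \<le> q \<and> q \<le> 2 * int i - 1)"
| "vega_adj0 i Vc (Cyc q) = (2 * int i \<le> q \<and> q \<le> 3 * int i - 2)"
| "vega_adj0 i Vw (Cyc q) = (2 * int i \<le> q \<and> q \<le> 3 * int i - 2)"
| "vega_adj0 i Va Vv = True"
| "vega_adj0 i Vv Vc = True"
| "vega_adj0 i Vc Vu = True"
| "vega_adj0 i Vu Vb = True"
| "vega_adj0 i Vb Vw = True"
| "vega_adj0 i Vw Va = True"
| "vega_adj0 i Vx Va = True"
| "vega_adj0 i Vx Vb = True"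
| "vega_adj0 i Vx Vc = True"
| "vega_adj0 i Vy Vu = True"
| "vega_adj0 i Vy Vv = True"
| "vega_adj0 i Vy Vw = True"
| "vega_adj0 i Vx Vy = True"
| "vega_adj0 i _ _ = False"

definition vega_adj :: "nat \<Rightarrow> vega_vertex \<Rightarrow> vega_vertex \<Rightarrow> bool" where
  "vega_adj i p q \<longleftrightarrow> vega_adj0 i p q \<or> vega_adj0 i q p"

definition vega_verts :: "nat \<Rightarrow> nat \<Rightarrow> nat \<Rightarrow> vega_vertex set" where
  "vega_verts i mu nu =
     ((Cyc ` {0..<3 * int i - 1}) \<union> {Va, Vb, Vc, Vu, Vv, Vw, Vx} \<union> (if mu = 0 then {Vy} else {}))
     - (if nu = 1 then {Cyc (2 * int i - 1)} else {})"

end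

theory Submission
  imports Defs
begin

text \<open>The density hypothesis enters only through averaging: for every finite multiset of vertices some
  vertex is adjacent to more than a third of it. If every independent triple has a common neighbour,
  averaging excludes induced cubes, hence every finite independent set has a common neighbour, and by Pach's theorem
  the graph is a blow-up of an Andrasfai graph (a largest embedded Andrasfai graph absorbs every vertex as
  a twin; the density bounds its size). Otherwise averaging produces a Grotzsch graph and then a hexagon
  on which every vertex has at least two neighbours. The neighbours on the hexagon determine all adjacencies
  except those among the three ranges of vertices joined to opposite hexagon vertices. Together with
  the twins of \<open>a\<close>, \<open>b\<close>, \<open>u\<close>, \<open>w\<close> on the hexagon \<open>a v c u b w\<close> these ranges again satisfy Pach's condition,
  and adding the remaining classes to the resulting Andrasfai graph gives a Vega graph.\<close>

section \<open>Refutation certificates for finite configurations\<close>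

text \<open>Neighbourhoods in the Andrasfai graph with parameter k have relative size k/(3k-1) >
  1/3, so averaging beyond a third cannot limit the parameter of an embedded Andrasfai graph. The
  limit comes from a real \<open>r\<close> strictly between 1/3 and the infimum: an embedding with
  parameter k forces r(3k-1) < k. What prevents a direct use of Pach's theorem is visible in the
  Vega graphs themselves. The set {i-1, i, x} is independent, but the common neighbours of i-1 and i
  lie in the third range, which contains no neighbour of x; the same holds for y. So x and y have to
  be set aside. Without x the set {a, b, c} has no common neighbour, and without y neither has {u,
  v, w}; this is why one vertex of each triple, c and v, is set aside as well. Which opposite pairs
  these two are taken from depends on an ordering of the three ranges, obtained from the relation
  \<open>lacking\<close>.\<close>

datatype idx = I0 | I1 | I2 | I3 | I4 | I5 | I6 | I7 | I8 | I9 | I10 | I11 | I12 | I13 | I14 | I15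

text \<open>A certificate is a case distinction refuting a finite configuration of vertices.
  \<^item> \<open>Split i j p q\<close>: \<open>i\<close> and \<open>j\<close> are adjacent in \<open>p\<close> and non-adjacent in \<open>q\<close>;
  \<^item> \<open>Common t i j\<close>: a new common neighbour \<open>t\<close> of the non-adjacent \<open>i\<close>, \<open>j\<close>;
  \<^item> \<open>Hex t xs ys p q\<close>: in an induced hexagon with colour classes \<open>xs\<close>, \<open>ys\<close>, one class has a common neighbour \<open>t\<close>;
  \<^item> \<open>Dens t L\<close>: a new vertex \<open>t\<close> adjacent to more than a third of the multiset \<open>L\<close>, where \<open>Few\<close> closes
    a branch in which the newest vertex has too many non-neighbours in \<open>L\<close> for this;
  \<^item> \<open>Und t\<close>: \<open>t\<close> dominates a set that is assumed undominated;
  \<^item> \<open>Ref k m\<close>: the already excluded pattern number \<open>k\<close> occurs at the vertices \<open>m\<close>.\<close>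

datatype cert =
    Split idx idx cert cert
  | Common idx idx idx cert
  | Hex idx "idx list" "idx list" cert cert
  | Dens idx "idx list" cert
  | Few
  | Und idx
  | Ref idx "idx list"

text \<open>A pattern lists required edges and required non-edges; a state consists of rows
  (vertex, known neighbours, known non-neighbours).\<close>

type_synonym pattern = "(idx \<times> idx) list \<times> (idx \<times> idx) list"
type_synonym state = "(idx \<times> idx list \<times> idx list) list"

text \<open>Nested conditionals stand for conjunctions here and below, so that symbolic evaluation
  stops at the first failing test.\<close>

fun mem :: "idx \<Rightarrow> idx list \<Rightarrow> bool" where
  "mem x [] = False"
| "mem x (y # ys) = (if x = y then True else mem x ys)"

fun nbs :: "state \<Rightarrow> idx \<Rightarrow> idx list" where
  "nbs [] i = []"
| "nbs ((j, N, M) # rs) i = (if i = j then N else nbs rs i)"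

fun nons :: "state \<Rightarrow> idx \<Rightarrow> idx list" where
  "nons [] i = []"
| "nons ((j, N, M) # rs) i = (if i = j then M else nons rs i)"

fun is_key :: "state \<Rightarrow> idx \<Rightarrow> bool" where
  "is_key [] i = False"
| "is_key ((j, N, M) # rs) i = (if i = j then True else is_key rs i)"

text \<open>Since the graph is triangle-free, a new edge makes each end non-adjacent to the neighbours of the other.\<close>

fun add_rows :: "idx \<Rightarrow> idx \<Rightarrow> idx list \<Rightarrow> idx list \<Rightarrow> state \<Rightarrow> state" where
  "add_rows i j Ni Nj [] = []"
| "add_rows i j Ni Nj ((k, N, M) # rs) =
     (if k = i then (k, j # N, Nj @ M)
      else if k = j then (k, i # N, Ni @ M)
      else if mem k Ni then (k, N, j # M)
      else if mem k Nj then (k, N, i # M)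
      else (k, N, M)) # add_rows i j Ni Nj rs"

definition add_edge :: "idx \<Rightarrow> idx \<Rightarrow> state \<Rightarrow> state" where
  "add_edge i j st = add_rows i j (nbs st i) (nbs st j) st"

fun add_non :: "idx \<Rightarrow> idx \<Rightarrow> state \<Rightarrow> state" where
  "add_non i j [] = []"
| "add_non i j ((k, N, M) # rs) =
     (if k = i then (k, N, j # M) else if k = j then (k, N, i # M) else (k, N, M)) # add_non i j rs"

fun add_edges :: "(idx \<times> idx) list \<Rightarrow> state \<Rightarrow> state" where
  "add_edges [] st = st"
| "add_edges ((i, j) # ps) st = add_edges ps (add_edge i j st)"

fun add_nons :: "(idx \<times> idx) list \<Rightarrow> state \<Rightarrow> state" where
  "add_nons [] st = st"
| "add_nons ((i, j) # ps) st = add_nons ps (add_non i j st)"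

fun filter_mem :: "idx list \<Rightarrow> idx list \<Rightarrow> idx list" where
  "filter_mem M [] = []"
| "filter_mem M (x # xs) = (if mem x M then x # filter_mem M xs else filter_mem M xs)"

fun no_shorter :: "idx list \<Rightarrow> idx list \<Rightarrow> bool" where
  "no_shorter xs [] = True"
| "no_shorter [] (y # ys) = False"
| "no_shorter (x # xs) (y # ys) = no_shorter xs ys"

text \<open>Lists serve as unary numbers here, so that evaluation needs no arithmetic.\<close>

definition few :: "idx list \<Rightarrow> idx list \<Rightarrow> bool" where
  "few M L = (let K = filter_mem M L in no_shorter (K @ K @ K) (L @ L))"

fun all_mem :: "idx list \<Rightarrow> idx list \<Rightarrow> bool" where
  "all_mem N [] = True"
| "all_mem N (x # xs) = (if mem x N then all_mem N xs else False)"

fun all_keys :: "state \<Rightarrow> idx list \<Rightarrow> bool" where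
  "all_keys st [] = True"
| "all_keys st (x # xs) = (if is_key st x then all_keys st xs else False)"

fun pairs_in :: "(idx \<Rightarrow> idx list) \<Rightarrow> (idx \<times> idx) list \<Rightarrow> bool" where
  "pairs_in g [] = True"
| "pairs_in g ((i, j) # ps) = (if mem j (g i) then pairs_in g ps else False)"

fun rename :: "idx list \<Rightarrow> idx list \<Rightarrow> idx \<Rightarrow> idx" where
  "rename (k # ks) (x # xs) i = (if i = k then x else rename ks xs i)"
| "rename _ _ i = i"

fun renamed_in :: "(idx \<Rightarrow> idx) \<Rightarrow> (idx \<Rightarrow> idx list) \<Rightarrow> (idx \<times> idx) list \<Rightarrow> bool" where
  "renamed_in r g [] = True"
| "renamed_in r g ((i, j) # ps) = (if mem (r j) (g (r i)) then renamed_in r g ps else False)"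

fun excluded :: "(idx \<times> pattern) list \<Rightarrow> idx \<Rightarrow> (idx \<Rightarrow> idx) \<Rightarrow> state \<Rightarrow> bool" where
  "excluded [] k r st = False"
| "excluded ((j, P) # env) k r st =
     (if k = j then (if renamed_in r (nbs st) (fst P) then renamed_in r (nons st) (snd P) else False)
      else excluded env k r st)"

fun dominated_in :: "idx list list \<Rightarrow> idx list \<Rightarrow> bool" where
  "dominated_in [] N = False"
| "dominated_in (u # us) N = (if all_mem N u then True else dominated_in us N)"

fun top_few :: "idx list \<Rightarrow> state \<Rightarrow> bool" where
  "top_few [] st = False"
| "top_few L [] = False"
| "top_few (x # L) ((k, N, M) # st) = few M (x # L)"

fun hex_ok :: "idx list \<Rightarrow> idx list \<Rightarrow> state \<Rightarrow> bool" where
  "hex_ok [x1, x2, x3] [y1, y2, y3] st =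
     (if pairs_in (nbs st) [(x1,y2),(x1,y3),(x2,y1),(x2,y3),(x3,y1),(x3,y2)]
      then pairs_in (nons st) [(x1,y1),(x2,y2),(x3,y3)] else False)"
| "hex_ok _ _ st = False"

fun add_star :: "idx \<Rightarrow> idx list \<Rightarrow> state \<Rightarrow> state" where
  "add_star t [] st = st"
| "add_star t (i # is) st = add_star t is (add_edge t i st)"

text \<open>\<open>L\<close> is the multiset of a preceding \<open>Dens\<close> whose vertex still
  heads the state. \<open>Common\<close> and \<open>Hex\<close> put another vertex at the head and
  hence continue with the empty list.\<close>

fun check :: "(idx \<times> pattern) list \<Rightarrow> idx list list \<Rightarrow> idx list \<Rightarrow> state \<Rightarrow> cert \<Rightarrow> bool" where
  "check env us L st (Split i j p q) =
     (if is_key st i then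
      if is_key st j then
      if check env us L (add_non i j st) q then
      if mem j (nons st i) then True else check env us L (add_edge i j st) p
      else False else False else False)"
| "check env us L st (Common t i j p) =
     (if is_key st t then False else
      if mem j (nons st i) then check env us [] (add_star t [i, j] ((t, [], []) # st)) p else False)"
| "check env us L st (Hex t xs ys p q) =
     (if is_key st t then False else
      if hex_ok xs ys st then
      if check env us [] (add_star t xs ((t, [], []) # st)) p then
        check env us [] (add_star t ys ((t, [], []) # st)) q else False else False)"
| "check env us L st (Dens t L' p) =
     (if is_key st t then False else
      if all_keys st L' then check env us L' ((t, [], []) # st) p else False)"
| "check env us L st Few = top_few L st"
| "check env us L st (Und t) = dominated_in us (nbs st t)"
| "check env us L st (Ref k m) =
     excluded env k (rename [I0, I1, I2, I3, I4, I5, I6, I7, I8, I9, I10, I11, I12] m) st"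

fun blank :: "idx list \<Rightarrow> state" where
  "blank [] = []"
| "blank (i # is) = (i, [], []) # blank is"

fun initial :: "idx list \<Rightarrow> pattern \<Rightarrow> state" where
  "initial vs (es, ns) = add_nons ns (add_edges es (blank vs))"

definition refutes :: "(idx \<times> pattern) list \<Rightarrow> idx list list \<Rightarrow> pattern \<Rightarrow> idx list \<Rightarrow> cert \<Rightarrow> bool" where
  "refutes env us P vs c = check env us [] (initial vs P) c"

text \<open>No injectivity is demanded: vertices may coincide wherever edges and non-edges allow it,
  so certificates never branch on equality.\<close>

definition occurs :: "('a \<Rightarrow> 'a \<Rightarrow> bool) \<Rightarrow> (idx \<Rightarrow> 'a) \<Rightarrow> pattern \<Rightarrow> bool" where
  "occurs E f p \<longleftrightarrow> (\<forall>(i, j) \<in> set (fst p). E (f i) (f j)) \<and> (\<forall>(i, j) \<in> set (snd p). \<not> E (f i) (f j))"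

definition avoids :: "('a \<Rightarrow> 'a \<Rightarrow> bool) \<Rightarrow> pattern \<Rightarrow> bool" where
  "avoids E P \<longleftrightarrow> (\<forall>f. \<not> occurs E f P)"

abbreviation keys :: "state \<Rightarrow> idx set" where "keys st \<equiv> fst ` set st"

text \<open>The inclusions in \<open>K\<close> keep rows from mentioning indices outside the state,
  so the placement may be changed freely at a fresh index.\<close>

definition row_ok :: "('a \<Rightarrow> 'a \<Rightarrow> bool) \<Rightarrow> (idx \<Rightarrow> 'a) \<Rightarrow> idx set \<Rightarrow> idx \<times> idx list \<times> idx list \<Rightarrow> bool" where
  "row_ok E f K r \<longleftrightarrow> (case r of (k, N, M) \<Rightarrow> set N \<subseteq> K \<and> set M \<subseteq> K \<and>
     (\<forall>j\<in>set N. E (f k) (f j)) \<and> (\<forall>j\<in>set M. \<not> E (f k) (f j)))"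

definition state_ok :: "('a \<Rightarrow> 'a \<Rightarrow> bool) \<Rightarrow> (idx \<Rightarrow> 'a) \<Rightarrow> state \<Rightarrow> bool" where
  "state_ok E f st \<longleftrightarrow> (\<forall>r\<in>set st. row_ok E f (keys st) r)"

section \<open>Soundness of the certificate checker\<close>

lemma mem_iff [simp]: "mem x xs \<longleftrightarrow> x \<in> set xs"
  by (induction xs) auto

lemma all_mem_iff [simp]: "all_mem N xs \<longleftrightarrow> set xs \<subseteq> set N"
  by (induction xs) auto

lemma is_key_iff [simp]: "is_key st i \<longleftrightarrow> i \<in> keys st"
  by (induction st) auto

lemma all_keys_iff [simp]: "all_keys st xs \<longleftrightarrow> set xs \<subseteq> keys st"
  by (induction xs) auto

lemma dominated_in_iff [simp]: "dominated_in us N \<longleftrightarrow> (\<exists>u\<in>set us. set u \<subseteq> set N)"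
  by (induction us) auto

lemma pairs_in_iff [simp]: "pairs_in g ps \<longleftrightarrow> (\<forall>(i, j)\<in>set ps. j \<in> set (g i))"
  by (induction g ps rule: pairs_in.induct) auto

lemma renamed_in_iff [simp]: "renamed_in r g ps \<longleftrightarrow> (\<forall>(i, j)\<in>set ps. r j \<in> set (g (r i)))"
  by (induction r g ps rule: renamed_in.induct) auto

lemma nbs_row: "j \<in> set (nbs st i) \<Longrightarrow> \<exists>N M. (i, N, M) \<in> set st \<and> j \<in> set N"
  by (induction st i rule: nbs.induct) (force split: if_splits)+

lemma nons_row: "j \<in> set (nons st i) \<Longrightarrow> \<exists>N M. (i, N, M) \<in> set st \<and> j \<in> set M"
  by (induction st i rule: nons.induct) (force split: if_splits)+

lemma state_ok_nbs: "state_ok E f st \<Longrightarrow> j \<in> set (nbs st i) \<Longrightarrow> E (f i) (f j) \<and> j \<in> keys st \<and> i \<in> keys st"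
  using nbs_row[of j st i] unfolding state_ok_def row_ok_def by force

lemma state_ok_nons: "state_ok E f st \<Longrightarrow> j \<in> set (nons st i) \<Longrightarrow> \<not> E (f i) (f j) \<and> j \<in> keys st \<and> i \<in> keys st"
  using nons_row[of j st i] unfolding state_ok_def row_ok_def by force

lemma map_fst_add_rows: "map fst (add_rows i j Ni Nj st) = map fst st"
  by (induction i j Ni Nj st rule: add_rows.induct) auto

lemma map_fst_add_non: "map fst (add_non i j st) = map fst st"
  by (induction i j st rule: add_non.induct) auto

lemma keys_add_rows [simp]: "keys (add_rows i j Ni Nj st) = keys st"
  using map_fst_add_rows[of i j Ni Nj st] by (metis list.set_map)

lemma keys_add_edge [simp]: "keys (add_edge i j st) = keys st"
  by (simp add: add_edge_def)

lemma keys_add_non [simp]: "keys (add_non i j st) = keys st"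
  using map_fst_add_non[of i j st] by (metis list.set_map)

lemma keys_add_star [simp]: "keys (add_star t is st) = keys st"
  by (induction "is" arbitrary: st) auto

lemma keys_add_edges [simp]: "keys (add_edges ps st) = keys st"
  by (induction ps st rule: add_edges.induct) simp_all

lemma keys_add_nons [simp]: "keys (add_nons ps st) = keys st"
  by (induction ps st rule: add_nons.induct) simp_all

lemma keys_blank [simp]: "keys (blank vs) = set vs"
  by (induction vs) auto

lemma state_ok_blank: "state_ok E f (blank vs)"
proof -
  have "r \<in> set (blank vs) \<Longrightarrow> \<exists>i. r = (i, [], [])" for r
    by (induction vs) auto
  then show ?thesis by (fastforce simp: state_ok_def row_ok_def)
qed

text \<open>Loops are excluded by \<open>triangle_free\<close> with three equal vertices. With
  \<open>u = v\<close>, \<open>common\<close> says that no vertex is isolated. Repetitions in the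
  list of \<open>dense\<close> act as integer weights.\<close>

locale dense_maximal_graph =
  fixes E :: "'a \<Rightarrow> 'a \<Rightarrow> bool"
  assumes sym: "E u v \<Longrightarrow> E v u"
    and triangle_free: "E u v \<Longrightarrow> E v w \<Longrightarrow> E u w \<Longrightarrow> False"
    and common: "\<not> E u v \<Longrightarrow> \<exists>w. E w u \<and> E w v"
    and dense: "L \<noteq> [] \<Longrightarrow> \<exists>t. length L < 3 * length (filter (E t) L)"
begin

lemma row_ok_add_rows:
  assumes E: "E (f i) (f j)" and ij: "i \<in> K" "j \<in> K"
    and Ni: "\<forall>k\<in>set Ni. E (f i) (f k) \<and> k \<in> K" and Nj: "\<forall>k\<in>set Nj. E (f j) (f k) \<and> k \<in> K"
    and ok: "\<forall>r\<in>set st. row_ok E f K r" and r: "r \<in> set (add_rows i j Ni Nj st)"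
  shows "row_ok E f K r"
  using ok r
proof (induction st)
  case (Cons r' st)
  obtain k N M where r': "r' = (k, N, M)" by (cases r')
  have k: "row_ok E f K (k, N, M)" using Cons.prems r' by simp
  have E': "E (f j) (f i)" using E sym by blast
  have Mi: "\<not> E (f i) (f l)" if "l \<in> set Nj" for l
    using that Nj triangle_free[of "f i" "f j" "f l"] E by blast
  have Mj: "\<not> E (f j) (f l)" if "l \<in> set Ni" for l
    using that Ni triangle_free[of "f j" "f i" "f l"] E' by blast
  have si: "\<not> E (f l) (f j)" if "l \<in> set Ni" for l using Mj[OF that] sym by blast
  have sj: "\<not> E (f l) (f i)" if "l \<in> set Nj" for l using Mi[OF that] sym by blast
  consider "r \<in> set (add_rows i j Ni Nj st)" |
     "r = (if k = i then (k, j # N, Nj @ M)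
      else if k = j then (k, i # N, Ni @ M)
      else if mem k Ni then (k, N, j # M)
      else if mem k Nj then (k, N, i # M)
      else (k, N, M))"
    using Cons.prems(2) r' by auto
  then show ?case
  proof cases
    case 1 then show ?thesis using Cons by auto
  next
    case 2
    then show ?thesis using k ij Ni Nj E E' Mi Mj si sj by (auto simp: row_ok_def split: if_splits)
  qed
qed simp

lemma state_ok_add_edge:
  assumes "state_ok E f st" "E (f i) (f j)" "i \<in> keys st" "j \<in> keys st"
  shows "state_ok E f (add_edge i j st)"
  unfolding state_ok_def keys_add_edge
proof
  fix r assume "r \<in> set (add_edge i j st)"
  then have r: "r \<in> set (add_rows i j (nbs st i) (nbs st j) st)" by (simp add: add_edge_def)
  show "row_ok E f (keys st) r"
  proof (rule row_ok_add_rows[OF assms(2,3,4) _ _ _ r])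
    show "\<forall>k\<in>set (nbs st i). E (f i) (f k) \<and> k \<in> keys st"
      and "\<forall>k\<in>set (nbs st j). E (f j) (f k) \<and> k \<in> keys st"
      using state_ok_nbs[OF assms(1)] by blast+
    show "\<forall>r\<in>set st. row_ok E f (keys st) r" using assms(1) by (simp add: state_ok_def)
  qed
qed

lemma state_ok_add_non:
  assumes "state_ok E f st" "\<not> E (f i) (f j)" "i \<in> keys st" "j \<in> keys st"
  shows "state_ok E f (add_non i j st)"
proof -
  have ji: "\<not> E (f j) (f i)" using assms(2) sym by blast
  have "row_ok E f K r"
    if "\<forall>r\<in>set st. row_ok E f K r" "r \<in> set (add_non i j st)" "i \<in> K" "j \<in> K" for r K and st :: state
    using that
  proof (induction st)
    case (Cons r' st)
    obtain k N M where "r' = (k, N, M)" by (cases r')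
    then show ?case using Cons assms(2) ji by (auto simp: row_ok_def split: if_splits)
  qed simp
  then show ?thesis using assms unfolding state_ok_def keys_add_non by blast
qed

lemma state_ok_add_star:
  assumes "state_ok E f st" "\<forall>i\<in>set is. E (f t) (f i) \<and> i \<in> keys st" "t \<in> keys st"
  shows "state_ok E f (add_star t is st)"
  using assms by (induction "is" arbitrary: st) (simp_all add: state_ok_add_edge)

lemma state_ok_fresh:
  assumes "state_ok E f st" "t \<notin> keys st"
  shows "state_ok E (f(t := w)) ((t, [], []) # st)"
  unfolding state_ok_def
proof
  fix r assume r: "r \<in> set ((t, [], []) # st)"
  obtain k N M where kr: "r = (k, N, M)" by (cases r)
  show "row_ok E (f(t := w)) (keys ((t, [], []) # st)) r"
  proof (cases "r = (t, [], [])")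
    case False
    then have rs: "r \<in> set st" using r by simp
    then have ok: "row_ok E f (keys st) (k, N, M)" using assms(1) kr by (simp add: state_ok_def)
    have "k \<in> keys st" using rs kr by force
    then have "k \<noteq> t" using assms(2) by blast
    moreover have "j \<noteq> t" if "j \<in> set N \<union> set M" for j
      using that ok assms(2) by (auto simp: row_ok_def simp del: image_eqI)
    ultimately show ?thesis using ok unfolding kr row_ok_def by simp blast
  qed (simp add: row_ok_def)
qed

definition top_ok :: "(idx \<Rightarrow> 'a) \<Rightarrow> idx list \<Rightarrow> state \<Rightarrow> bool" where
  "top_ok f L st \<longleftrightarrow> L = [] \<or> st \<noteq> [] \<and> length L < 3 * length (filter (\<lambda>i. E (f (fst (hd st))) (f i)) L)"

definition undominated :: "'a set \<Rightarrow> bool" where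
  "undominated S \<longleftrightarrow> \<not> (\<exists>t. \<forall>s\<in>S. E t s)"

lemma filter_mem_eq: "filter_mem M L = filter (\<lambda>x. x \<in> set M) L"
  by (induction L) auto

lemma no_shorter_iff: "no_shorter xs ys \<longleftrightarrow> length ys \<le> length xs"
  by (induction xs ys rule: no_shorter.induct) auto

text \<open>When two thirds of \<open>L\<close> are known non-neighbours, at most a third is left
  for neighbours, and the inequality in \<open>dense\<close> is strict.\<close>

lemma few_contradiction:
  assumes "few M L" "\<forall>j\<in>set M. \<not> Q j" "length L < 3 * length (filter Q L)"
  shows False
proof -
  have "length (filter (\<lambda>x. x \<in> set M) L) \<le> length (filter (\<lambda>x. \<not> Q x) L)"
    using assms(2) by (induction L) auto
  moreover have "length (filter Q L) + length (filter (\<lambda>x. \<not> Q x) L) = length L"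
    by (rule sum_length_filter_compl)
  moreover have "2 * length L \<le> 3 * length (filter (\<lambda>x. x \<in> set M) L)"
    using assms(1) by (simp add: few_def Let_def no_shorter_iff filter_mem_eq)
  ultimately show False using assms(3) by linarith
qed

lemma top_ok_add:
  "map fst st' = map fst st \<Longrightarrow> top_ok f L st' = top_ok f L st"
  unfolding top_ok_def by (cases st; cases st') auto

text \<open>A vertex adjacent to more than a third of the six vertices of a hexagon is adjacent to a whole colour class.\<close>

lemma triple_common:
  assumes "E x1 y2" "E x1 y3" "E x2 y1" "E x2 y3" "E x3 y1" "E x3 y2"
  shows "(\<exists>t. E t x1 \<and> E t x2 \<and> E t x3) \<or> (\<exists>t. E t y1 \<and> E t y2 \<and> E t y3)"
proof -
  obtain t where t: "length [x1,x2,x3,y1,y2,y3] < 3 * length (filter (E t) [x1,x2,x3,y1,y2,y3])"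
    using dense[of "[x1,x2,x3,y1,y2,y3]"] by blast
  have "\<not> (E t x \<and> E t y)" if "E x y" for x y
    using that triangle_free[of x y t] sym by blast
  from this[OF assms(1)] this[OF assms(2)] this[OF assms(3)] this[OF assms(4)] this[OF assms(5)] this[OF assms(6)]
  show ?thesis using t by (auto split: if_splits)
qed

lemma excluded_pairs:
  "excluded env k r st \<Longrightarrow>
     \<exists>P\<in>snd ` set env. renamed_in r (nbs st) (fst P) \<and> renamed_in r (nons st) (snd P)"
proof (induction env)
  case (Cons e env)
  obtain j P where "e = (j, P)" by (cases e)
  then show ?case using Cons
    by (auto simp del: renamed_in_iff split: if_splits)
qed simp

lemma fresh_us:
  assumes "\<forall>u\<in>set us. set u \<subseteq> keys st \<and> undominated (f ` set u)" "t \<notin> keys st"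
  shows "\<forall>u\<in>set us. set u \<subseteq> keys ((t, [], []) # st) \<and> undominated ((f(t := w)) ` set u)"
proof
  fix u assume u: "u \<in> set us"
  have "(f(t := w)) ` set u = f ` set u" using assms u by (intro image_cong) auto
  then show "set u \<subseteq> keys ((t, [], []) # st) \<and> undominated ((f(t := w)) ` set u)"
    using assms(1) u by auto
qed

text \<open>Each node is a sound inference: excluded middle for \<open>Split\<close>,
  \<open>common\<close> for \<open>Common\<close>, \<open>triple_common\<close> for
  \<open>Hex\<close>, \<open>dense\<close> for \<open>Dens\<close>. The placement is arbitrary in
  the induction because new vertices extend it.\<close>

theorem check_sound:
  assumes "check env us L st c" "\<forall>(k, P)\<in>set env. avoids E P"
    and "state_ok E f st" "top_ok f L st"
    and "\<forall>u\<in>set us. set u \<subseteq> keys st \<and> undominated (f ` set u)"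
  shows False
  using assms
proof (induction c arbitrary: L st f)
  case (Split i j p q)
  have k: "i \<in> keys st" "j \<in> keys st" using Split.prems(1) by (auto split: if_splits)
  show ?case
  proof (cases "E (f i) (f j)")
    case True
    have "j \<notin> set (nons st i)" using True state_ok_nons[OF Split.prems(3)] by blast
    then have "check env us L (add_edge i j st) p" using Split.prems(1) by (auto split: if_splits)
    moreover have "top_ok f L (add_edge i j st)"
      using Split.prems(4) top_ok_add[of "add_edge i j st" st] by (simp add: add_edge_def map_fst_add_rows)
    moreover have "\<forall>u\<in>set us. set u \<subseteq> keys (add_edge i j st) \<and> undominated (f ` set u)"
      using Split.prems(5) by (simp only: keys_add_edge)
    ultimately show False
      using Split.IH(1) Split.prems(2) state_ok_add_edge[OF Split.prems(3) True k] by blast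
  next
    case False
    have "check env us L (add_non i j st) q" using Split.prems(1) by (auto split: if_splits)
    moreover have "top_ok f L (add_non i j st)"
      using Split.prems(4) top_ok_add[of "add_non i j st" st] by (simp add: map_fst_add_non)
    moreover have "\<forall>u\<in>set us. set u \<subseteq> keys (add_non i j st) \<and> undominated (f ` set u)"
      using Split.prems(5) by (simp only: keys_add_non)
    ultimately show False
      using Split.IH(2) Split.prems(2) state_ok_add_non[OF Split.prems(3) False k] by blast
  qed
next
  case (Common t i j p)
  have t: "t \<notin> keys st" and ij: "j \<in> set (nons st i)"
    and c: "check env us [] (add_star t [i, j] ((t, [], []) # st)) p"
    using Common.prems(1) by (auto split: if_splits)
  have n: "\<not> E (f i) (f j)" "i \<in> keys st" "j \<in> keys st" using state_ok_nons[OF Common.prems(3) ij] by auto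
  obtain w where w: "E w (f i)" "E w (f j)" using common[OF n(1)] by blast
  let ?f = "f(t := w)"
  have it: "i \<noteq> t" "j \<noteq> t" using n t by auto
  have ok: "state_ok E ?f (add_star t [i, j] ((t, [], []) # st))"
    by (rule state_ok_add_star[OF state_ok_fresh[OF Common.prems(3) t]]) (use w it n in auto)
  have us: "\<forall>u\<in>set us. set u \<subseteq> keys (add_star t [i, j] ((t, [], []) # st)) \<and> undominated (?f ` set u)"
    using fresh_us[OF Common.prems(5) t] unfolding keys_add_star by auto
  show False
    by (rule Common.IH[OF c Common.prems(2) ok _ us]) (simp add: top_ok_def)
next
  case (Hex t xs ys p q)
  have t: "t \<notin> keys st" and h: "hex_ok xs ys st"
    and c1: "check env us [] (add_star t xs ((t, [], []) # st)) p"
    and c2: "check env us [] (add_star t ys ((t, [], []) # st)) q"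
    using Hex.prems(1) by (auto split: if_splits)
  from h obtain x1 x2 x3 y1 y2 y3 where xy: "xs = [x1, x2, x3]" "ys = [y1, y2, y3]"
    by (cases "(xs, ys, st)" rule: hex_ok.cases) auto
  note nb = state_ok_nbs[OF Hex.prems(3)]
  have e: "y2 \<in> set (nbs st x1)" "y3 \<in> set (nbs st x1)" "y1 \<in> set (nbs st x2)" "y3 \<in> set (nbs st x2)"
     "y1 \<in> set (nbs st x3)" "y2 \<in> set (nbs st x3)"
    using h xy by (auto split: if_splits)
  have ks: "set xs \<subseteq> keys st" "set ys \<subseteq> keys st"
    using nb[OF e(1)] nb[OF e(2)] nb[OF e(3)] nb[OF e(4)] nb[OF e(5)] nb[OF e(6)] xy by auto
  have "(\<exists>w. \<forall>i\<in>set xs. E w (f i)) \<or> (\<exists>w. \<forall>i\<in>set ys. E w (f i))"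
    using triple_common[of "f x1" "f y2" "f y3" "f x2" "f y1" "f x3"] nb[OF e(1)] nb[OF e(2)] nb[OF e(3)]
       nb[OF e(4)] nb[OF e(5)] nb[OF e(6)] xy by auto
  then obtain w zs where w: "\<forall>i\<in>set zs. E w (f i)" "zs = xs \<or> zs = ys" by blast
  let ?f = "f(t := w)"
  have it: "\<forall>i\<in>set zs. i \<noteq> t \<and> i \<in> keys st" using w ks t by auto
  have ok: "state_ok E ?f (add_star t zs ((t, [], []) # st))"
    by (rule state_ok_add_star[OF state_ok_fresh[OF Hex.prems(3) t]]) (use w it in auto)
  have us: "\<forall>u\<in>set us. set u \<subseteq> keys (add_star t zs ((t, [], []) # st)) \<and> undominated (?f ` set u)"
    using fresh_us[OF Hex.prems(5) t] unfolding keys_add_star by auto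
  have top: "top_ok ?f [] (add_star t zs ((t, [], []) # st))" by (simp add: top_ok_def)
  from w(2) show False
    using Hex.IH(1)[OF c1 Hex.prems(2), of ?f] Hex.IH(2)[OF c2 Hex.prems(2), of ?f] ok us top by blast
next
  case (Dens t L' p)
  have t: "t \<notin> keys st" and L: "set L' \<subseteq> keys st" and c: "check env us L' ((t, [], []) # st) p"
    using Dens.prems(1) by (auto split: if_splits)
  have "\<exists>w. L' = [] \<or> length (map f L') < 3 * length (filter (E w) (map f L'))"
  proof (cases "L' = []")
    case False
    then have "map f L' \<noteq> []" by simp
    from dense[OF this] show ?thesis by blast
  qed simp
  then obtain w where w: "L' = [] \<or> length (map f L') < 3 * length (filter (E w) (map f L'))" by blast
  let ?f = "f(t := w)"
  have "filter (\<lambda>i. E w (?f i)) L' = filter (\<lambda>i. E w (f i)) L'"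
    using L t by (intro filter_cong) auto
  then have top: "top_ok ?f L' ((t, [], []) # st)"
    using w by (simp add: top_ok_def filter_map o_def)
  show False
    using Dens.IH[OF c Dens.prems(2) state_ok_fresh[OF Dens.prems(3) t] top] fresh_us[OF Dens.prems(5) t] by blast
next
  case Few
  obtain x L' where L: "L = x # L'" using Few.prems(1) by (cases L) auto
  obtain r st' where "st = r # st'" using Few.prems(1) L by (cases st) auto
  then obtain k N M where st: "st = (k, N, M) # st'" by (cases r) auto
  have fw: "few M L" using Few.prems(1) L st by simp
  have "\<forall>j\<in>set M. \<not> E (f k) (f j)"
    using Few.prems(3) st by (simp add: state_ok_def row_ok_def)
  moreover have "length L < 3 * length (filter (\<lambda>i. E (f k) (f i)) L)"
    using Few.prems(4) L st by (simp add: top_ok_def)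
  ultimately show False by (rule few_contradiction[OF fw])
next
  case (Und t)
  then obtain u where u: "u \<in> set us" "set u \<subseteq> set (nbs st t)" by auto
  then have "\<forall>s\<in>f ` set u. E (f t) s" using state_ok_nbs[OF Und.prems(3)] by blast
  then show False using Und.prems(5) u(1) unfolding undominated_def by blast
next
  case (Ref k m)
  define r where "r = rename [I0, I1, I2, I3, I4, I5, I6, I7, I8, I9, I10, I11, I12] m"
  from Ref.prems(1) have "excluded env k r st" by (simp add: r_def)
  from excluded_pairs[OF this] obtain P where P: "P \<in> snd ` set env"
    and e: "renamed_in r (nbs st) (fst P)" and n: "renamed_in r (nons st) (snd P)"
    by (elim bexE conjE)
  have "E (f (r i)) (f (r j))" if "(i, j) \<in> set (fst P)" for i j
    using state_ok_nbs[OF Ref.prems(3), of "r j" "r i"] e that by auto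
  moreover have "\<not> E (f (r i)) (f (r j))" if "(i, j) \<in> set (snd P)" for i j
    using state_ok_nons[OF Ref.prems(3), of "r j" "r i"] n that by auto
  ultimately have "occurs E (f \<circ> r) P" unfolding occurs_def by auto
  moreover from P obtain l where "(l, P) \<in> set env" by force
  then have "avoids E P" using Ref.prems(2) by blast
  ultimately show False unfolding avoids_def by blast
qed

lemma state_ok_add_edges:
  assumes "state_ok E f st" "\<forall>(i, j)\<in>set es. E (f i) (f j) \<and> i \<in> keys st \<and> j \<in> keys st"
  shows "state_ok E f (add_edges es st)"
  using assms
proof (induction es arbitrary: st)
  case (Cons p ps)
  obtain i j where p: "p = (i, j)" by (cases p)
  have ij: "E (f i) (f j) \<and> i \<in> keys st \<and> j \<in> keys st"
    using bspec[OF Cons.prems(2), of p] p by simp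
  have "state_ok E f (add_edge i j st)"
    using state_ok_add_edge[OF Cons.prems(1)] ij by blast
  from Cons.IH[OF this] show ?case
    using Cons.prems(2) unfolding p add_edges.simps keys_add_edge by simp
qed simp

lemma state_ok_add_nons:
  assumes "state_ok E f st" "\<forall>(i, j)\<in>set ns. \<not> E (f i) (f j) \<and> i \<in> keys st \<and> j \<in> keys st"
  shows "state_ok E f (add_nons ns st)"
  using assms
proof (induction ns arbitrary: st)
  case (Cons p ps)
  obtain i j where p: "p = (i, j)" by (cases p)
  have ij: "\<not> E (f i) (f j) \<and> i \<in> keys st \<and> j \<in> keys st"
    using bspec[OF Cons.prems(2), of p] p by simp
  have "state_ok E f (add_non i j st)"
    using state_ok_add_non[OF Cons.prems(1)] ij by blast
  from Cons.IH[OF this] show ?case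
    using Cons.prems(2) unfolding p add_nons.simps keys_add_non by simp
qed simp

lemma refutes_sound:
  assumes "refutes env us P vs c" "\<forall>(k, P)\<in>set env. avoids E P"
    and "\<forall>u\<in>set us. set u \<subseteq> set vs" "\<forall>(i, j)\<in>set (fst P) \<union> set (snd P). i \<in> set vs \<and> j \<in> set vs"
    and "\<forall>u\<in>set us. undominated (f ` set u)"
  shows "\<not> occurs E f P"
proof
  assume o: "occurs E f P"
  obtain es ns where P: "P = (es, ns)" by (cases P)
  have "state_ok E f (add_edges es (blank vs))"
    by (rule state_ok_add_edges[OF state_ok_blank]) (use o P assms(4) in \<open>auto simp: occurs_def\<close>)
  then have "state_ok E f (initial vs P)"
    unfolding P initial.simps
    by (rule state_ok_add_nons) (use o P assms(4) in \<open>auto simp: occurs_def\<close>)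
  moreover have "keys (initial vs P) = set vs" by (simp add: P)
  ultimately show False
    using check_sound[of env us "[]" "initial vs P" c f] assms by (auto simp: refutes_def top_ok_def)
qed

lemma avoids_by_refutation:
  assumes "refutes env [] P vs c" "\<forall>(k, P)\<in>set env. avoids E P"
    and "\<forall>(i, j)\<in>set (fst P) \<union> set (snd P). i \<in> set vs \<and> j \<in> set vs"
  shows "avoids E P"
  using refutes_sound[OF assms(1,2) _ assms(3)] by (simp add: avoids_def)

end

section \<open>Excluded configurations\<close>

definition with_vertex :: "idx \<Rightarrow> idx list \<Rightarrow> idx list \<Rightarrow> pattern \<Rightarrow> pattern" where
  "with_vertex z N M P = (fst P @ map (Pair z) N, snd P @ map (Pair z) M)"

text \<open>The complete bipartite graph between \<open>I0\<close> to \<open>I3\<close> and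
  \<open>I4\<close> to \<open>I7\<close> minus a perfect matching is the graph of the 3-cube; the
  matched pairs are its antipodes.\<close>

definition cube :: pattern where
  "cube = ([(I0, I5), (I0, I6), (I0, I7), (I1, I4), (I1, I6), (I1, I7), (I2, I4), (I2, I5), (I2, I7), (I3, I4), (I3, I5), (I3, I6)], [(I0, I4), (I1, I5), (I2, I6), (I3, I7)])"

text \<open>\<open>I8\<close> to \<open>I11\<close> are common neighbours of the four antipodal
  pairs; maximality provides them.\<close>

definition cube_paths :: pattern where
  "cube_paths = (fst cube @ [(I8, I0), (I9, I1), (I10, I2), (I11, I3), (I8, I4), (I9, I5), (I10, I6), (I11, I7)], snd cube)"

definition cube_star :: pattern where
  "cube_star = (fst cube_paths @ [(I11, I8), (I11, I9), (I11, I10)], snd cube)"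

definition cube_square :: pattern where
  "cube_square = (fst cube_paths @ [(I8, I10), (I8, I11), (I9, I10), (I9, I11)], snd cube)"

text \<open>The former neighbours \<open>I6\<close>, \<open>I7\<close>, \<open>I8\<close> of the
  removed vertex are each joined to a pair of opposite vertices of the remaining hexagon.\<close>

definition petersen_minus_vertex :: pattern where
  "petersen_minus_vertex = ([(I0, I4), (I0, I5), (I1, I3), (I1, I5), (I2, I3), (I2, I4), (I6, I0), (I7, I1), (I8, I2), (I6, I3), (I7, I4), (I8, I5)], [(I6, I7), (I6, I8), (I7, I8)])"

definition petersen_plus_one :: pattern where
  "petersen_plus_one = with_vertex I9 [I7, I8, I0, I3] [] petersen_minus_vertex"

definition petersen_plus_two :: pattern where
  "petersen_plus_two = with_vertex I10 [I2, I5, I7] [I6] petersen_plus_one"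

text \<open>Refuted under the assumption that its class \<open>I0\<close>, \<open>I1\<close>, \<open>I2\<close> is undominated.\<close>

definition hexagon :: pattern where
  "hexagon = ([(I0, I4), (I0, I5), (I1, I3), (I1, I5), (I2, I3), (I2, I4)], [(I0, I3), (I1, I4), (I2, I5)])"

text \<open>Hub \<open>I0\<close>, pentagon \<open>I1\<close> to \<open>I5\<close> (called \<open>c0\<close> to \<open>c4\<close> below) and its copies \<open>I6\<close> to \<open>I10\<close>
  (called \<open>s0\<close> to \<open>s4\<close>), which are adjacent to the hub \<open>o\<close>. The patterns \<open>type_...\<close> add a vertex
  \<open>I11\<close> with exactly the named neighbours; up to symmetry and consequences of \<open>cube\<close> and
  \<open>petersen_minus_vertex\<close>, the first eleven are all neighbourhoods that never occur.\<close>

definition grotzsch :: pattern where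
  "grotzsch = ([(I0, I6), (I0, I7), (I0, I8), (I0, I9), (I0, I10), (I1, I2), (I1, I5), (I1, I7), (I1, I10), (I2, I3), (I2, I6), (I2, I8), (I3, I4), (I3, I7), (I3, I9), (I4, I5), (I4, I8), (I4, I10), (I5, I6), (I5, I9)], [])"

text \<open>Any two non-adjacent vertices of the Grotzsch graph have a common neighbour, so
  \<open>grotzsch\<close> lists no non-edges. Likewise these patterns list only those non-edges of
  \<open>I11\<close> that no triangle forces.\<close>

definition type_s0_s1 :: pattern where
  "type_s0_s1 = with_vertex I11 [I6, I7] [I4, I8, I9, I10] grotzsch"

definition type_s0_s1_s2 :: pattern where
  "type_s0_s1_s2 = with_vertex I11 [I6, I7, I8] [I9, I10] grotzsch"

definition type_s0_s1_s2_s3 :: pattern where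
  "type_s0_s1_s2_s3 = with_vertex I11 [I6, I7, I8, I9] [I10] grotzsch"

definition type_s0_s1_s3 :: pattern where
  "type_s0_s1_s3 = with_vertex I11 [I6, I7, I9] [I4, I8, I10] grotzsch"

definition type_s0_s2 :: pattern where
  "type_s0_s2 = with_vertex I11 [I6, I8] [I1, I3, I7, I9, I10] grotzsch"

definition type_c0_s0 :: pattern where
  "type_c0_s0 = with_vertex I11 [I1, I6] [I3, I4, I8, I9] grotzsch"

definition type_c0_c2 :: pattern where
  "type_c0_c2 = with_vertex I11 [I1, I3] [I0, I6, I8] grotzsch"

definition type_s0 :: pattern where
  "type_s0 = with_vertex I11 [I6] [I1, I3, I4, I7, I8, I9, I10] grotzsch"

definition type_c0 :: pattern where
  "type_c0 = with_vertex I11 [I1] [I0, I3, I4, I6, I8, I9] grotzsch"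

definition type_empty :: pattern where
  "type_empty = with_vertex I11 [] [I0, I1, I2, I3, I4, I5, I6, I7, I8, I9, I10] grotzsch"

definition type_o :: pattern where
  "type_o = with_vertex I11 [I0] [I1, I2, I3, I4, I5] grotzsch"

text \<open>This pattern and the next two are excluded under the additional hypothesis that
  \<open>grotzsch_plus_two\<close> is avoided.\<close>

definition type_c0_s0_s2 :: pattern where
  "type_c0_s0_s2 = with_vertex I11 [I1, I6, I8] [I3, I9] grotzsch"

definition type_c0_c2_s0 :: pattern where
  "type_c0_c2_s0 = with_vertex I11 [I1, I3, I6] [I8] grotzsch"

definition type_o_c0 :: pattern where
  "type_o_c0 = with_vertex I11 [I0, I1] [I3, I4] grotzsch"

text \<open>This graph only fits into Vega graphs with parameter at least three, and it determines the hexagon there.\<close>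

definition grotzsch_plus_two :: pattern where
  "grotzsch_plus_two = with_vertex I12 [I3, I8, I10, I6] [] (with_vertex I11 [I1, I6, I8, I9] [] grotzsch)"

text \<open>With the hexagon \<open>a v c u b w\<close> of this graph: a vertex whose only neighbour on it is \<open>p\<close> (\<open>few_A_p\<close>), and an edge
  between vertices attached like opposite hexagon vertices (\<open>cross_A_p\<close>).\<close>

definition few_A_a :: pattern where
  "few_A_a = with_vertex I13 [] [I1, I3, I2, I9, I10] grotzsch_plus_two"

definition few_A_b :: pattern where
  "few_A_b = with_vertex I13 [] [I0, I3, I2, I9, I10] grotzsch_plus_two"

definition few_A_c :: pattern where
  "few_A_c = with_vertex I13 [] [I0, I1, I2, I9, I10] grotzsch_plus_two"

definition few_A_u :: pattern where
  "few_A_u = with_vertex I13 [] [I0, I1, I3, I9, I10] grotzsch_plus_two"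

definition few_A_v :: pattern where
  "few_A_v = with_vertex I13 [] [I0, I1, I3, I2, I10] grotzsch_plus_two"

definition few_A_w :: pattern where
  "few_A_w = with_vertex I13 [] [I0, I1, I3, I2, I9] grotzsch_plus_two"

definition cross_A_a :: pattern where
  "cross_A_a = with_vertex I14 [I13, I1, I3] [I0] (with_vertex I13 [I9, I10] [I2] grotzsch_plus_two)"

definition cross_A_b :: pattern where
  "cross_A_b = with_vertex I14 [I13, I0, I3] [I1] (with_vertex I13 [I2, I10] [I9] grotzsch_plus_two)"

definition cross_A_c :: pattern where
  "cross_A_c = with_vertex I14 [I13, I0, I1] [I3] (with_vertex I13 [I2, I9] [I10] grotzsch_plus_two)"

text \<open>The same for the hexagon of a Grotzsch graph in a graph avoiding \<^const>\<open>grotzsch_plus_two\<close>, where three corners of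
  the Grotzsch graph are assumed undominated.\<close>

definition few_B_a :: pattern where
  "few_B_a = with_vertex I11 [] [I1, I4, I5, I8, I7] grotzsch"

definition few_B_b :: pattern where
  "few_B_b = with_vertex I11 [] [I0, I4, I5, I8, I7] grotzsch"

definition few_B_c :: pattern where
  "few_B_c = with_vertex I11 [] [I0, I1, I5, I8, I7] grotzsch"

definition few_B_u :: pattern where
  "few_B_u = with_vertex I11 [] [I0, I1, I4, I8, I7] grotzsch"

definition few_B_v :: pattern where
  "few_B_v = with_vertex I11 [] [I0, I1, I4, I5, I7] grotzsch"

definition few_B_w :: pattern where
  "few_B_w = with_vertex I11 [] [I0, I1, I4, I5, I8] grotzsch"

definition cross_B_a :: pattern where
  "cross_B_a = with_vertex I12 [I11, I1, I4] [I0] (with_vertex I11 [I8, I7] [I5] grotzsch)"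

definition cross_B_b :: pattern where
  "cross_B_b = with_vertex I12 [I11, I0, I4] [I1] (with_vertex I11 [I5, I7] [I8] grotzsch)"

definition cross_B_c :: pattern where
  "cross_B_c = with_vertex I12 [I11, I0, I1] [I4] (with_vertex I11 [I5, I8] [I7] grotzsch)"


text \<open>Single letters abbreviate vertices and certificate nodes. The certificates were found by computer search.\<close>

abbreviation (input) "a \<equiv> I0"
abbreviation (input) "b \<equiv> I1"
abbreviation (input) "c \<equiv> I2"
abbreviation (input) "d \<equiv> I3"
abbreviation (input) "e \<equiv> I4"
abbreviation (input) "f \<equiv> I5"
abbreviation (input) "g \<equiv> I6"
abbreviation (input) "h \<equiv> I7"
abbreviation (input) "i \<equiv> I8"
abbreviation (input) "j \<equiv> I9"
abbreviation (input) "k \<equiv> I10"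
abbreviation (input) "l \<equiv> I11"
abbreviation (input) "m \<equiv> I12"
abbreviation (input) "n \<equiv> I13"
abbreviation (input) "p \<equiv> I14"
abbreviation (input) "q \<equiv> I15"
abbreviation (input) "S \<equiv> Split"
abbreviation (input) "C \<equiv> Common"
abbreviation (input) "H \<equiv> Hex"
abbreviation (input) "D \<equiv> Dens"
abbreviation (input) "F \<equiv> Few"
abbreviation (input) "U \<equiv> Und"
abbreviation (input) "R \<equiv> Ref"

section \<open>Certificates for the excluded patterns\<close>

lemma refutes_cube_square:
  "refutes []
    [] cube_square
    [l,k,j,i,h,g,f,e,d,c,b,a]
   (D m [a,b,c,d,e,f,g,h,i,j,k,l] (S m a (S m e (S m j F F) (S m j F (S m c (S m d F F) (S m d F F)))) (S m c (S m l F (S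
m b F (S m d F F))) (S m b (S m d F (S m i F F)) (S m d (S m k F F) (S m i (S m f F F) (S m j F (S m g (S m h F F) (S
m h F F)))))))))"
  by code_simp

lemma refutes_cube_star:
  "refutes [(a,cube_square)]
    [] cube_star
    [l,k,j,i,h,g,f,e,d,c,b,a]
   (D m [a,b,c,e,f,g,i,j,k] (S m a (S m e (S m j (S m k (R a [b,c,a,d,f,g,e,h,j,k,m,l]) F) F) (S m j (S m c F F) (S m k F
F))) (S m b (S m c F (S m f (S m i (S m k (R a [a,c,b,d,e,g,f,h,i,k,m,l]) F) F) F)) (S m c (S m g (S m i (S m j (R a
[a,b,c,d,e,f,g,h,i,j,m,l]) F) F) F) (S m e (S m j (S m g F F) (S m k F F)) (S m f (S m k F F) (S m g F F)))))))"
  by code_simp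

text \<open>Averaging over the twelve vertices of \<open>cube_paths\<close> gives a vertex adjacent
  to at least five of them. Counting leaves one shape: it is joined to an antipodal pair and to the
  three vertices linking the other pairs, so it replaces the fourth linking vertex and completes
  \<open>cube_star\<close>.\<close>

lemma refutes_cube:
  "refutes [(a,cube_star)]
    [] cube
    [h,g,f,e,d,c,b,a]
   (C i a e (C j b f (C k c g (C l d h (D m [a,b,c,d,e,f,g,h,i,j,k,l] (S m a (S m e (S m j (S m k (S m l (R a
[b,c,d,a,f,g,h,e,j,k,l,m]) F) F) F) (S m b (S m c (S m d F F) (S m d F F)) (S m c (S m d F F) (S m d F F)))) (S m b (S
m c (S m d F F) (S m d F (S m f (S m i (S m k (S m l (R a [a,c,d,b,e,g,h,f,i,k,l,m]) F) F) F) F))) (S m c (S m d F (S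
m g (S m i (S m j (S m l (R a [a,b,d,c,e,f,h,g,i,j,l,m]) F) F) F) F)) (S m d (S m h (S m i (S m j (S m k (R a
[a,b,c,d,e,f,g,h,i,j,k,m]) F) F) F) F) (S m e (S m f (S m g (S m h F F) (S m h F F)) (S m g (S m h F F) (S m h F F)))
(S m f (S m g (S m h F F) (S m h F F)) (S m g (S m h F F) (S m h F F)))))))))))))"
  by code_simp

lemma refutes_petersen_plus_two:
  "refutes [(a,cube)]
    [] petersen_plus_two
    [k,j,i,h,g,f,e,d,c,b,a]
   (C l g h (S l i (D m [a,d,h,b,e,g,f,c,l] (S m a (S m b (S m c (S m l (R a [m,i,h,d,j,b,c,l]) F) F) (S m c (S m h F F)
(S m h F F))) (S m c (S m b (S m g F F) (S m l F (S m f (S m g (S m h (R a [m,a,d,i,j,c,f,g]) F) F) F))) (S m b (S m g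
F F) (S m d (S m h F (S m e (S m f (S m l (R a [m,i,h,a,j,e,f,l]) F) F) F)) (S m h F (S m g F F))))))) (S l c (S l f
(R a [l,a,d,i,j,c,f,g]) (D m [a,d,h,b,e,g,c,l,f] (S m c (S m a (S m b F F) (S m b F (S m f (S m g (S m h (R a
[m,a,d,i,j,c,f,g]) F) F) F))) (S m a (S m b F (S m h F F)) (S m b (S m g F F) (S m d (S m h F (S m e (S m f (S m l (D
n [a,b,c,d,e,f,f,g,h,h,i,j,k,l,m] (S n a (S n c (S n b F F) (S n d (S n h F F) (S n h F (S n l F F)))) (S n c (S n f
(S n h (S n g (R a [n,a,d,i,j,c,f,g]) F) F) (S n h F F)) (S n b (S n i (S n l F (S n e F F)) (S n l F (S n e F F))) (S
n d (S n f (S n h F F) (S n h F F)) (S n f (S n h F (S n g F F)) (S n h F (S n l F (S n e F F))))))))) F) F) F)) (S m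
h F (S m g F F)))))))) (S l f (D m [a,d,h,b,e,g,f,l,c] (S m a (S m b (S m c (S m l (D n
[a,b,c,c,d,e,f,g,h,h,i,j,k,l,m] (S n a (S n c (S n h F F) (S n b F (S n h F F))) (S n c (S n l F (S n b F (S n h (S n
f (S n g (R a [n,a,d,i,j,c,f,g]) F) F) F))) (S n b (S n g (S n i F F) (S n i F F)) (S n d (S n l F (S n k F (S n e F
(S n f F F)))) (S n l F (S n f (S n h F F) (S n h F (S n i F F))))))))) F) F) (S m c (S m h F F) (S m h F F))) (S m c
(S m l F (S m b F (S m f (S m g (S m h (R a [m,a,d,i,j,c,f,g]) F) F) F))) (S m b (S m g F F) (S m l F (S m d (S m e F
F) (S m e F F))))))) (D m [a,d,h,b,e,g,f,c,l] (S m a (S m b (S m c (S m l (D n [a,b,c,c,d,e,f,g,h,h,i,j,k,l,m] (S n a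
(S n c (S n h F F) (S n b F (S n h F F))) (S n b (S n c (S n g F F) (S n g (S n i F F) (S n i F F))) (S n c (S n l F
(S n h (S n f (S n g (R a [n,a,d,i,j,c,f,g]) F) F) F)) (S n d (S n f (S n h F F) (S n h F (S n l F F))) (S n f (S n h
F (S n g F F)) (S n h F (S n l F (S n i F F))))))))) F) F) (S m c (S m h F F) (S m h F F))) (S m c (S m b (S m g F F)
(S m l F (S m f (S m g (S m h (R a [m,a,d,i,j,c,f,g]) F) F) F))) (S m b (S m g F F) (S m d (S m h F (S m e (S m f (S m
l (D n [a,b,c,d,e,f,f,g,h,h,i,j,k,l,m] (S n a (S n c (S n h F F) (S n d (S n h F F) (S n h F (S n l F F)))) (S n b (S
n c (S n g F F) (S n i (S n l F (S n e F F)) (S n l F (S n e F F)))) (S n c (S n l F (S n f (S n h (S n g (R a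
[n,a,d,i,j,c,f,g]) F) F) (S n h F F))) (S n d (S n f (S n h F F) (S n h F F)) (S n f (S n h F (S n g F F)) (S n h F (S
n l F (S n e F F))))))))) F) F) F)) (S m h F (S m g F F)))))))))))"
  by code_simp

lemma refutes_petersen_plus_one:
  "refutes [(a,cube), (b,petersen_plus_two)]
    [] petersen_plus_one
    [j,i,h,g,f,e,d,c,b,a]
   (H k [b,e,i] [c,f,h] (S k g (R a [k,a,d,h,j,b,e,g]) (R b [a,c,b,d,f,e,g,i,h,j,k])) (S k g (R a [k,a,d,i,j,c,f,g]) (R b
[a,b,c,d,e,f,g,h,i,j,k])))"
  by code_simp

text \<open>More than a third of nine means at least four. Up to rotation such a vertex is
  \<open>I9\<close> of \<open>petersen_plus_one\<close>; the three references are the three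
  rotations, and all other branches fail by counting.\<close>

lemma refutes_petersen_minus_vertex:
  "refutes [(a,petersen_plus_one)]
    [] petersen_minus_vertex
    [i,h,g,f,e,d,c,b,a]
   (D j [a,b,c,d,e,f,g,h,i] (S j a (S j b (S j c F F) (S j c F (S j d (S j h (S j i (R a [a,b,c,d,e,f,g,h,i,j]) F) F) F)))
(S j b (S j c F (S j e (S j g (S j i (R a [b,a,c,e,d,f,h,g,i,j]) F) F) F)) (S j c (S j f (S j g (S j h (R a
[c,a,b,f,d,e,i,g,h,j]) F) F) F) (S j d (S j e (S j f F F) (S j f F F)) (S j e (S j f F F) (S j f F F)))))))"
  by code_simp

lemma refutes_type_s0_s1:
  "refutes [(a,petersen_minus_vertex)]
    [] type_s0_s1
    [l,k,j,i,h,g,f,e,d,c,b,a]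
   (C m j l (S m b (R a [a,c,m,b,j,g,k,d,l]) (S m c (R a [a,b,m,c,j,h,i,f,l]) (S m i (R a [c,j,l,m,g,d,i,f,h]) (S m e (D n
[a,a,b,b,c,c,d,e,f,g,h,i,j,j,j,j,k,l,l,l,m,m,m,m] (S n b (S n j (S n l (R a [a,c,n,b,j,g,k,d,l]) (S n e F F)) (S n a
(S n e F (S n m (R a [a,f,m,e,n,g,i,b,l]) F)) (S n e F (S n m (S n i (R a [a,b,m,n,j,h,i,f,l]) F) F)))) (S n j (S n k
(S n g F (S n l (R a [b,j,l,n,h,f,k,d,g]) (S n c F F))) (S n g F (S n e (S n h F (S n c (S n l (R a
[a,b,n,c,j,h,i,f,l]) F) F)) (S n h F (S n c (R a [a,c,f,b,j,i,h,n,e]) F))))) (S n a (S n e F (S n c (S n m (R a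
[a,d,m,e,n,h,k,c,l]) F) (S n l F F))) (S n e F (S n c (S n l F (S n f (S n h (S n k (S n m (R a [a,c,m,n,j,g,k,d,l])
F) F) F) F)) (S n l F (S n m (S n d (S n f F F) (S n f F F)) F)))))))) (S m k (R a [b,j,l,m,h,f,k,d,g]) (D n
[a,b,b,c,c,d,e,f,g,h,i,j,j,j,k,l,l,l,m,m,m] (S n b (S n i (S n m (R a [a,b,m,n,j,h,i,f,l]) (S n d (S n g F F) (S n g F
(R a [a,b,e,f,i,h,g,n,d])))) (S n d (S n g F (S n l F F)) (S n a (S n l F F) (S n m F (S n j (S n l (R a
[a,c,n,b,j,g,k,d,l]) F) F))))) (S n c (S n k (S n m (R a [a,c,m,n,j,g,k,d,l]) (S n f (S n h F F) (S n h F (R a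
[a,c,e,d,k,g,h,n,f])))) (S n e (S n a (S n l F F) (S n m F (S n h F (S n j (S n l (R a [a,b,n,c,j,h,i,f,l]) F) F))))
(S n a (S n l F F) (S n m F (S n f F (S n h F (S n j (R a [a,c,f,b,j,i,h,n,e]) F))))))) (S n a (S n l F F) (S n d (S n
g F (S n l F F)) (S n e (S n l F (S n j F F)) (S n f (S n l F F) (S n m F (S n g F (S n h F (S n i (S n j (S n l (R a
[c,j,l,n,g,d,i,f,h]) F) F) F)))))))))))))))))"
  by code_simp

lemma refutes_type_s0_s1_s2:
  "refutes [(a,petersen_minus_vertex)]
    [] type_s0_s1_s2
    [l,k,j,i,h,g,f,e,d,c,b,a]
   (C m j l (S m b (R a [a,c,m,b,j,g,k,d,l]) (S m k (R a [b,j,l,m,h,f,k,d,g]) (S m c (S m e (D n [a,b,c,d,e,f,g,h,j,k,l,m]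
(S n a (S n b (S n e F (S n l F F)) (S n e F (S n c F (S n l F F)))) (S n b (S n m F (S n d F (S n g F F))) (S n d (S
n g F (S n l F F)) (S n e (S n g F (S n h F F)) (S n f (S n l F (S n c F F)) (S n l F (S n c F (S n j F F))))))))) (R
a [a,c,f,b,j,i,h,m,e])) (S m e (D n [a,b,c,d,e,f,g,h,j,k,l,m] (S n a (S n b (S n e F (S n l F F)) (S n e F (S n c (S n
l F F) (S n l F F)))) (S n b (S n m F (S n d F (S n g F F))) (S n d (S n g F (S n l F F)) (S n e (S n g F (S n h F F))
(S n c (S n j (S n h F F) (S n l F (S n k (S n m (R a [a,c,m,n,j,g,k,d,l]) F) F))) (S n l F (S n f F (S n j F
F))))))))) (D n [a,b,b,c,c,d,e,f,g,h,i,j,k,l,m] (S n b (S n a (S n d (S n l F F) (S n l F F)) (S n e (S n l F (S n j F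
F)) (S n l F (S n j F (S n i (S n m (R a [a,f,n,b,i,j,h,e,m]) F) F))))) (S n a (S n d F (S n e (S n l F F) (S n l F
F))) (S n e (S n g F (S n l F (S n j F F))) (S n c (S n j (S n h F F) (S n l F (S n k (S n m (R a [a,c,m,n,j,g,k,d,l])
F) F))) (S n l F (S n j F (S n d (S n f F F) (S n f F F))))))))))))))"
  by code_simp

lemma refutes_type_s0_s1_s2_s3:
  "refutes [(a,petersen_minus_vertex)]
    [] type_s0_s1_s2_s3
    [l,k,j,i,h,g,f,e,d,c,b,a]
   (C m k l (S m f (S m c (D n [a,b,c,d,e,f,h,i,j,k,l,m] (S n a (S n c (S n e F F) (S n f F (S n d (S n l F F) (S n l F
F)))) (S n b (S n l F (S n d F (S n e F F))) (S n d (S n l F (S n f F F)) (S n e (S n l F (S n c F F)) (S n l F (S n m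
F (S n c (S n f F F) (S n f F F))))))))) (S m d (D n [a,b,c,d,e,f,g,h,i,k,l,m] (S n a (S n b (S n d F (S n l F F)) (S
n d F (S n f F (S n l F F)))) (S n b (S n l F (S n d F (S n e F F))) (S n c (S n m F (S n e F (S n h F F))) (S n d (S
n g F (S n i F F)) (S n l F (S n e F (S n f F (S n k F F))))))))) (D n [a,b,c,d,e,f,g,h,i,k,l,m] (S n a (S n c (S n f
F (S n l F F)) (S n f F (S n d (S n l F F) (S n l F F)))) (S n b (S n l F (S n e F (S n d (S n g (S n i (S n m (D p
[a,b,d,e,f,h,i,j,k,l,m,n] (S p a (S p d (S p f F (S p l F F)) (S p f F (S p m F (S p b F F)))) (S p b (S p l F (S p d
F (S p e F F))) (S p d (S p l F (S p f F F)) (S p e (S p l F (S p m F F)) (S p l F (S p m F (S p f (S p i F F) (S p i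
F F))))))))) F) F) F) F))) (S n c (S n m F (S n e F (S n h F F))) (S n d (S n l F (S n f F (S n k F F))) (S n l F (S n
e F (S n f F (S n k F F))))))))))) (S m c (R a [a,c,e,d,k,g,h,m,f]) (S m d (R a [a,b,d,c,j,k,i,f,m]) (D n
[a,b,c,c,d,d,e,f,g,h,i,j,k,l,m] (S n b (S n a (S n d (S n l F F) F) (S n l F (S n e F (S n d (S n g (S n m (R a
[a,e,n,d,g,k,h,f,m]) F) F) F)))) (S n a (S n d (S n l F F) (S n e (S n l F F) (S n l F F))) (S n d (S n l F (S n f (S
n k F F) (S n k F F))) (S n f (S n i F (S n l F (S n k F F))) (S n l F (S n c (S n k F (S n j (S n m (R a
[a,b,n,c,j,k,i,f,m]) F) F)) (S n e F (S n k F F)))))))))))))"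
  by code_simp

lemma refutes_type_s0_s1_s3:
  "refutes [(a,type_s0_s1_s2_s3)]
    [] type_s0_s1_s3
    [l,k,j,i,h,g,f,e,d,c,b,a]
   (D m [a,b,c,d,e,e,f,g,h,i,k,l] (S m a (S m b (S m e (S m l (R a [a,c,b,f,e,d,h,g,m,j,i,l]) F) F) (S m d F (S m e (S m c
(S m l (R a [a,b,c,d,e,f,g,h,m,j,k,l]) F) F) F))) (S m b (S m e (S m g F F) (S m g F F)) (S m d (S m g F (S m f (S m i
(S m k (S m l (R a [m,g,c,b,h,a,i,f,d,k,l,e]) F) F) F) F)) (S m e (S m g F (S m h F F)) (S m g F (S m c (S m h F F) (S
m h F F))))))))"
  by code_simp

lemma refutes_type_s0_s2:
  "refutes [(a,petersen_minus_vertex), (b,type_s0_s1_s2), (c,type_s0_s1_s3), (d,cube), (e,type_s0_s1_s2_s3),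
     (f,type_s0_s1)]
    [] type_s0_s2
    [l,k,j,i,h,g,f,e,d,c,b,a]
   (C m b l (S m j (R a [a,c,m,b,j,g,k,d,l]) (S m a (S m d (R b [a,b,c,d,e,f,g,m,i,j,k,l]) (S m e (R c
[a,f,b,c,d,e,m,g,h,i,j,l]) (D n [a,c,f,b,j,i,d,e,m] (S n c (S n a (S n e F F) (S n f F (S n e (S n j (S n m (R b
[a,n,c,b,f,e,i,m,g,k,j,l]) F) F) F))) (S n k (S n j F (S n d (S n f (S n i (S n m (R c [a,b,f,n,d,c,g,m,j,i,h,l]) F)
F) F) F)) (S n a (S n e F (S n b F F)) (S n b (S n d F (S n e F F)) (S n e F (S n j F (S n f (S n i (S n m (R d
[n,a,b,e,k,f,i,m]) F) F) F)))))))))) (S m d (D n [a,b,d,e,f,g,i,j,k,l,l,m] (S n a (S n m F (S n b (S n l (S n d (R b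
[a,b,c,d,e,f,g,n,i,j,k,l]) (S n e (R c [a,f,b,c,d,e,n,g,h,i,j,l]) F)) F) (S n e F (S n d (S n f (S n l (R c
[a,e,d,c,b,f,n,i,h,g,k,l]) F) F) F)))) (S n g (S n b (S n d F (S n e F F)) (S n d F (S n e F (S n i (S n j (S n k (S n
m (R e [n,b,f,e,d,c,g,k,j,i,m,a]) F) F) F) F)))) (S n b (S n i F (S n d F (S n j (S n l (R a [a,c,n,b,j,g,k,d,l]) F)
F))) (S n e (S n l F F) (S n c (S n l (S n f F F) F) (S n d (S n l (S n k (R a [a,c,n,d,k,g,j,b,l]) F) F) (S n f (S n
l F F) (S n l F F))))))))) (S m e (H n [a,b,l] [m,g,h] (S n e (R c [a,f,b,c,d,e,n,g,h,i,j,l]) (R d [n,m,i,k,e,a,b,l]))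
(S n i (S n j (R e [n,b,c,d,e,f,g,h,i,j,m,a]) (S n k (R e [a,d,c,b,f,e,i,h,g,k,j,n]) (R d [n,e,b,a,k,h,i,m]))) (S n k
(R d [n,e,l,a,i,g,k,m]) (S n j (R c [a,b,c,d,e,f,g,h,i,j,k,n]) (R f [a,b,c,d,e,f,g,h,i,j,k,n]))))) (D n
[a,b,d,e,f,h,i,j,l] (S n a (S n b (S n d (S n l (R b [a,b,c,d,e,f,g,n,i,j,k,l]) F) (S n e (S n l (R c
[a,f,b,c,d,e,n,g,h,i,j,l]) F) F)) (S n e F (S n d (S n f (S n l (R c [a,e,d,c,b,f,n,i,h,g,k,l]) F) F) F))) (S n b (S n
d (S n i F F) (S n i F (S n j (S n l (R a [a,c,n,b,j,g,k,d,l]) F) F))) (S n d (S n i F F) (S n e (S n h (S n l (R a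
[b,g,n,l,h,f,m,a,e]) F) F) (S n f (S n i F F) (S n i F F))))))))))))"
  by code_simp

lemma refutes_type_c0_s0:
  "refutes [(a,type_s0_s1_s2_s3), (b,type_s0_s1_s3), (c,type_s0_s1_s2), (d,petersen_minus_vertex),
     (e,type_s0_s1), (f,cube), (g,type_s0_s2)]
    [] type_c0_s0
    [l,k,j,i,h,g,f,e,d,c,b,a]
   (C m i l (S m k (S m f (S m d (C n j l (S n c (S n h (S n e (D p [a,a,b,c,d,e,f,g,h,i,j,k,l,m,n] (S p a (S p b (S p d F
(S p e F F)) (S p d (S p l F F) (S p n F (S p f F (S p l F F))))) (S p b (S p d F (S p e F (S p i F F))) (S p c (S p f
F (S p k F (S p l F F))) (S p d (S p g F (S p l F F)) (S p e (S p g F F) (S p m F (S p n F (S p f F (S p g F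
F)))))))))) (S n k (R a [m,n,j,a,g,c,d,k,f,i,l,e]) (H p [a,m,n] [l,j,i] (S p e (R a [m,g,a,j,n,c,i,f,p,d,l,e]) (R b
[m,a,g,c,n,j,f,i,l,d,p,e])) (S p h (R a [j,m,i,c,g,l,p,d,a,n,f,h]) (R c [j,i,c,g,l,m,d,a,n,f,p,h]))))) (R d
[a,c,f,b,j,i,h,n,m])) (S n k (S n h (S n i (R a [a,c,d,e,f,b,h,i,j,k,g,n]) (R b [a,e,f,b,c,d,j,k,g,h,i,n])) (S n i (R
c [a,d,e,f,b,c,i,j,k,g,h,n]) (R e [a,e,f,b,c,d,j,k,g,h,i,n]))) (R d [a,d,l,m,g,j,k,c,n])))) (S m h (R b
[f,a,i,c,d,h,m,g,e,b,j,l]) (C n d m (S n b (S n a (R b [f,a,i,c,d,n,m,g,e,b,j,l]) (S n g (H p [a,d,m] [n,i,j] (S p b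
(R b [f,a,i,c,d,p,m,g,e,b,j,l]) (R f [p,n,k,h,b,a,d,m])) (S p k (R a [i,d,j,f,g,n,p,e,a,m,c,k]) (R c
[i,j,f,g,n,d,e,a,m,c,p,k]))) (H p [a,d,m] [n,i,j] (S p b (R b [f,a,i,c,d,p,m,g,e,b,j,l]) (R f [p,n,k,h,b,a,d,m])) (S p
g (R b [f,p,i,c,d,n,m,g,e,b,j,l]) (S p h (S p k (R a [a,c,d,e,f,b,h,i,j,k,g,p]) (R f [p,m,b,a,k,h,i,n])) (S p k (R f
[p,b,d,a,h,j,k,n]) (R e [a,d,e,f,b,c,i,j,k,g,h,p]))))))) (S n a (H p [b,d,m] [n,f,c] (S p a (R b
[f,a,i,c,d,p,m,g,e,b,j,l]) (R f [p,n,k,h,a,b,d,m])) (S p l (R b [f,i,a,n,d,c,g,m,j,p,e,l]) (R e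
[f,i,a,n,d,c,g,m,j,p,e,l]))) (R d [c,j,m,f,i,d,b,a,n])))))) (S m d (C n f m (S n a (R d [b,d,n,m,f,h,l,e,a]) (S n c (S
n h (R d [a,f,m,n,i,g,h,e,l]) (H p [a,f,m] [n,i,j] (R d [b,d,p,m,f,h,l,e,a]) (S p g (S p h (R d [b,d,n,m,f,h,l,e,p])
(S p b (R b [b,e,d,j,a,i,c,f,h,p,k,n]) (S p k (R a [a,b,f,e,d,c,g,k,j,i,h,p]) (R b [a,d,e,f,b,c,i,j,k,g,h,p])))) (R f
[p,f,c,a,g,i,j,n])))) (R d [b,j,m,d,k,f,c,a,n])))) (S m h (S m j (R a [a,c,d,e,f,b,h,i,j,k,g,m]) (R b
[a,c,d,e,f,b,h,i,j,k,g,m])) (S m j (R c [a,d,e,f,b,c,i,j,k,g,h,m]) (R g [a,d,e,f,b,c,i,j,k,g,h,m]))))) (S m f (S m d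
(C n k m (S n j (S n c (R c [f,n,c,i,a,k,b,m,g,e,j,l]) (S n g (S n h (R a [a,c,b,f,e,d,h,g,k,j,i,n]) (R c
[a,b,f,e,d,c,g,k,j,i,h,n])) (S n h (R b [a,e,f,b,c,d,j,k,g,h,i,n]) (R e [a,e,f,b,c,d,j,k,g,h,i,n])))) (S n c (S n h (H
p [a,f,n] [m,k,g] (S p l (R a [f,k,n,c,i,a,p,b,m,g,e,l]) (R c [f,i,c,n,k,a,g,m,b,p,e,l])) (S p h (R a
[k,f,g,c,i,m,p,b,a,n,e,h]) (R c [k,g,c,i,m,f,b,a,n,e,p,h]))) (R d [a,c,e,d,k,g,h,n,f])) (R d [a,b,m,f,i,k,j,c,n]))))
(R d [a,c,f,b,j,i,k,d,m])) (S m d (C n e l (S n h (R d [a,e,l,n,g,i,h,f,m]) (S n a (R d [b,d,n,e,l,h,f,m,a]) (S n c (S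
n j (H p [a,b,n] [c,j,k] (S p d (R d [a,e,l,n,g,i,p,f,m]) (R f [p,c,j,h,d,a,b,n])) (S p l (R g
[c,f,e,k,a,j,d,b,i,p,g,m]) (R g [c,j,f,e,k,a,g,d,b,i,p,l]))) (H p [a,e,l] [n,g,k] (R d [b,d,p,e,l,h,f,m,a]) (S p i (S
p h (R d [b,d,n,e,l,h,f,m,p]) (S p d (R b [d,f,b,k,a,g,c,e,h,p,j,n]) (S p j (R a [a,b,f,e,d,c,g,k,j,i,h,p]) (R b
[a,b,f,e,d,c,g,k,j,i,h,p])))) (R f [p,e,c,a,i,g,k,n])))) (S n j (H p [a,d,l] [m,g,h] (R d [b,e,p,d,l,k,c,n,a]) (S p e
(R b [e,a,g,c,b,h,p,i,f,d,k,m]) (S p k (S p j (R d [e,l,p,m,k,n,i,b,j]) (R c [a,c,b,f,e,d,h,g,k,j,i,p])) (S p j (R b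
[a,b,c,d,e,f,g,h,i,j,k,p]) (R e [a,b,c,d,e,f,g,h,i,j,k,p]))))) (H p [a,d,l] [m,g,h] (R d [b,e,p,d,l,k,c,n,a]) (S p e
(R b [e,a,g,c,b,h,p,i,f,d,k,m]) (S p j (S p k (R a [a,c,b,f,e,d,h,g,k,j,i,p]) (R b [a,b,c,d,e,f,g,h,i,j,k,p])) (S p k
(R c [a,c,b,f,e,d,h,g,k,j,i,p]) (R e [a,b,c,d,e,f,g,h,i,j,k,p])))))))))) (S m h (S m j (R c [a,c,d,e,f,b,h,i,j,k,g,m])
(R e [a,c,d,e,f,b,h,i,j,k,g,m])) (S m j (R e [a,d,e,f,b,c,i,j,k,g,h,m]) (D n [a,a,b,c,d,d,e,f,g,g,h,j,k,l,m] (S n a (S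
n b (S n d (S n m (R e [a,c,d,e,f,b,n,i,j,k,g,m]) F) F) (S n l (S n d (R d [a,c,l,b,n,i,k,d,m]) (S n e F F)) (S n e F
(S n d (S n f (S n m (R e [a,e,d,c,b,f,n,i,h,g,k,m]) F) F) F)))) (S n b (S n j (S n m (R d [a,c,n,b,j,i,k,d,m]) F) (S
n d (S n g (S n m (R d [a,e,n,d,g,i,h,f,m]) F) F) F)) (S n d (S n l F (S n g (S n i F (R d [a,d,f,e,g,h,i,n,b])) F))
(S n e (S n l F (S n g (S n h (S n m (R e [e,a,g,c,b,h,n,i,f,d,k,m]) F) F) F)) (S n f (S n l F F) (S n l F (S n g (S n
h (S n i F (S n j (S n k (R a [a,c,b,f,e,d,h,g,k,j,i,n]) F) F)) F) F))))))))))))))"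
  by code_simp

lemma refutes_type_c0_c2:
  "refutes [(a,type_s0_s1_s2_s3), (b,type_s0_s1_s3), (c,type_s0_s2), (d,type_s0_s1_s2), (e,type_c0_s0),
     (f,petersen_minus_vertex), (g,cube), (h,type_s0_s1)]
    [] type_c0_c2
    [l,k,j,i,h,g,f,e,d,c,b,a]
   (C m g l (S m j (S m h (S m e (C n i l (S n k (S n g (S n j (R a [n,b,f,e,d,c,g,k,j,i,l,a]) (R b
[e,c,b,l,n,g,f,d,k,m,i,j])) (S n h (S n f (R a [h,g,f,e,i,c,b,m,n,d,a,l]) (S n j (R a [a,c,d,e,f,b,h,i,j,k,g,n]) (R b
[a,c,d,e,f,b,h,i,j,k,g,n]))) (S n f (R b [e,g,c,b,h,a,i,f,d,k,m,n]) (R c [e,g,a,h,b,c,i,m,k,d,f,n])))) (S n g (S n h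
(S n j (R a [a,b,c,d,e,f,g,h,i,j,k,n]) (R d [a,b,c,d,e,f,g,h,i,j,k,n])) (R e [e,g,c,b,h,a,i,f,d,k,m,n])) (R f
[b,i,m,e,l,c,k,n,g])))) (S m i (S m k (R a [m,b,f,e,d,c,g,k,j,i,l,a]) (R a [a,b,c,d,e,f,g,h,i,j,k,m])) (S m k (R a
[a,c,b,f,e,d,h,g,k,j,i,m]) (R b [a,b,c,d,e,f,g,h,i,j,k,m])))) (S m k (R g [m,b,d,a,h,j,k,l]) (S m e (C n i l (S n k (S
n g (S n j (R a [n,b,f,e,d,c,g,k,j,i,l,a]) (R b [e,c,b,l,n,g,f,d,k,m,i,j])) (S n h (S n f (R b
[f,c,i,a,h,d,e,g,n,j,b,m]) (S n j (R a [a,c,d,e,f,b,h,i,j,k,g,n]) (R b [a,c,d,e,f,b,h,i,j,k,g,n]))) (S n f (H p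
[a,b,m] [l,g,h] (S p d (S p n (R d [p,g,c,i,e,f,b,a,d,n,m,h]) (R b [e,g,c,b,p,a,i,f,d,k,m,n])) (R g
[p,l,j,h,d,a,b,m])) (S p j (S p i (R d [l,g,c,i,e,f,b,p,d,n,m,h]) (S p e (R b [e,g,c,b,h,a,i,f,d,k,p,n]) (S p k (R a
[a,c,b,f,e,d,h,g,k,j,i,p]) (R b [a,b,c,d,e,f,g,h,i,j,k,p])))) (R g [p,d,m,a,j,g,h,l]))) (S n j (R g [n,b,d,a,h,j,k,l])
(R c [a,d,e,f,b,c,i,j,k,g,h,n]))))) (S n g (S n h (S n j (R a [a,b,c,d,e,f,g,h,i,j,k,n]) (R g [n,d,m,a,j,g,h,l])) (S n
j (R b [a,d,e,f,b,c,i,j,k,g,h,n]) (R c [a,b,c,d,e,f,g,h,i,j,k,n]))) (R f [b,i,m,e,l,c,k,n,g])))) (S m i (R b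
[a,d,e,f,b,c,i,j,k,g,h,m]) (R c [a,b,f,e,d,c,g,k,j,i,h,m]))))) (S m e (R f [a,c,e,d,k,g,j,b,m]) (S m h (S m i (S m k
(R a [a,d,c,b,f,e,i,h,g,k,j,m]) (R d [a,b,c,d,e,f,g,h,i,j,k,m])) (S m k (R d [a,c,b,f,e,d,h,g,k,j,i,m]) (R h
[a,b,c,d,e,f,g,h,i,j,k,m]))) (S m i (S m k (R b [a,b,f,e,d,c,g,k,j,i,h,m]) (R c [a,b,c,d,e,f,g,h,i,j,k,m])) (S m k (R
h [a,b,f,e,d,c,g,k,j,i,h,m]) (D n [a,b,d,e,i,j,k,l,m] (S n b (S n a (S n d (S n m (R h [a,c,b,f,e,d,n,g,k,j,i,m]) F)
(S n e (S n m (R h [a,f,b,c,d,e,n,g,h,i,j,m]) F) F)) (S n i (S n m (R f [a,f,n,b,i,g,h,e,m]) (S n d F F)) (S n d F (S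
n j (S n m (R f [a,c,n,b,j,g,k,d,m]) F) F)))) (S n l (S n a F (S n e F (S n i (S n j (S n k (S n g (R a
[n,b,f,e,d,c,g,k,j,i,l,a]) (S n h (R a [a,c,d,e,f,b,h,i,j,k,g,n]) (R g [n,b,d,a,h,j,k,l]))) F) F) F))) (S n d (S n a F
(S n k (S n m (R f [a,c,n,d,k,g,j,b,m]) F) F)) (S n a F (S n e F (S n c F (S n i (S n j (S n m (R f
[c,j,m,n,g,d,i,f,l]) F) F) F))))))))))))))"
  by code_simp

lemma refutes_type_s0:
  "refutes [(a,petersen_minus_vertex), (b,type_s0_s1), (c,type_c0_s0), (d,type_s0_s1_s2_s3), (e,type_s0_s2)]
    [] type_s0
    [l,k,j,i,h,g,f,e,d,c,b,a]
   (D m [a,a,b,b,c,d,d,e,e,f,g,h,i,j,k,k,l,l] (S m k (S m d (S m g F (S m l (R a [a,c,m,d,k,g,j,b,l]) F)) (S m g F (S m c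
(S m l (S m j (R b [c,a,j,f,e,k,m,g,d,b,i,l]) (S m f (S m h (R c [a,m,c,d,e,f,g,h,i,j,k,l]) F) F)) F) (S m l (S m f (S
m h (S m i (R b [f,a,i,c,d,h,m,g,e,b,j,l]) F) F) (S m h (S m i (S m j (R d [a,c,d,e,f,b,h,i,j,k,g,m]) F) F) F)) F))))
(S m a (S m b (S m d (S m l (R b [a,c,b,f,e,d,m,g,k,j,i,l]) F) (S m e (S m l (R b [a,f,b,c,d,e,m,g,h,i,j,l]) F) F)) (S
m d (S m f (S m l (R e [a,e,f,b,c,d,m,k,g,h,i,l]) F) F) (S m e (S m c (S m l (R e [a,d,c,b,f,e,m,h,g,k,j,l]) F) F)
F))) (S m b (S m d (S m l (S m i (R a [a,f,m,b,i,g,h,e,l]) F) F) (S m e (S m l (S m j (R a [a,c,m,b,j,g,k,d,l]) F) F)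
(S m g F F))) (S m d (S m f F F) (S m f F (S m g F (S m e (S m h (S m l (R a [a,f,m,e,h,g,i,b,l]) F) F) F))))))))"
  by code_simp

lemma refutes_type_c0:
  "refutes [(a,petersen_minus_vertex), (b,type_c0_s0), (c,type_s0_s1_s2_s3), (d,type_s0_s1_s2),
     (e,type_s0_s1_s3), (f,type_s0_s1), (g,type_s0_s2), (h,type_s0)]
    [] type_c0
    [l,k,j,i,h,g,f,e,d,c,b,a]
   (C m g l (S m d (R a [b,d,g,m,f,h,l,e,a]) (S m e (R a [b,e,g,m,c,k,l,d,a]) (S m h (S m i (S m j (S m k (D n
[a,b,c,d,e,f,i,j,l] (S n a (S n d (S n b F (S n l (R a [a,b,d,c,n,k,g,l,e]) F)) (S n b F (S n e (S n l (R a
[a,b,e,f,n,h,g,l,d]) F) (S n c (S n f (S n l (R b [a,b,c,d,e,f,n,h,i,j,k,l]) F) F) F)))) (S n c (S n f F (S n e (S n j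
(S n l (R c [m,n,e,f,b,c,i,j,k,g,l,a]) F) F) F)) (S n b (S n d F (S n e F F)) (S n e F (S n j F (S n d (S n f (S n i
(S n l (R c [m,n,d,c,b,f,j,i,h,g,l,a]) F) F) F) F))))))) (R c [a,b,c,d,e,f,g,h,i,j,k,m])) (S m k (R c
[a,d,c,b,f,e,i,h,g,k,j,m]) (R d [a,b,c,d,e,f,g,h,i,j,k,m]))) (S m j (S m k (R c [a,c,b,f,e,d,h,g,k,j,i,m]) (R e
[a,b,c,d,e,f,g,h,i,j,k,m])) (S m k (R d [a,c,b,f,e,d,h,g,k,j,i,m]) (R f [a,b,c,d,e,f,g,h,i,j,k,m])))) (S m i (S m j (S
m k (R c [a,b,f,e,d,c,g,k,j,i,h,m]) (R e [a,d,e,f,b,c,i,j,k,g,h,m])) (S m k (R e [a,b,f,e,d,c,g,k,j,i,h,m]) (R g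
[a,b,c,d,e,f,g,h,i,j,k,m]))) (S m j (S m k (R d [a,b,f,e,d,c,g,k,j,i,h,m]) (R g [a,b,f,e,d,c,g,k,j,i,h,m])) (S m k (R
f [a,b,f,e,d,c,g,k,j,i,h,m]) (R h [a,b,c,d,e,f,g,h,i,j,k,m]))))))))"
  by code_simp

lemma refutes_type_empty:
  "refutes [(a,type_s0), (b,type_c0)]
    [] type_empty
    [l,k,j,i,h,g,f,e,d,c,b,a]
   (D m [a,a,b,b,c,c,d,d,e,e,f,f,g,h,i,j,k,l] (S m a (S m b (S m d (S m l (R a [a,c,b,f,e,d,m,g,k,j,i,l]) F) (S m e (S m l
(R a [a,f,b,c,d,e,m,g,h,i,j,l]) F) F)) (S m c (S m e (S m l (R a [a,d,c,b,f,e,m,h,g,k,j,l]) F) (S m f (S m l (R a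
[a,b,c,d,e,f,m,h,i,j,k,l]) F) F)) (S m e F (S m d (S m f (S m l (R a [a,e,d,c,b,f,m,i,h,g,k,l]) F) F) F)))) (S m b (S
m d (S m g (S m i (S m l (R b [a,m,b,f,e,d,h,g,k,j,i,l]) F) F) F) (S m e (S m g (S m j (S m l (R b
[a,m,b,c,d,e,k,g,h,i,j,l]) F) F) F) F)) (S m c (S m e (S m h (S m j (S m l (R b [a,m,c,b,f,e,i,h,g,k,j,l]) F) F) F) (S
m f (S m h (S m k (S m l (R b [a,m,c,d,e,f,g,h,i,j,k,l]) F) F) F) F)) (S m e F (S m d (S m f (S m i (S m k (S m l (R b
[a,m,d,c,b,f,j,i,h,g,k,l]) F) F) F) F) (S m f F F)))))))"
  by code_simp

lemma refutes_type_o: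
  "refutes [(a,type_c0_s0), (b,type_s0_s1_s2_s3), (c,type_s0_s1_s2), (d,petersen_minus_vertex), (e,type_c0_c2),
     (f,cube), (g,type_s0_s2), (h,type_c0), (i,type_s0_s1_s3), (j,type_s0_s1)]
    [] type_o
    [l,k,j,i,h,g,f,e,d,c,b,a]
   (C m b l (S m g (S m i (S m d (C n c l (S n j (S n k (R a [c,a,j,f,e,k,n,g,d,b,i,l]) (S n e (S n h (H p [b,e,l] [n,m,k]
(S p g (S p j (C q f l (S q k (S q h (S q i (R b [e,q,h,b,m,l,n,f,d,p,i,j]) (R c [a,p,b,m,d,e,k,l,h,i,j,q])) (S q i (R
c [a,p,e,n,c,b,k,l,i,h,g,q]) (R d [b,e,l,n,m,f,h,i,q]))) (S q c (R d [a,f,m,b,l,j,k,q,d]) (R d [a,f,n,e,l,g,k,q,c]))))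
(R e [b,n,l,a,i,e,p,h,m,k,c,j])) (R e [e,m,l,a,h,b,p,i,n,k,d,g])) (S p f (R f [p,l,j,g,a,f,m,n]) (R d
[a,b,n,c,j,k,i,f,p]))) (R a [a,e,d,m,b,f,j,i,h,g,k,n])) (S n h (R g [a,m,d,e,f,b,h,i,j,k,g,n]) (R d
[a,c,f,b,j,i,h,n,e])))) (S n e (R d [a,e,m,d,l,k,j,n,b]) (S n f (S n k (S n h (H p [d,f,l] [n,m,j] (S p i (S p k (C q
e l (S q j (S q g (S q h (R b [d,q,g,f,n,l,m,e,c,p,h,i]) (R c [a,p,f,n,c,d,j,l,g,h,i,q])) (S q h (R c
[a,p,d,m,b,f,j,l,h,g,k,q]) (R d [d,f,l,n,m,e,h,g,q]))) (S q b (R d [a,e,n,f,l,i,j,q,c]) (R d [a,e,m,d,l,k,j,q,b]))))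
(R e [d,n,l,a,g,f,p,h,m,j,c,k])) (R e [f,m,l,a,h,d,p,g,n,j,b,i])) (S p e (R f [p,l,k,i,a,e,m,n]) (R d
[a,d,n,c,k,j,g,e,p]))) (R a [a,f,e,d,m,b,k,j,i,h,g,n])) (R d [a,f,m,b,l,j,k,n,d])) (S n h (S n k (R g
[a,m,b,f,e,d,h,g,k,j,i,n]) (R a [a,c,d,e,f,b,h,i,j,k,g,n])) (S n k (R d [a,c,e,d,k,g,h,n,f]) (R h
[a,c,d,e,f,b,h,i,j,k,g,n]))))))) (S m j (R a [b,a,i,e,d,j,m,k,c,f,h,l]) (D n [a,b,e,f,i,h,j,d,m] (S n a (S n b (S n d
F F) (S n e F (S n d (S n f (S n m (R a [b,a,i,e,d,n,m,k,c,f,h,l]) F) F) F))) (S n b (S n d F (S n e F F)) (S n d (S n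
i F F) (S n e (S n h (S n j (S n m (S n c (C p d m (S p f (S p a (R e [e,a,p,m,b,h,d,i,f,n,k,l]) (S p k (R a
[a,f,e,n,c,b,k,j,i,h,g,p]) (R e [a,d,e,f,b,c,i,j,k,g,h,p]))) (S p a (D q [b,d,i,e,m,h,p,a,f] (S q k (S q d (S q i F F)
(S q m F (S q f (S q h (S q i (S q l (R a [f,a,h,d,c,i,q,j,b,e,g,l]) (R h [f,a,h,d,c,i,q,j,b,e,g,l])) F) F) F))) (S q
h (S q l (S q e F (S q f (R d [a,f,n,e,h,g,k,q,m]) F)) (S q c (S q e (S q m F F) (S q m F F)) (S q f (R d
[a,d,f,e,g,h,k,c,q]) (S q i F (S q m F F))))) (S q a (S q b (S q d F F) (S q e F (S q d (S q f (S q m (R e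
[e,a,q,m,b,h,d,i,f,n,k,l]) F) F) F))) (S q b (S q d F (S q e F F)) (S q e F (S q c F (S q g F (S q j F (S q m F (S q d
F F))))))))))) (R d [b,d,i,e,m,h,f,p,a])))) (R f [n,b,i,d,c,e,h,m])) F) F) F) (S n f (S n i F F) (S n i F F)))))))))
(S m d (C n i m (S n f (R d [a,d,n,m,i,j,l,c,f]) (S n h (S n j (S n k (R b [a,c,d,e,f,b,h,i,j,k,g,n]) (R c
[a,c,d,e,f,b,h,i,j,k,g,n])) (S n k (R i [a,c,d,e,f,b,h,i,j,k,g,n]) (R j [a,c,d,e,f,b,h,i,j,k,g,n]))) (R d
[a,e,m,d,g,i,h,f,n])))) (S m e (S m j (C n f l (S n h (S n i (R a [f,a,h,d,c,i,n,j,b,e,g,l]) (S n c (S n k (H p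
[c,e,l] [m,n,i] (S p h (S p j (C q d l (S q i (S q g (S q k (R b [e,q,g,c,n,l,m,d,f,p,k,j]) (R c
[a,p,c,n,f,e,i,l,g,k,j,q])) (S q k (R c [a,p,e,m,b,c,i,l,k,g,h,q]) (R d [c,e,l,m,n,d,g,k,q]))) (S q b (R d
[a,d,n,c,l,j,i,q,f]) (R d [a,d,m,e,l,h,i,q,b])))) (R e [c,m,l,a,k,e,p,g,n,i,b,j])) (R e [e,n,l,a,g,c,p,k,m,i,f,h])) (S
p d (R f [p,l,h,j,a,d,m,n]) (R d [a,c,m,b,j,i,k,d,p]))) (R a [a,c,d,e,m,b,h,i,j,k,g,n])) (S n k (R g
[a,m,b,c,d,e,k,g,h,i,j,n]) (R d [a,d,f,e,g,h,k,c,n])))) (S n c (R d [a,c,m,b,l,i,h,n,e]) (S n d (S n i (S n k (H p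
[b,d,l] [n,m,h] (S p g (S p i (C q c l (S q h (S q j (S q k (R b [b,q,j,d,n,l,m,c,f,p,k,g]) (R c
[a,p,d,n,f,b,h,l,j,k,g,q])) (S q k (R c [a,p,b,m,e,d,h,l,k,j,i,q]) (R d [b,d,l,n,m,c,k,j,q]))) (S q e (R d
[a,c,n,d,l,g,h,q,f]) (R d [a,c,m,b,l,i,h,q,e])))) (R e [b,n,l,a,j,d,p,k,m,h,f,i])) (R e [d,m,l,a,k,b,p,j,n,h,e,g])) (S
p c (R f [p,l,i,g,a,c,m,n]) (R d [a,b,n,f,i,h,j,c,p]))) (R a [a,d,e,m,b,c,i,j,k,g,h,n])) (R d [a,d,m,e,l,h,i,n,b])) (S
n i (S n k (R g [a,m,e,d,c,b,k,j,i,h,g,n]) (R d [a,c,f,b,j,i,k,d,n])) (S n k (R a [a,f,b,c,d,e,k,g,h,i,j,n]) (R h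
[a,f,b,c,d,e,k,g,h,i,j,n]))))))) (C n j m (S n c (R d [a,e,n,m,j,i,l,f,c]) (S n k (S n h (S n i (R b
[a,c,d,e,f,b,h,i,j,k,g,n]) (R i [a,e,f,b,c,d,j,k,g,h,i,n])) (S n i (R c [a,d,e,f,b,c,i,j,k,g,h,n]) (R j
[a,e,f,b,c,d,j,k,g,h,i,n]))) (R d [a,d,m,e,g,j,k,c,n]))))) (S m j (D n [a,b,d,c,j,k,i,e,m] (S n a (S n b (S n d F F)
(S n d F (S n c (S n e (S n m (R a [b,a,j,d,e,n,m,h,f,c,k,l]) F) F) F))) (S n b (S n d F (S n e F F)) (S n c (S n e (S
n j F F) (S n j F F)) (S n e F (S n j F (S n d (S n i (S n k (S n m (S n f (C p e m (S p c (S p a (R a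
[b,a,j,d,e,p,m,h,f,c,k,l]) (S p h (R a [a,c,b,f,n,d,h,g,k,j,i,p]) (R e [a,c,d,e,f,b,h,i,j,k,g,p]))) (S p a (D q
[b,e,j,d,m,k,p,a,c] (S q h (S q e (S q j F F) (S q m F (S q c (S q j (S q k (S q l (R a [c,a,j,f,e,k,q,g,d,b,i,l]) (R
h [c,a,j,f,e,k,q,g,d,b,i,l])) F) F) F))) (S q a (S q b (S q d F F) (S q d F (S q c (S q e (S q m (R a
[b,a,j,d,e,q,m,h,f,c,k,l]) F) F) F))) (S q c (S q l (S q e F (S q j (R d [a,c,f,b,j,i,h,q,e]) F)) (S q e (S q j F F)
(S q j (R d [a,c,f,b,j,i,h,q,e]) (S q m F F)))) (S q b (S q d F (S q e F F)) (S q e F (S q j F (S q m F F)))))))) (R d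
[b,e,j,d,m,k,c,p,a])))) (R f [n,b,j,e,f,d,k,m])) F) F) F) F))))))) (R a [a,b,c,d,e,f,g,h,i,j,k,m]))))) (S m i (S m d
(C n g m (S n e (R d [a,b,n,m,g,k,l,c,e]) (S n h (S n j (S n k (R b [a,c,b,f,e,d,h,g,k,j,i,n]) (R i
[a,b,c,d,e,f,g,h,i,j,k,n])) (S n k (R c [a,c,b,f,e,d,h,g,k,j,i,n]) (R j [a,b,c,d,e,f,g,h,i,j,k,n]))) (R d
[a,f,m,b,i,g,h,e,n])))) (R d [a,b,e,f,i,h,g,m,d])) (S m d (R e [a,b,c,d,e,f,g,h,i,j,k,m]) (S m e (S m j (C n g m (S n
d (R d [a,b,n,m,g,h,l,f,d]) (S n k (S n h (S n i (R b [a,d,c,b,f,e,i,h,g,k,j,n]) (R c [a,c,b,f,e,d,h,g,k,j,i,n])) (S n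
i (R i [a,b,f,e,d,c,g,k,j,i,h,n]) (R j [a,b,f,e,d,c,g,k,j,i,h,n]))) (R d [a,c,m,b,j,g,k,d,n])))) (R e
[a,b,f,e,d,c,g,k,j,i,h,m])) (S m j (R d [a,b,d,c,j,k,g,m,e]) (R h [a,b,c,d,e,f,g,h,i,j,k,m])))))))"
  by code_simp

text \<open>As the class \<open>I0\<close>, \<open>I1\<close>, \<open>I2\<close> is undominated, the
  other class has a common neighbour. Take also common neighbours of the three opposite pairs: if
  pairwise non-adjacent, they give the Petersen graph minus a vertex; if two are adjacent, further
  hexagons, partly after averaging, produce a Grotzsch graph.\<close>

lemma refutes_hexagon:
  "refutes [(a,grotzsch), (b,petersen_minus_vertex)]
    [[a,b,c]] hexagon
    [f,e,d,c,b,a]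
   (C g a d (H h [a,b,c] [d,e,f] (U h) (C i b e (S i g (C j c f (S j g (H k [b,e,j] [c,f,i] (R a [e,f,b,d,g,j,k,h,i,c,a])
(R a [f,e,c,d,g,i,k,h,j,b,a])) (S j i (H k [a,d,j] [c,f,g] (R a [d,f,a,e,i,j,k,h,g,c,b]) (R a
[f,d,c,e,i,g,k,h,j,a,b])) (D k [a,b,c,d,e,f,g,i,j] (S k a (S k b (S k c F F) (S k c F (S k d (S k i (S k j (H l
[b,e,j] [c,f,i] (R a [e,f,b,d,k,j,l,h,i,c,a]) (R a [f,e,c,d,k,i,l,h,j,b,a])) F) F) F))) (S k b (S k c F (S k e (S k g
(S k j (H l [a,d,j] [c,f,g] (R a [d,f,a,e,k,j,l,h,g,c,b]) (R a [f,d,c,e,k,g,l,h,j,a,b])) F) F) F)) (S k c (S k g F F)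
(S k h F (S k f (S k g F (S k e F F)) (S k g F (S k e F F))))))))))) (C j c f (S j g (S j i (H k [a,d,i] [b,e,g] (R a
[d,e,a,f,j,i,k,h,g,b,c]) (R a [e,d,b,f,j,g,k,h,i,a,c])) (D k [a,b,c,d,e,f,g,j,i] (S k a (S k b (S k c F F) (S k c F (S
k d (S k i (S k j (H l [b,e,j] [c,f,i] (R a [e,f,b,d,k,j,l,h,i,c,a]) (R a [f,e,c,d,k,i,l,h,j,b,a])) F) F) F))) (S k b
(S k c F (S k g F F)) (S k c (S k f (S k g (S k i (H l [a,d,i] [b,e,g] (R a [d,e,a,f,k,i,l,h,g,b,c]) (R a
[e,d,b,f,k,g,l,h,i,a,c])) F) F) F) (S k e (S k g F (S k f F F)) (S k g F (S k f F F)))))))) (S j i (D k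
[a,b,c,d,e,f,i,j,g] (S k b (S k a (S k c F F) (S k c F (S k e (S k g (S k j (H l [a,d,j] [c,f,g] (R a
[d,f,a,e,k,j,l,h,g,c,b]) (R a [f,d,c,e,k,g,l,h,j,a,b])) F) F) F))) (S k a (S k c F (S k i F F)) (S k c (S k f (S k g
(S k i (H l [a,d,i] [b,e,g] (R a [d,e,a,f,k,i,l,h,g,b,c]) (R a [e,d,b,f,k,g,l,h,i,a,c])) F) F) F) (S k d (S k i F (S k
f F F)) (S k i F (S k f F F))))))) (R b [a,b,c,d,e,f,g,i,j]))))))))"
  by code_simp

lemma refutes_type_c0_s0_s2:
  "refutes [(a,grotzsch_plus_two), (b,type_c0_c2), (c,petersen_minus_vertex), (d,type_s0_s1_s2_s3),
     (e,type_s0_s1_s3), (f,type_s0_s1_s2), (g,type_s0_s1), (h,type_c0_s0), (i,type_o), (j,cube)]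
    [] type_c0_s0_s2
    [l,k,j,i,h,g,f,e,d,c,b,a]
   (D m [a,b,e,f,i,h,j,d,l] (S m a (S m b (S m d F F) (S m e F (S m d (S m f (S m l (C n j l (S n e (S n c (S n h (R a
[b,a,i,e,d,m,l,k,c,f,h,g,n]) (R b [a,e,d,c,b,f,m,i,h,g,k,n])) (R c [b,e,m,d,l,k,c,n,a])) (S n h (S n c (S n k (R d
[c,j,a,k,e,f,g,n,i,b,d,l]) (R e [b,m,a,i,e,d,h,l,k,c,f,n])) (S n k (R f [b,m,a,i,e,d,h,l,k,c,f,n]) (R g
[b,m,a,i,e,d,h,l,k,c,f,n]))) (R c [a,f,l,b,i,j,h,e,n])))) F) F) F))) (S m b (S m d F (S m e F F)) (S m d (S m i F F)
(S m e (S m h (S m j (S m l (S m c (C n d l (S n f (S n a (R a [e,a,h,b,l,n,d,k,m,f,i,j,c]) (S n k (R h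
[a,f,e,m,c,b,k,j,i,h,g,n]) (R b [a,d,e,f,b,c,i,j,k,g,h,n]))) (S n a (R i [a,m,c,b,f,e,i,h,g,k,j,n]) (R c
[b,d,i,e,l,h,f,n,a])))) (R j [m,b,i,d,c,e,h,l])) F) F) F) (S m f (S m i F F) (S m i F F)))))))"
  by code_simp

lemma refutes_type_c0_c2_s0:
  "refutes [(a,grotzsch_plus_two), (b,type_c0_s0_s2), (c,petersen_minus_vertex), (d,type_s0_s1_s2_s3),
     (e,type_s0_s1_s2), (f,type_s0_s1_s3), (g,type_s0_s1)]
    [] type_c0_c2_s0
    [l,k,j,i,h,g,f,e,d,c,b,a]
   (C m i l (S m f (S m k (S m h (R a [f,a,h,d,c,i,m,j,b,e,g,k,l]) (R b [a,f,e,d,c,b,k,j,i,h,g,m])) (R c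
[a,c,f,b,j,i,k,d,m])) (S m h (S m j (S m k (R d [a,c,d,e,f,b,h,i,j,k,g,m]) (R e [a,c,d,e,f,b,h,i,j,k,g,m])) (S m k (R
f [a,c,d,e,f,b,h,i,j,k,g,m]) (R g [a,c,d,e,f,b,h,i,j,k,g,m]))) (R c [a,e,l,d,g,i,h,f,m]))))"
  by code_simp

lemma refutes_type_o_c0:
  "refutes [(a,type_c0_c2_s0), (b,type_c0_s0_s2), (c,type_c0_s0), (d,type_c0_c2), (e,petersen_minus_vertex)]
    [] type_o_c0
    [l,k,j,i,h,g,f,e,d,c,b,a]
   (C m d l (S m i (S m f (R a [a,d,m,f,b,c,i,j,l,g,h,e]) (S m g (S m k (R a [d,a,k,b,f,g,m,h,e,c,j,l]) (R b
[a,d,c,b,f,e,i,h,g,k,j,m])) (S m k (R b [a,d,e,f,b,c,i,j,k,g,h,m]) (R c [a,d,e,f,b,c,i,j,k,g,h,m])))) (S m f (S m k (R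
a [a,f,e,d,c,b,k,j,i,h,g,m]) (R d [a,d,e,f,b,c,i,j,k,g,h,m])) (R e [a,b,d,c,j,l,i,f,m]))))"
  by code_simp

lemma refutes_few_A_a:
  "refutes [(a,petersen_minus_vertex), (b,type_s0_s1), (c,type_s0), (d,type_c0_c2), (e,type_c0_s0), (f,cube),
     (g,type_o), (h,type_c0), (i,type_empty)]
    [] few_A_a
    [n,m,l,k,j,i,h,g,f,e,d,c,b,a]
   (S n h (S n e (R a [a,b,e,f,i,h,j,c,n]) (S n f (R a [a,d,f,e,g,h,k,c,n]) (S n g (R a [b,d,g,m,f,h,k,j,n]) (S n m (R b
[d,a,k,b,f,g,m,h,e,c,j,n]) (R c [d,k,a,g,f,b,h,m,j,c,e,n]))))) (S n a (S n e (S n l (S n m (H p [b,j,m] [d,k,l] (R d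
[b,a,g,m,d,j,f,k,c,p,h,n]) (S p f (R e [d,a,k,b,f,g,m,h,p,c,j,n]) (R f [p,b,j,e,f,d,k,l]))) (R a [a,d,f,e,g,h,n,m,b]))
(R d [b,a,i,e,d,j,l,k,c,f,h,n])) (S n f (S n l (S n m (H p [b,j,m] [d,k,l] (S p e (R e [b,a,j,d,e,i,l,h,p,c,k,n]) (R f
[p,d,k,f,e,b,j,m])) (R d [d,a,i,l,b,k,e,j,c,p,h,n])) (R d [d,a,g,f,b,k,m,j,c,e,h,n])) (R a [a,b,e,f,i,h,n,l,d])) (R g
[a,b,c,d,e,f,g,h,i,j,k,n]))) (S n e (S n l (R a [b,e,j,d,l,k,c,n,a]) (R h [b,e,d,j,a,i,c,f,h,l,k,n])) (S n g (R h
[d,g,f,b,k,a,j,c,e,h,m,n]) (S n f (S n m (R a [b,j,m,d,k,f,c,a,n]) (R h [d,f,b,k,a,g,c,e,h,m,j,n])) (S n m (R c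
[d,a,g,f,b,k,m,j,c,e,h,n]) (R i [d,a,g,f,b,k,m,j,c,e,h,n])))))))"
  by code_simp

lemma refutes_few_A_b:
  "refutes [(a,petersen_minus_vertex), (b,type_s0_s1), (c,type_s0), (d,type_o), (e,type_c0_s0), (f,type_c0_c2),
     (g,type_c0), (h,type_empty)]
    [] few_A_b
    [n,m,l,k,j,i,h,g,f,e,d,c,b,a]
   (S n h (S n e (R a [a,b,e,f,i,h,j,c,n]) (S n f (R a [a,d,f,e,g,h,k,c,n]) (S n g (R a [b,d,g,m,f,h,k,j,n]) (S n m (R b
[d,a,k,b,f,g,m,h,e,c,j,n]) (R c [d,k,a,g,f,b,h,m,j,c,e,n]))))) (S n b (S n e (S n g (H p [b,j,m] [d,k,l] (R d
[b,d,j,a,i,m,p,h,l,k,c,n]) (S p n (R e [d,b,k,a,i,l,p,h,m,j,c,n]) (R a [b,d,i,e,l,h,n,p,a]))) (R f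
[a,b,f,e,d,c,g,k,j,i,h,n])) (S n g (R f [d,g,f,b,k,a,j,c,e,h,m,n]) (S n i (R a [a,b,e,f,i,h,g,n,d]) (R d
[b,a,i,e,d,j,l,k,c,f,h,n])))) (S n e (S n l (R a [b,e,j,d,l,k,c,n,a]) (R g [b,e,d,j,a,i,c,f,h,l,k,n])) (S n g (R g
[d,g,f,b,k,a,j,c,e,h,m,n]) (S n f (S n m (R a [b,j,m,d,k,f,c,a,n]) (R g [d,f,b,k,a,g,c,e,h,m,j,n])) (S n m (R c
[d,a,g,f,b,k,m,j,c,e,h,n]) (R h [d,a,g,f,b,k,m,j,c,e,h,n])))))))"
  by code_simp

lemma refutes_few_A_c:
  "refutes [(a,petersen_minus_vertex), (b,type_s0_s1), (c,type_s0), (d,type_c0_s0), (e,type_o), (f,type_c0_c2),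
     (g,type_c0), (h,type_empty)]
    [] few_A_c
    [n,m,l,k,j,i,h,g,f,e,d,c,b,a]
   (S n h (S n e (R a [a,b,e,f,i,h,j,c,n]) (S n f (R a [a,d,f,e,g,h,k,c,n]) (S n g (R a [b,d,g,m,f,h,k,j,n]) (S n m (R b
[d,a,k,b,f,g,m,h,e,c,j,n]) (R c [d,k,a,g,f,b,h,m,j,c,e,n]))))) (S n d (S n f (S n i (H p [b,j,m] [d,k,l] (S p n (R d
[b,d,j,a,g,m,p,h,l,k,c,n]) (R a [b,d,g,m,f,h,p,n,a])) (R e [d,b,k,a,g,l,p,h,m,j,c,n])) (R f
[a,d,e,f,b,c,i,j,k,g,h,n])) (S n g (S n i (R f [b,i,e,d,j,a,k,c,f,h,l,n]) (R a [a,d,f,e,g,h,i,n,b])) (R e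
[d,a,g,f,b,k,m,j,c,e,h,n]))) (S n e (S n l (R a [b,e,j,d,l,k,c,n,a]) (R g [b,e,d,j,a,i,c,f,h,l,k,n])) (S n g (R g
[d,g,f,b,k,a,j,c,e,h,m,n]) (S n f (S n m (R a [b,j,m,d,k,f,c,a,n]) (R g [d,f,b,k,a,g,c,e,h,m,j,n])) (S n m (R c
[d,a,g,f,b,k,m,j,c,e,h,n]) (R h [d,a,g,f,b,k,m,j,c,e,h,n])))))))"
  by code_simp

lemma refutes_few_A_u:
  "refutes [(a,petersen_minus_vertex), (b,type_s0_s1_s2_s3), (c,type_s0_s1_s2), (d,type_c0_s0), (e,type_s0),
     (f,type_c0_c2), (g,type_c0), (h,type_empty)]
    [] few_A_u
    [n,m,l,k,j,i,h,g,f,e,d,c,b,a]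
   (S n h (S n g (R a [b,d,g,m,f,h,k,j,n]) (S n i (R a [b,d,i,e,l,h,k,j,n]) (S n c (S n e (S n m (R b
[d,a,k,b,f,g,m,h,e,c,j,n]) (R c [d,f,b,k,a,g,c,e,h,m,j,n])) (S n f (S n l (R b [b,a,j,d,e,i,l,h,f,c,k,n]) (R c
[b,e,d,j,a,i,c,f,h,l,k,n])) (R d [a,c,d,e,f,b,h,i,j,k,g,n]))) (S n e (R a [a,b,e,f,i,h,j,c,n]) (S n f (R a
[a,d,f,e,g,h,k,c,n]) (R e [a,c,d,e,f,b,h,i,j,k,g,n])))))) (S n c (S n e (R f [a,c,d,e,f,b,h,i,j,k,g,n]) (S n f (R f
[a,c,b,f,e,d,h,g,k,j,i,n]) (R g [a,c,d,e,f,b,h,i,j,k,g,n]))) (S n e (S n l (R a [b,e,j,d,l,k,c,n,a]) (R g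
[b,e,d,j,a,i,c,f,h,l,k,n])) (S n g (R g [d,g,f,b,k,a,j,c,e,h,m,n]) (S n f (S n m (R a [b,j,m,d,k,f,c,a,n]) (R g
[d,f,b,k,a,g,c,e,h,m,j,n])) (S n m (R e [d,a,g,f,b,k,m,j,c,e,h,n]) (R h [d,a,g,f,b,k,m,j,c,e,h,n])))))))"
  by code_simp

lemma refutes_few_A_v:
  "refutes [(a,petersen_minus_vertex), (b,type_c0_s0), (c,type_s0_s1_s2_s3), (d,type_s0_s1_s2),
     (e,type_s0_s1_s3), (f,type_s0_s1), (g,type_s0), (h,type_c0_c2), (i,type_c0), (j,type_empty)]
    [] few_A_v
    [n,m,l,k,j,i,h,g,f,e,d,c,b,a]
   (S n h (S n f (R a [a,d,f,e,g,h,k,c,n]) (S n e (S n j (S n g (H p [b,i,n] [e,h,l] (R b [b,i,a,j,n,e,k,l,h,f,p,m]) (S p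
m (R c [g,p,h,b,k,e,n,l,a,f,m,j]) (R d [e,h,a,j,l,b,k,d,i,f,p,m]))) (S n m (R c [d,g,a,k,b,f,j,m,h,e,c,n]) (R e
[d,b,k,a,g,f,e,h,m,j,c,n]))) (R a [a,b,e,f,i,h,j,c,n])) (S n l (R f [b,a,j,d,e,i,l,h,f,c,k,n]) (S n j (S n i (S n g (R
c [a,b,c,d,e,f,g,h,i,j,k,n]) (R d [a,c,d,e,f,b,h,i,j,k,g,n])) (R b [b,j,a,i,e,d,h,l,k,c,f,n])) (S n i (R a
[b,d,i,e,l,h,k,j,n]) (R g [b,j,a,i,e,d,h,l,k,c,f,n])))))) (S n e (S n j (R h [b,e,d,j,a,i,c,f,h,l,k,n]) (S n l (R a
[b,e,j,d,l,k,c,n,a]) (R i [b,e,d,j,a,i,c,f,h,l,k,n]))) (S n f (S n m (R a [b,j,m,d,k,f,c,a,n]) (R i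
[d,f,b,k,a,g,c,e,h,m,j,n])) (S n l (R g [b,a,i,e,d,j,l,k,c,f,h,n]) (S n j (S n i (R h [b,i,a,j,d,e,k,l,h,f,c,n]) (R i
[b,j,a,i,e,d,h,l,k,c,f,n])) (S n i (R i [b,i,e,d,j,a,k,c,f,h,l,n]) (R j [b,a,i,e,d,j,l,k,c,f,h,n])))))))"
  by code_simp

lemma refutes_few_A_w:
  "refutes [(a,petersen_minus_vertex), (b,type_s0_s1_s2_s3), (c,type_s0_s1_s2), (d,type_c0_s0),
     (e,type_s0_s1_s3), (f,type_s0_s1), (g,type_s0), (h,type_c0_c2), (i,type_c0), (j,type_empty)]
    [] few_A_w
    [n,m,l,k,j,i,h,g,f,e,d,c,b,a]
   (S n h (S n e (R a [a,b,e,f,i,h,j,c,n]) (S n f (S n k (S n i (H p [b,j,m] [d,k,l] (S p n (R b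
[i,p,j,d,h,b,l,m,a,c,n,g]) (R c [b,j,a,g,m,d,h,f,k,c,p,n])) (R d [d,k,a,g,l,b,h,m,j,c,p,n])) (S n l (R b
[b,i,a,j,d,e,k,l,h,f,c,n]) (R e [b,d,j,a,i,e,f,h,l,k,c,n]))) (R a [a,d,f,e,g,h,k,c,n])) (S n m (R f
[d,a,k,b,f,g,m,h,e,c,j,n]) (S n k (S n g (S n i (R b [a,d,c,b,f,e,i,h,g,k,j,n]) (R c [a,c,b,f,e,d,h,g,k,j,i,n])) (R d
[d,k,a,g,f,b,h,m,j,c,e,n])) (S n g (R a [b,d,g,m,f,h,k,j,n]) (R g [d,k,a,g,f,b,h,m,j,c,e,n])))))) (S n f (S n k (R h
[d,f,b,k,a,g,c,e,h,m,j,n]) (S n m (R a [b,j,m,d,k,f,c,a,n]) (R i [d,f,b,k,a,g,c,e,h,m,j,n]))) (S n e (S n l (R a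
[b,e,j,d,l,k,c,n,a]) (R i [b,e,d,j,a,i,c,f,h,l,k,n])) (S n m (R g [d,a,g,f,b,k,m,j,c,e,h,n]) (S n k (S n g (R h
[d,g,a,k,b,f,j,m,h,e,c,n]) (R i [d,k,a,g,f,b,h,m,j,c,e,n])) (S n g (R i [d,g,f,b,k,a,j,c,e,h,m,n]) (R j
[d,a,g,f,b,k,m,j,c,e,h,n])))))))"
  by code_simp

lemma refutes_cross_A_a:
  "refutes [(a,type_s0_s1_s2_s3), (b,petersen_minus_vertex), (c,type_s0_s1_s3)]
    [] cross_A_a
    [p,n,m,l,k,j,i,h,g,f,e,d,c,b,a]
   (S n g (S n h (S n i (R a [n,b,f,e,d,c,g,k,j,i,p,a]) (R a [a,c,b,f,e,d,h,g,k,j,i,n])) (S n i (R a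
[a,b,f,e,d,c,g,k,j,i,h,n]) (R b [b,e,j,d,l,k,h,i,n]))) (S n h (S n i (R a [a,c,d,e,f,b,h,i,j,k,g,n]) (R c
[a,e,f,b,c,d,j,k,g,h,i,n])) (R b [b,j,m,d,k,f,h,n,g])))"
  by code_simp

lemma refutes_cross_A_b:
  "refutes [(a,type_s0_s1_s2_s3), (b,type_s0_s1_s2), (c,type_s0_s1_s3), (d,petersen_minus_vertex)]
    [] cross_A_b
    [p,n,m,l,k,j,i,h,g,f,e,d,c,b,a]
   (S n f (S n h (S n l (R a [n,a,i,e,d,j,l,k,c,f,p,b]) (R a [b,i,e,d,j,a,k,c,f,h,l,n])) (S n l (R a
[b,a,i,e,d,j,l,k,c,f,h,n]) (R b [b,i,e,d,j,a,k,c,f,h,l,n]))) (S n h (S n l (R a [b,e,i,a,j,d,c,k,l,h,f,n]) (R c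
[b,i,e,d,j,a,k,c,f,h,l,n])) (R d [a,c,e,d,k,g,h,n,f])))"
  by code_simp

lemma refutes_cross_A_c:
  "refutes [(a,type_s0_s1_s2_s3), (b,type_s0_s1_s2), (c,type_s0_s1_s3), (d,petersen_minus_vertex)]
    [] cross_A_c
    [p,n,m,l,k,j,i,h,g,f,e,d,c,b,a]
   (S n e (S n h (S n m (R a [n,a,g,f,b,k,m,j,c,e,p,d]) (R a [d,g,f,b,k,a,j,c,e,h,m,n])) (S n m (R a
[d,a,g,f,b,k,m,j,c,e,h,n]) (R b [d,g,f,b,k,a,j,c,e,h,m,n]))) (S n h (S n m (R a [d,f,g,a,k,b,c,j,m,h,e,n]) (R c
[d,g,f,b,k,a,j,c,e,h,m,n])) (R d [a,c,f,b,j,i,h,n,e])))"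
  by code_simp

lemma refutes_few_B_a:
  "refutes [(a,petersen_minus_vertex), (b,type_s0_s1_s2), (c,type_s0_s1), (d,type_s0), (e,type_o_c0),
     (f,type_o), (g,type_s0_s2), (h,type_c0), (i,type_empty)]
    [[c,h,j,k],[d,i,k,g],[e,j,g,h]] few_B_a
    [l,k,j,i,h,g,f,e,d,c,b,a]
   (S l k (S l c (R a [a,c,e,d,k,g,h,l,f]) (S l d (R a [a,b,d,c,j,k,i,f,l]) (S l g (S l j (R b [a,b,f,e,d,c,g,k,j,i,h,l])
(R c [a,b,f,e,d,c,g,k,j,i,h,l])) (S l j (R c [a,e,f,b,c,d,j,k,g,h,i,l]) (R d [a,f,b,c,d,e,k,g,h,i,j,l]))))) (S l a (S
l c (R e [a,c,d,e,f,b,h,i,j,k,g,l]) (S l d (R e [a,d,e,f,b,c,i,j,k,g,h,l]) (R f [a,b,c,d,e,f,g,h,i,j,k,l]))) (S l g (S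
l d (R a [a,d,f,e,g,h,i,l,b]) (S l j (R g [a,b,f,e,d,c,g,k,j,i,h,l]) (R d [a,b,c,d,e,f,g,h,i,j,k,l]))) (S l d (R h
[a,d,e,f,b,c,i,j,k,g,h,l]) (S l c (S l j (R a [a,c,f,b,j,i,h,l,e]) (R h [a,c,d,e,f,b,h,i,j,k,g,l])) (S l j (R d
[a,e,f,b,c,d,j,k,g,h,i,l]) (R i [a,b,c,d,e,f,g,h,i,j,k,l])))))))"
  by code_simp

lemma refutes_few_B_b:
  "refutes [(a,type_c0_c2_s0), (b,type_c0_s0_s2), (c,type_c0_s0), (d,petersen_minus_vertex), (e,type_s0_s1_s2),
     (f,type_s0_s2), (g,type_s0_s1), (h,type_s0), (i,type_c0_c2), (j,type_c0), (k,type_empty)]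
    [[c,h,j,k],[d,i,k,g],[e,j,g,h]] few_B_b
    [l,k,j,i,h,g,f,e,d,c,b,a]
   (S l g (S l b (S l d (R a [a,b,c,d,e,f,g,h,i,j,k,l]) (S l j (R b [a,b,f,e,d,c,g,k,j,i,h,l]) (R c
[a,b,c,d,e,f,g,h,i,j,k,l]))) (S l d (R d [a,d,f,e,g,h,i,l,b]) (S l j (S l k (R e [a,b,f,e,d,c,g,k,j,i,h,l]) (R f
[a,b,f,e,d,c,g,k,j,i,h,l])) (S l k (R g [a,b,f,e,d,c,g,k,j,i,h,l]) (R h [a,b,c,d,e,f,g,h,i,j,k,l]))))) (S l j (S l c
(R d [a,c,f,b,j,i,h,l,e]) (S l b (R d [a,b,d,c,j,k,g,l,e]) (S l k (R g [a,e,f,b,c,d,j,k,g,h,i,l]) (R h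
[a,e,f,b,c,d,j,k,g,h,i,l])))) (S l d (S l b (R i [a,b,c,d,e,f,g,h,i,j,k,l]) (S l k (R d [a,b,d,c,j,k,i,f,l]) (R j
[a,d,e,f,b,c,i,j,k,g,h,l]))) (S l b (R j [a,b,c,d,e,f,g,h,i,j,k,l]) (S l c (S l k (R d [a,c,e,d,k,g,h,l,f]) (R j
[a,c,d,e,f,b,h,i,j,k,g,l])) (S l k (R h [a,f,b,c,d,e,k,g,h,i,j,l]) (R k [a,b,c,d,e,f,g,h,i,j,k,l])))))))"
  by code_simp

lemma refutes_few_B_c:
  "refutes [(a,type_c0_c2_s0), (b,petersen_minus_vertex), (c,type_c0_s0_s2), (d,type_s0_s1_s2), (e,type_s0_s2),
     (f,type_c0_s0), (g,type_s0_s1), (h,type_s0), (i,type_c0_c2), (j,type_c0), (k,type_empty)]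
    [[c,h,j,k],[d,i,k,g],[e,j,g,h]] few_B_c
    [l,k,j,i,h,g,f,e,d,c,b,a]
   (S l j (S l c (S l e (R a [a,e,d,c,b,f,j,i,h,g,k,l]) (R b [a,c,f,b,j,i,h,l,e])) (S l g (S l e (R c
[a,e,f,b,c,d,j,k,g,h,i,l]) (S l k (R d [a,b,f,e,d,c,g,k,j,i,h,l]) (R e [a,b,f,e,d,c,g,k,j,i,h,l]))) (S l e (R f
[a,e,f,b,c,d,j,k,g,h,i,l]) (S l k (R g [a,e,f,b,c,d,j,k,g,h,i,l]) (R h [a,e,f,b,c,d,j,k,g,h,i,l]))))) (S l g (S l d (R
b [a,d,f,e,g,h,i,l,b]) (S l e (R b [a,c,e,d,k,g,j,b,l]) (S l k (R g [a,b,f,e,d,c,g,k,j,i,h,l]) (R h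
[a,b,c,d,e,f,g,h,i,j,k,l])))) (S l c (S l e (R i [a,c,d,e,f,b,h,i,j,k,g,l]) (S l k (R b [a,c,e,d,k,g,h,l,f]) (R j
[a,c,d,e,f,b,h,i,j,k,g,l]))) (S l e (R j [a,e,f,b,c,d,j,k,g,h,i,l]) (S l d (S l k (R b [a,b,d,c,j,k,i,f,l]) (R j
[a,d,e,f,b,c,i,j,k,g,h,l])) (S l k (R h [a,f,b,c,d,e,k,g,h,i,j,l]) (R k [a,b,c,d,e,f,g,h,i,j,k,l])))))))"
  by code_simp

lemma refutes_few_B_u:
  "refutes [(a,type_c0_c2_s0), (b,petersen_minus_vertex), (c,type_c0_s0), (d,type_s0_s1_s2), (e,type_s0_s1),
     (f,type_s0), (g,type_c0_c2), (h,type_c0), (i,type_s0_s2), (j,type_empty)]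
    [[c,h,j,k],[d,i,k,g],[e,j,g,h]] few_B_u
    [l,k,j,i,h,g,f,e,d,c,b,a]
   (S l k (S l c (S l f (R a [a,f,b,c,d,e,k,g,h,i,j,l]) (R b [a,c,e,d,k,g,h,l,f])) (S l d (S l f (R a
[a,f,e,d,c,b,k,j,i,h,g,l]) (R b [a,b,d,c,j,k,i,f,l])) (S l f (R c [a,f,b,c,d,e,k,g,h,i,j,l]) (S l g (S l j (R d
[a,b,f,e,d,c,g,k,j,i,h,l]) (R e [a,b,f,e,d,c,g,k,j,i,h,l])) (S l j (R e [a,e,f,b,c,d,j,k,g,h,i,l]) (R f
[a,f,b,c,d,e,k,g,h,i,j,l])))))) (S l c (S l f (R g [a,c,b,f,e,d,h,g,k,j,i,l]) (S l j (R b [a,c,f,b,j,i,h,l,e]) (R h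
[a,c,d,e,f,b,h,i,j,k,g,l]))) (S l d (S l f (R g [a,d,e,f,b,c,i,j,k,g,h,l]) (S l g (R b [a,d,f,e,g,h,i,l,b]) (R h
[a,d,e,f,b,c,i,j,k,g,h,l]))) (S l f (R h [a,f,b,c,d,e,k,g,h,i,j,l]) (S l g (S l j (R i [a,b,f,e,d,c,g,k,j,i,h,l]) (R f
[a,b,c,d,e,f,g,h,i,j,k,l])) (S l j (R f [a,e,f,b,c,d,j,k,g,h,i,l]) (R j [a,b,c,d,e,f,g,h,i,j,k,l])))))))"
  by code_simp

lemma refutes_few_B_v:
  "refutes [(a,petersen_minus_vertex), (b,type_s0_s1_s2_s3), (c,type_s0_s1_s3), (d,type_c0_s0_s2),
     (e,type_s0_s1_s2), (f,type_s0_s2), (g,type_s0_s1), (h,type_s0), (i,type_c0_s0), (j,type_c0),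
     (k,type_empty)]
    [[c,h,j,k],[d,i,k,g],[e,j,g,h]] few_B_v
    [l,k,j,i,h,g,f,e,d,c,b,a]
   (S l k (S l c (R a [a,c,e,d,k,g,h,l,f]) (S l i (S l g (S l d (U l) (S l j (R b [a,b,f,e,d,c,g,k,j,i,h,l]) (R c
[a,b,f,e,d,c,g,k,j,i,h,l]))) (S l d (R d [a,d,e,f,b,c,i,j,k,g,h,l]) (S l j (R e [a,d,e,f,b,c,i,j,k,g,h,l]) (R f
[a,d,e,f,b,c,i,j,k,g,h,l])))) (S l d (R a [a,b,d,c,j,k,i,f,l]) (S l g (S l j (R e [a,b,f,e,d,c,g,k,j,i,h,l]) (R g
[a,b,f,e,d,c,g,k,j,i,h,l])) (S l j (R g [a,e,f,b,c,d,j,k,g,h,i,l]) (R h [a,f,b,c,d,e,k,g,h,i,j,l])))))) (S l g (S l i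
(S l d (R d [a,d,c,b,f,e,i,h,g,k,j,l]) (S l j (R c [a,d,e,f,b,c,i,j,k,g,h,l]) (R f [a,b,c,d,e,f,g,h,i,j,k,l]))) (S l d
(R a [a,d,f,e,g,h,i,l,b]) (S l j (R f [a,b,f,e,d,c,g,k,j,i,h,l]) (R h [a,b,c,d,e,f,g,h,i,j,k,l])))) (S l i (S l d (R i
[a,d,e,f,b,c,i,j,k,g,h,l]) (S l j (R g [a,d,e,f,b,c,i,j,k,g,h,l]) (R h [a,d,e,f,b,c,i,j,k,g,h,l]))) (S l d (R j
[a,d,e,f,b,c,i,j,k,g,h,l]) (S l c (S l j (R a [a,c,f,b,j,i,h,l,e]) (R j [a,c,d,e,f,b,h,i,j,k,g,l])) (S l j (R h
[a,e,f,b,c,d,j,k,g,h,i,l]) (R k [a,b,c,d,e,f,g,h,i,j,k,l])))))))"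
  by code_simp

lemma refutes_few_B_w:
  "refutes [(a,petersen_minus_vertex), (b,type_s0_s1_s2_s3), (c,type_s0_s1_s3), (d,type_c0_s0_s2),
     (e,type_s0_s1_s2), (f,type_s0_s2), (g,type_s0_s1), (h,type_s0), (i,type_c0_s0), (j,type_c0),
     (k,type_empty)]
    [[c,h,j,k],[d,i,k,g],[e,j,g,h]] few_B_w
    [l,k,j,i,h,g,f,e,d,c,b,a]
   (S l k (S l d (R a [a,b,d,c,j,k,i,f,l]) (S l h (S l j (S l c (U l) (S l g (R b [a,c,b,f,e,d,h,g,k,j,i,l]) (R c
[a,e,f,b,c,d,j,k,g,h,i,l]))) (S l c (R d [a,c,b,f,e,d,h,g,k,j,i,l]) (S l g (R e [a,c,b,f,e,d,h,g,k,j,i,l]) (R f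
[a,c,b,f,e,d,h,g,k,j,i,l])))) (S l c (R a [a,c,e,d,k,g,h,l,f]) (S l g (S l j (R e [a,b,f,e,d,c,g,k,j,i,h,l]) (R g
[a,b,f,e,d,c,g,k,j,i,h,l])) (S l j (R g [a,e,f,b,c,d,j,k,g,h,i,l]) (R h [a,f,b,c,d,e,k,g,h,i,j,l])))))) (S l h (S l j
(S l c (R d [a,c,d,e,f,b,h,i,j,k,g,l]) (S l g (R c [a,b,c,d,e,f,g,h,i,j,k,l]) (R f [a,c,d,e,f,b,h,i,j,k,g,l]))) (S l c
(R i [a,c,d,e,f,b,h,i,j,k,g,l]) (S l g (R g [a,b,c,d,e,f,g,h,i,j,k,l]) (R h [a,c,d,e,f,b,h,i,j,k,g,l])))) (S l g (S l
d (R a [a,d,f,e,g,h,i,l,b]) (S l j (R f [a,b,f,e,d,c,g,k,j,i,h,l]) (R h [a,b,c,d,e,f,g,h,i,j,k,l]))) (S l d (R j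
[a,d,e,f,b,c,i,j,k,g,h,l]) (S l c (S l j (R a [a,c,f,b,j,i,h,l,e]) (R j [a,c,d,e,f,b,h,i,j,k,g,l])) (S l j (R h
[a,e,f,b,c,d,j,k,g,h,i,l]) (R k [a,b,c,d,e,f,g,h,i,j,k,l])))))))"
  by code_simp

lemma refutes_cross_B_a:
  "refutes [(a,type_s0_s1_s2_s3), (b,type_s0_s1_s2), (c,type_s0_s1_s3), (d,type_s0_s1)]
    [[c,h,j,k],[d,i,k,g],[e,j,g,h]] cross_B_a
    [m,l,k,j,i,h,g,f,e,d,c,b,a]
   (S l g (S l j (S l k (R a [l,b,c,d,e,f,g,h,i,j,m,a]) (R a [a,b,c,d,e,f,g,h,i,j,k,l])) (S l k (R a
[a,d,c,b,f,e,i,h,g,k,j,l]) (R b [a,b,c,d,e,f,g,h,i,j,k,l]))) (S l j (S l k (R a [a,c,d,e,f,b,h,i,j,k,g,l]) (R b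
[a,c,d,e,f,b,h,i,j,k,g,l])) (S l k (R c [a,c,d,e,f,b,h,i,j,k,g,l]) (R d [a,c,d,e,f,b,h,i,j,k,g,l]))))"
  by code_simp

lemma refutes_cross_B_b:
  "refutes [(a,type_o_c0), (b,type_c0_c2_s0), (c,type_c0_s0_s2), (d,petersen_minus_vertex)]
    [[c,h,j,k],[d,i,k,g],[e,j,g,h]] cross_B_b
    [m,l,k,j,i,h,g,f,e,d,c,b,a]
   (S l c (S l k (R a [a,e,f,b,c,d,j,k,g,h,i,m]) (R b [a,c,b,f,e,d,h,g,k,j,i,l])) (S l k (R c [a,f,b,c,d,e,k,g,h,i,j,l])
(R d [a,d,f,e,g,h,k,c,l])))"
  by code_simp

lemma refutes_cross_B_c:
  "refutes [(a,type_o_c0), (b,type_c0_c2_s0), (c,type_c0_s0_s2), (d,petersen_minus_vertex)]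
    [[c,h,j,k],[d,i,k,g],[e,j,g,h]] cross_B_c
    [m,l,k,j,i,h,g,f,e,d,c,b,a]
   (S l d (S l k (R a [a,b,c,d,e,f,g,h,i,j,k,m]) (R b [a,d,e,f,b,c,i,j,k,g,h,l])) (S l k (R c [a,f,e,d,c,b,k,j,i,h,g,l])
(R d [a,c,f,b,j,i,k,d,l])))"
  by code_simp

hide_const (open) a b c d e f g h i j k l m n p q S C H D F U R

section \<open>Patterns avoided by the graph\<close>

context dense_maximal_graph
begin

lemma avoids_cube_square: "avoids E cube_square"
  by (rule avoids_by_refutation[OF refutes_cube_square], simp, code_simp)

lemma avoids_cube_star: "avoids E cube_star"
  by (rule avoids_by_refutation[OF refutes_cube_star], simp add: avoids_cube_square, code_simp)

lemma avoids_cube: "avoids E cube"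
  by (rule avoids_by_refutation[OF refutes_cube], simp add: avoids_cube_star, code_simp)

lemma avoids_petersen_plus_two: "avoids E petersen_plus_two"
  by (rule avoids_by_refutation[OF refutes_petersen_plus_two], simp add: avoids_cube, code_simp)

lemma avoids_petersen_plus_one: "avoids E petersen_plus_one"
  by (rule avoids_by_refutation[OF refutes_petersen_plus_one], simp add: avoids_cube avoids_petersen_plus_two, code_simp)

lemma avoids_petersen_minus_vertex: "avoids E petersen_minus_vertex"
  by (rule avoids_by_refutation[OF refutes_petersen_minus_vertex], simp add: avoids_petersen_plus_one, code_simp)

lemma avoids_type_s0_s1: "avoids E type_s0_s1"
  by (rule avoids_by_refutation[OF refutes_type_s0_s1], simp add: avoids_petersen_minus_vertex, code_simp)

lemma avoids_type_s0_s1_s2: "avoids E type_s0_s1_s2"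
  by (rule avoids_by_refutation[OF refutes_type_s0_s1_s2], simp add: avoids_petersen_minus_vertex, code_simp)

lemma avoids_type_s0_s1_s2_s3: "avoids E type_s0_s1_s2_s3"
  by (rule avoids_by_refutation[OF refutes_type_s0_s1_s2_s3], simp add: avoids_petersen_minus_vertex, code_simp)

lemma avoids_type_s0_s1_s3: "avoids E type_s0_s1_s3"
  by (rule avoids_by_refutation[OF refutes_type_s0_s1_s3], simp add: avoids_type_s0_s1_s2_s3, code_simp)

lemma avoids_type_s0_s2: "avoids E type_s0_s2"
  by (rule avoids_by_refutation[OF refutes_type_s0_s2], simp add: avoids_petersen_minus_vertex avoids_type_s0_s1_s2 avoids_type_s0_s1_s3 avoids_cube avoids_type_s0_s1_s2_s3 avoids_type_s0_s1, code_simp)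

lemma avoids_type_c0_s0: "avoids E type_c0_s0"
  by (rule avoids_by_refutation[OF refutes_type_c0_s0], simp add: avoids_type_s0_s1_s2_s3 avoids_type_s0_s1_s3 avoids_type_s0_s1_s2 avoids_petersen_minus_vertex avoids_type_s0_s1 avoids_cube avoids_type_s0_s2, code_simp)

lemma avoids_type_c0_c2: "avoids E type_c0_c2"
  by (rule avoids_by_refutation[OF refutes_type_c0_c2], simp add: avoids_type_s0_s1_s2_s3 avoids_type_s0_s1_s3 avoids_type_s0_s2 avoids_type_s0_s1_s2 avoids_type_c0_s0 avoids_petersen_minus_vertex avoids_cube avoids_type_s0_s1, code_simp)

lemma avoids_type_s0: "avoids E type_s0"
  by (rule avoids_by_refutation[OF refutes_type_s0], simp add: avoids_petersen_minus_vertex avoids_type_s0_s1 avoids_type_c0_s0 avoids_type_s0_s1_s2_s3 avoids_type_s0_s2, code_simp)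

lemma avoids_type_c0: "avoids E type_c0"
  by (rule avoids_by_refutation[OF refutes_type_c0], simp add: avoids_petersen_minus_vertex avoids_type_c0_s0 avoids_type_s0_s1_s2_s3 avoids_type_s0_s1_s2 avoids_type_s0_s1_s3 avoids_type_s0_s1 avoids_type_s0_s2 avoids_type_s0, code_simp)

lemma avoids_type_empty: "avoids E type_empty"
  by (rule avoids_by_refutation[OF refutes_type_empty], simp add: avoids_type_s0 avoids_type_c0, code_simp)

lemma avoids_type_o: "avoids E type_o"
  by (rule avoids_by_refutation[OF refutes_type_o], simp add: avoids_type_c0_s0 avoids_type_s0_s1_s2_s3 avoids_type_s0_s1_s2 avoids_petersen_minus_vertex avoids_type_c0_c2 avoids_cube avoids_type_s0_s2 avoids_type_c0 avoids_type_s0_s1_s3 avoids_type_s0_s1, code_simp)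

lemma avoids_type_c0_s0_s2:
  assumes K: "avoids E grotzsch_plus_two"
  shows "avoids E type_c0_s0_s2"
  by (rule avoids_by_refutation[OF refutes_type_c0_s0_s2], simp add: K avoids_type_c0_c2 avoids_petersen_minus_vertex avoids_type_s0_s1_s2_s3 avoids_type_s0_s1_s3 avoids_type_s0_s1_s2 avoids_type_s0_s1 avoids_type_c0_s0 avoids_type_o avoids_cube, code_simp)

lemma avoids_type_c0_c2_s0:
  assumes K: "avoids E grotzsch_plus_two"
  shows "avoids E type_c0_c2_s0"
  by (rule avoids_by_refutation[OF refutes_type_c0_c2_s0], simp add: K avoids_type_c0_s0_s2[OF K] avoids_petersen_minus_vertex avoids_type_s0_s1_s2_s3 avoids_type_s0_s1_s2 avoids_type_s0_s1_s3 avoids_type_s0_s1, code_simp)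

lemma avoids_type_o_c0:
  assumes K: "avoids E grotzsch_plus_two"
  shows "avoids E type_o_c0"
  by (rule avoids_by_refutation[OF refutes_type_o_c0], simp add: K avoids_type_c0_c2_s0[OF K] avoids_type_c0_s0_s2[OF K] avoids_type_c0_s0 avoids_type_c0_c2 avoids_petersen_minus_vertex, code_simp)

lemma avoids_few_A_a: "avoids E few_A_a"
  by (rule avoids_by_refutation[OF refutes_few_A_a], simp add: avoids_petersen_minus_vertex avoids_type_s0_s1 avoids_type_s0 avoids_type_c0_c2 avoids_type_c0_s0 avoids_cube avoids_type_o avoids_type_c0 avoids_type_empty, code_simp)

lemma avoids_few_A_b: "avoids E few_A_b"
  by (rule avoids_by_refutation[OF refutes_few_A_b], simp add: avoids_petersen_minus_vertex avoids_type_s0_s1 avoids_type_s0 avoids_type_o avoids_type_c0_s0 avoids_type_c0_c2 avoids_type_c0 avoids_type_empty, code_simp)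

lemma avoids_few_A_c: "avoids E few_A_c"
  by (rule avoids_by_refutation[OF refutes_few_A_c], simp add: avoids_petersen_minus_vertex avoids_type_s0_s1 avoids_type_s0 avoids_type_c0_s0 avoids_type_o avoids_type_c0_c2 avoids_type_c0 avoids_type_empty, code_simp)

lemma avoids_few_A_u: "avoids E few_A_u"
  by (rule avoids_by_refutation[OF refutes_few_A_u], simp add: avoids_petersen_minus_vertex avoids_type_s0_s1_s2_s3 avoids_type_s0_s1_s2 avoids_type_c0_s0 avoids_type_s0 avoids_type_c0_c2 avoids_type_c0 avoids_type_empty, code_simp)

lemma avoids_few_A_v: "avoids E few_A_v"
  by (rule avoids_by_refutation[OF refutes_few_A_v], simp add: avoids_petersen_minus_vertex avoids_type_c0_s0 avoids_type_s0_s1_s2_s3 avoids_type_s0_s1_s2 avoids_type_s0_s1_s3 avoids_type_s0_s1 avoids_type_s0 avoids_type_c0_c2 avoids_type_c0 avoids_type_empty, code_simp)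

lemma avoids_few_A_w: "avoids E few_A_w"
  by (rule avoids_by_refutation[OF refutes_few_A_w], simp add: avoids_petersen_minus_vertex avoids_type_s0_s1_s2_s3 avoids_type_s0_s1_s2 avoids_type_c0_s0 avoids_type_s0_s1_s3 avoids_type_s0_s1 avoids_type_s0 avoids_type_c0_c2 avoids_type_c0 avoids_type_empty, code_simp)

lemma avoids_cross_A_a: "avoids E cross_A_a"
  by (rule avoids_by_refutation[OF refutes_cross_A_a], simp add: avoids_type_s0_s1_s2_s3 avoids_petersen_minus_vertex avoids_type_s0_s1_s3, code_simp)

lemma avoids_cross_A_b: "avoids E cross_A_b"
  by (rule avoids_by_refutation[OF refutes_cross_A_b], simp add: avoids_type_s0_s1_s2_s3 avoids_type_s0_s1_s2 avoids_type_s0_s1_s3 avoids_petersen_minus_vertex, code_simp)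

lemma avoids_cross_A_c: "avoids E cross_A_c"
  by (rule avoids_by_refutation[OF refutes_cross_A_c], simp add: avoids_type_s0_s1_s2_s3 avoids_type_s0_s1_s2 avoids_type_s0_s1_s3 avoids_petersen_minus_vertex, code_simp)

end

section \<open>Pach's characterisation of Andrasfai graphs\<close>

abbreviation circ :: "nat \<Rightarrow> int" where "circ k \<equiv> 3 * int k - 1"

text \<open>The interval from k to 2k-1 is invariant under d -> 3k-1-d, so the sign of a difference
  does not matter and adjacency of representatives becomes linear arithmetic.\<close>

lemma adj_abs:
  assumes "\<bar>i - j\<bar> < circ k"
  shows "andrasfai_adj k i j \<longleftrightarrow> int k \<le> \<bar>i - j\<bar> \<and> \<bar>i - j\<bar> \<le> 2 * int k - 1"
proof (cases "0 \<le> i - j")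
  case True
  then have "(i - j) mod circ k = i - j" using assms by simp
  then show ?thesis using True by (auto simp: andrasfai_adj_def)
next
  case False
  have "(i - j) mod circ k = (i - j + circ k) mod circ k" by (rule mod_add_self2[symmetric])
  also have "\<dots> = i - j + circ k" using False assms by (intro mod_pos_pos_trivial) auto
  finally show ?thesis using False by (auto simp: andrasfai_adj_def)
qed

lemma adj_shift: "andrasfai_adj k ((i + r) mod circ k) ((j + r) mod circ k) = andrasfai_adj k i j"
  by (simp add: andrasfai_adj_def mod_simps)

lemma adj_sym: "andrasfai_adj k i j \<Longrightarrow> k \<ge> 1 \<Longrightarrow> andrasfai_adj k j i"
proof -
  assume a: "andrasfai_adj k i j" and k: "k \<ge> 1"
  have "(j - i) mod circ k = (- ((i - j) mod circ k)) mod circ k" by (simp add: mod_simps)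
  also have "\<dots> = (circ k - (i - j) mod circ k) mod circ k" by (simp add: mod_simps)
  also have "\<dots> = circ k - (i - j) mod circ k"
    using a k by (intro mod_pos_pos_trivial) (auto simp: andrasfai_adj_def)
  finally show ?thesis using a by (simp add: andrasfai_adj_def)
qed

lemma nonadj_common:
  assumes "k \<ge> 1" "\<not> andrasfai_adj k i j"
  shows "\<exists>l\<in>{0..<circ k}. andrasfai_adj k l i \<and> andrasfai_adj k l j"
proof -
  have *: "\<exists>l\<in>{0..<circ k}. andrasfai_adj k l i \<and> andrasfai_adj k l j" if d: "(i - j) mod circ k \<le> int k - 1" for i j
  proof -
    define d' where "d' = (i - j) mod circ k"
    have d': "0 \<le> d'" "d' \<le> int k - 1" using d assms(1) by (simp_all add: d'_def)
    \<comment> \<open>The witness is the neighbour of \<open>j\<close> at distance 2k-1; its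
      distance from \<open>i\<close> is 2k-1-d', which is at least k because d' <= k-1.\<close>
    have "(j + 2 * int k - 1 - j) mod circ k = 2 * int k - 1"
      using assms(1) by (simp add: mod_pos_pos_trivial)
    then have 1: "andrasfai_adj k (j + 2 * int k - 1) j" using assms(1) by (simp add: andrasfai_adj_def)
    have "(j + 2 * int k - 1 - i) mod circ k = (2 * int k - 1 - (i - j)) mod circ k"
      by (simp add: algebra_simps)
    also have "\<dots> = (2 * int k - 1 - (i - j) mod circ k) mod circ k"
      by (rule mod_diff_right_eq[symmetric])
    also have "\<dots> = 2 * int k - 1 - d'"
      unfolding d'_def[symmetric] using d' assms(1) by (intro mod_pos_pos_trivial) auto
    finally have 2: "andrasfai_adj k (j + 2 * int k - 1) i" using d' by (simp add: andrasfai_adj_def)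
    have "andrasfai_adj k ((j + 2 * int k - 1) mod circ k) x = andrasfai_adj k (j + 2 * int k - 1) x" for x
      by (simp add: andrasfai_adj_def mod_simps)
    then show ?thesis
      using 1 2 assms(1) by (intro bexI[of _ "(j + 2 * int k - 1) mod circ k"]) auto
  qed
  show ?thesis
  proof (cases "(i - j) mod circ k \<le> int k - 1")
    case False
    have b: "(i - j) mod circ k < circ k" using assms(1) by simp
    have "(j - i) mod circ k = (- ((i - j) mod circ k)) mod circ k" by (simp add: mod_simps)
    also have "\<dots> = (circ k - (i - j) mod circ k) mod circ k" by (simp add: mod_simps)
    also have "\<dots> = circ k - (i - j) mod circ k"
      using False assms(1) b by (intro mod_pos_pos_trivial) linarith+
    finally have "(j - i) mod circ k \<le> int k - 1"
      using False assms(2) by (auto simp: andrasfai_adj_def)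
    from *[OF this] show ?thesis by blast
  qed (rule *)
qed

text \<open>By \<open>adj_iff_in_arc\<close> the arcs of k consecutive residues are exactly the
  neighbourhoods of single vertices.\<close>

definition in_arc :: "nat \<Rightarrow> int \<Rightarrow> int \<Rightarrow> bool" where
  "in_arc k r j \<longleftrightarrow> (j - r) mod circ k < int k"

text \<open>Non-adjacency to a fixed \<open>s\<close> confines \<open>T\<close> to the 2k-1 residues
  around \<open>s\<close>. Inside this window the circle is a line, so \<open>T\<close> has a first
  element; the others are at most 2k-2 beyond it and not adjacent to it, hence less than k beyond
  it.\<close>

lemma independent_in_arc:
  assumes k: "k \<ge> 1" and T: "T \<subseteq> {0..<circ k}" and ind: "\<forall>i\<in>T. \<forall>j\<in>T. \<not> andrasfai_adj k i j"
  shows "\<exists>r. \<forall>j\<in>T. in_arc k r j"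
proof (cases "T = {}")
  case False
  then obtain s where s: "s \<in> T" by blast
  \<comment> \<open>The offset k-1 moves the window from s-(k-1) to s+(k-1) onto 0 to 2k-2.\<close>
  define w where "w j = (j - s + (int k - 1)) mod circ k" for j
  have pos: "0 < circ k" using k by simp
  have w_rng: "0 \<le> w j \<and> w j \<le> 2 * int k - 2" if "j \<in> T" for j
  proof -
    define d where "d = (j - s) mod circ k"
    have d: "0 \<le> d" "d < circ k" using pos by (simp_all add: d_def)
    have nd: "\<not> (int k \<le> d \<and> d \<le> 2 * int k - 1)" using ind s that by (auto simp: andrasfai_adj_def d_def)
    have wd: "w j = (d + (int k - 1)) mod circ k" by (simp add: w_def d_def mod_simps)
    show ?thesis
    proof (cases "d < int k")
      case True
      then have "w j = d + (int k - 1)" unfolding wd using d k by (intro mod_pos_pos_trivial) auto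
      then show ?thesis using True d k by auto
    next
      case False
      then have d2: "2 * int k \<le> d" using nd by linarith
      have "w j = (d + (int k - 1) - circ k) mod circ k" unfolding wd by (simp only: minus_mod_self2)
      also have "\<dots> = d + (int k - 1) - circ k" using d2 d k by (intro mod_pos_pos_trivial) auto
      finally show ?thesis using d d2 by auto
    qed
  qed
  have fin: "finite (w ` T)" using T finite_subset by blast
  define m where "m = Min (w ` T)"
  have "m \<in> w ` T" unfolding m_def by (rule Min_in[OF fin]) (use s in blast)
  moreover have m: "m \<le> w j" if "j \<in> T" for j unfolding m_def using fin that by simp
  ultimately obtain i where i: "i \<in> T" "w i = m" by blast
  have "in_arc k (s - (int k - 1) + m) j" if j: "j \<in> T" for j
  proof -
    have a: "0 \<le> w j - m" "w j - m \<le> 2 * int k - 2" using m[OF j] w_rng[OF j] w_rng[OF i(1)] i(2) by auto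
    have "(j - i) mod circ k = (w j - w i) mod circ k" by (simp add: w_def mod_simps)
    also have "\<dots> = w j - m" using a k i(2) by (simp add: mod_pos_pos_trivial)
    finally have e: "(j - i) mod circ k = w j - m" .
    have "\<not> andrasfai_adj k j i" using ind j i(1) by blast
    then have "\<not> (int k \<le> w j - m \<and> w j - m \<le> 2 * int k - 1)" by (simp add: andrasfai_adj_def e)
    then have "w j - m < int k" using a by linarith
    moreover have "(j - (s - (int k - 1) + m)) mod circ k = (w j - m) mod circ k"
      by (simp add: w_def mod_simps algebra_simps)
    ultimately show ?thesis using a k by (simp add: in_arc_def mod_pos_pos_trivial)
  qed
  then show ?thesis by blast
qed (simp add: in_arc_def)

lemma adj_iff_in_arc:
  assumes "k \<ge> 1"
  shows "andrasfai_adj k (r + 2 * int k - 1) j \<longleftrightarrow> in_arc k r j"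
proof -
  define d where "d = (j - r) mod circ k"
  have d: "0 \<le> d" "d < circ k" using assms by (simp_all add: d_def)
  have "(r + 2 * int k - 1 - j) mod circ k = (2 * int k - 1 - (j - r)) mod circ k"
    by (simp add: algebra_simps)
  also have "\<dots> = (2 * int k - 1 - d) mod circ k"
    unfolding d_def by (rule mod_diff_right_eq[symmetric])
  finally have e: "(r + 2 * int k - 1 - j) mod circ k = (2 * int k - 1 - d) mod circ k" .
  show ?thesis
  proof (cases "d \<le> 2 * int k - 1")
    case True
    then have "(2 * int k - 1 - d) mod circ k = 2 * int k - 1 - d"
      using d assms by (intro mod_pos_pos_trivial) auto
    then show ?thesis using e d by (auto simp: andrasfai_adj_def in_arc_def d_def[symmetric])
  next
    case False
    have "(2 * int k - 1 - d) mod circ k = (2 * int k - 1 - d + circ k) mod circ k" by (rule mod_add_self2[symmetric])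
    also have "\<dots> = 2 * int k - 1 - d + circ k" using False d by (intro mod_pos_pos_trivial) auto
    finally show ?thesis using e d False by (auto simp: andrasfai_adj_def in_arc_def d_def[symmetric])
  qed
qed

text \<open>Neighbourhoods are arcs, and an arc determines its start: if two arcs coincide, each
  contains the start of the other, so both differences of the starts are below k, whereas for
  distinct starts they add up to 3k-1.\<close>

lemma adj_inj:
  assumes k: "k \<ge> 1" and ij: "i \<in> {0..<circ k}" "j \<in> {0..<circ k}"
    and same: "\<And>l. l \<in> {0..<circ k} \<Longrightarrow> andrasfai_adj k i l \<longleftrightarrow> andrasfai_adj k j l"
  shows "i = j"
proof -
  have red: "andrasfai_adj k x (l mod circ k) = andrasfai_adj k x l" for x l
    by (simp add: andrasfai_adj_def mod_simps)
  have arc: "in_arc k (i - 2 * int k + 1) l \<longleftrightarrow> in_arc k (j - 2 * int k + 1) l" for l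
    using same[of "l mod circ k"] k adj_iff_in_arc[OF k, of "i - 2 * int k + 1" l]
      adj_iff_in_arc[OF k, of "j - 2 * int k + 1" l] by (simp add: red)
  define d where "d = (i - j) mod circ k"
  have d: "0 \<le> d" "d < circ k" using k by (simp_all add: d_def)
  have "(i - j) mod circ k < int k" using arc[of "i - 2 * int k + 1"] k by (simp add: in_arc_def)
  moreover have "(j - i) mod circ k < int k" using arc[of "j - 2 * int k + 1"] k by (simp add: in_arc_def)
  moreover have "(j - i) mod circ k = (- d) mod circ k" by (simp add: d_def mod_simps)
  moreover have "(- d) mod circ k = circ k - d" if "d > 0"
  proof -
    have "(- d) mod circ k = (- d + circ k) mod circ k" by (rule mod_add_self2[symmetric])
    also have "\<dots> = circ k - d" using that d by (subst mod_pos_pos_trivial) auto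
    finally show ?thesis .
  qed
  ultimately have "d = 0" using d k unfolding d_def[symmetric] by linarith
  then have "circ k dvd i - j" unfolding d_def by (simp add: dvd_eq_mod_eq_0)
  then show ?thesis using ij by (metis atLeastLessThan_iff mod_eq_dvd_iff mod_pos_pos_trivial)
qed

section \<open>Extending an embedded Andrasfai graph\<close>

definition embeds :: "('a \<Rightarrow> 'a \<Rightarrow> bool) \<Rightarrow> 'a set \<Rightarrow> nat \<Rightarrow> (int \<Rightarrow> 'a) \<Rightarrow> bool" where
  "embeds E V k \<phi> \<longleftrightarrow> (\<forall>i\<in>{0..<circ k}. \<phi> i \<in> V) \<and>
     (\<forall>i\<in>{0..<circ k}. \<forall>j\<in>{0..<circ k}. andrasfai_adj k i j \<longrightarrow> E (\<phi> i) (\<phi> j))"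

lemma embeds_rotate:
  assumes "embeds E V k \<phi>" "k \<ge> 1"
  shows "embeds E V k (\<lambda>j. \<phi> ((j + r) mod circ k))"
proof -
  have "(j + r) mod circ k \<in> {0..<circ k}" for j using assms(2) by simp
  then show ?thesis using assms(1) adj_shift[of k] unfolding embeds_def by blast
qed

text \<open>\<open>V\<close> will be the set of all vertices or \<open>core\<close>. The dominating
  vertex must lie in \<open>V\<close> again, which keeps the growing embeddings inside
  \<open>V\<close>.\<close>

locale dominated_graph =
  fixes E :: "'a \<Rightarrow> 'a \<Rightarrow> bool" and V :: "'a set"
  assumes sym: "E u v \<Longrightarrow> E v u"
    and triangle_free: "E u v \<Longrightarrow> E v w \<Longrightarrow> E u w \<Longrightarrow> False"
    and dominated: "finite I \<Longrightarrow> I \<subseteq> V \<Longrightarrow> (\<And>x y. x \<in> I \<Longrightarrow> y \<in> I \<Longrightarrow> \<not> E x y) \<Longrightarrow> \<exists>w\<in>V. \<forall>x\<in>I. E w x"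
begin

lemma common_nonadj: "E w x \<Longrightarrow> E w y \<Longrightarrow> \<not> E x y"
  using sym triangle_free by blast

text \<open>The ends of a non-edge of an Andrasfai graph have a common neighbour there, so
  preservation of edges already entails preservation of non-edges.\<close>

lemma embeds_nonadj:
  assumes "embeds E V k \<phi>" "k \<ge> 1" "i \<in> {0..<circ k}" "j \<in> {0..<circ k}" "\<not> andrasfai_adj k i j"
  shows "\<not> E (\<phi> i) (\<phi> j)"
proof -
  obtain l where "l \<in> {0..<circ k}" "andrasfai_adj k l i" "andrasfai_adj k l j"
    using nonadj_common[OF assms(2,5)] by blast
  then show ?thesis using assms common_nonadj unfolding embeds_def by blast
qed

lemma embeds_arc_nonadj:
  assumes "embeds E V k \<phi>" "k \<ge> 1" "0 \<le> i" "i < circ k" "0 \<le> j" "j < circ k" "\<bar>i - j\<bar> < int k"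
  shows "\<not> E (\<phi> i) (\<phi> j)"
  using assms by (intro embeds_nonadj) (auto simp: adj_abs)

lemma embeds_edge:
  assumes "embeds E V k \<phi>" "0 \<le> i" "i < circ k" "0 \<le> j" "j < circ k" "int k \<le> j - i" "j - i \<le> 2 * int k - 1"
  shows "E (\<phi> i) (\<phi> j)"
proof -
  have "andrasfai_adj k i j" using assms by (subst adj_abs) auto
  then show ?thesis using assms unfolding embeds_def by auto
qed

lemma embedsI:
  assumes "\<And>i. 0 \<le> i \<Longrightarrow> i < circ k \<Longrightarrow> \<phi> i \<in> V"
    and "\<And>i j. 0 \<le> i \<Longrightarrow> i < circ k \<Longrightarrow> 0 \<le> j \<Longrightarrow> j < circ k \<Longrightarrow> int k \<le> j - i \<Longrightarrow> j - i \<le> 2 * int k - 1 \<Longrightarrow> E (\<phi> i) (\<phi> j)"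
  shows "embeds E V k \<phi>"
  unfolding embeds_def
proof (intro conjI ballI impI)
  fix i j assume ij: "i \<in> {0..<circ k}" "j \<in> {0..<circ k}" "andrasfai_adj k i j"
  then have "int k \<le> \<bar>i - j\<bar> \<and> \<bar>i - j\<bar> \<le> 2 * int k - 1" using adj_abs[of i j k] by auto
  then have "int k \<le> j - i \<and> j - i \<le> 2 * int k - 1 \<or> int k \<le> i - j \<and> i - j \<le> 2 * int k - 1" by linarith
  then show "E (\<phi> i) (\<phi> j)" using assms(2)[of i j] assms(2)[of j i] sym ij by auto
qed (use assms(1) in auto)

text \<open>The three new vertices of the larger Andrasfai graph dominate the three arcs of length \<open>k\<close>, \<open>k\<close>
  and \<open>k - 1\<close> into which the circle falls, the first two together with \<open>z\<close>.\<close>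

lemma extend_top:
  assumes e: "embeds E V k \<phi>" and k: "k \<ge> 1" and z: "z \<in> V"
    and arc: "\<And>j. 0 \<le> j \<Longrightarrow> j < circ k \<Longrightarrow> E z (\<phi> j) \<Longrightarrow> 2 * int k \<le> j"
  shows "\<exists>\<psi>. embeds E V (Suc k) \<psi>"
proof -
  let ?k = "int k"
  have \<phi>V: "\<phi> j \<in> V" if "0 \<le> j" "j < circ k" for j using e that unfolding embeds_def by auto
  have zz: "\<not> E z z" using triangle_free by blast
  have A: "\<exists>w\<in>V. \<forall>x\<in>insert z (\<phi> ` {p..<p + ?k}). E w x" if p: "0 \<le> p" "p \<le> ?k" for p
  proof (rule dominated)
    show "insert z (\<phi> ` {p..<p + ?k}) \<subseteq> V" using z p k \<phi>V by auto
    have *: "\<not> E z (\<phi> i)" "\<not> E (\<phi> i) z" if "i \<in> {p..<p + ?k}" for i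
      using arc[of i] that p k sym by auto
    show "\<not> E x y" if "x \<in> insert z (\<phi> ` {p..<p + ?k})" "y \<in> insert z (\<phi> ` {p..<p + ?k})" for x y
      using that zz * embeds_arc_nonadj[OF e k] p k by auto
  qed simp
  obtain \<alpha> where \<alpha>: "\<alpha> \<in> V" "E \<alpha> z" "\<And>i. 0 \<le> i \<Longrightarrow> i < ?k \<Longrightarrow> E \<alpha> (\<phi> i)"
    using A[of 0] by auto
  obtain \<beta> where \<beta>: "\<beta> \<in> V" "E \<beta> z" "\<And>i. ?k \<le> i \<Longrightarrow> i < 2 * ?k \<Longrightarrow> E \<beta> (\<phi> i)"
    using A[of ?k] by auto
  have \<alpha>R: "\<not> E \<alpha> (\<phi> j)" if j: "2 * ?k \<le> j" "j < circ k" for j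
  proof -
    have "E (\<phi> (?k - 1)) (\<phi> j)" using j k by (intro embeds_edge[OF e]) auto
    then show ?thesis using \<alpha>(3)[of "?k - 1"] k triangle_free[of \<alpha> "\<phi> (?k - 1)" "\<phi> j"] by auto
  qed
  have \<beta>R: "\<not> E \<beta> (\<phi> j)" if j: "2 * ?k \<le> j" "j < circ k" for j
  proof -
    have "E (\<phi> ?k) (\<phi> j)" using j k by (intro embeds_edge[OF e]) auto
    then show ?thesis using \<beta>(3)[of ?k] k triangle_free[of \<beta> "\<phi> ?k" "\<phi> j"] by auto
  qed
  have "\<exists>w\<in>V. \<forall>x\<in>insert \<alpha> (insert \<beta> (\<phi> ` {2 * ?k..<circ k})). E w x"
  proof (rule dominated)
    show "insert \<alpha> (insert \<beta> (\<phi> ` {2 * ?k..<circ k})) \<subseteq> V" using \<alpha>(1) \<beta>(1) k \<phi>V by auto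
    \<comment> \<open>The common neighbour \<open>z\<close> keeps \<alpha> and \<beta> non-adjacent,
      so that they form an independent set with the third arc.\<close>
    have "\<not> E \<alpha> \<beta>" "\<not> E \<beta> \<alpha>" "\<not> E \<alpha> \<alpha>" "\<not> E \<beta> \<beta>"
      using \<alpha>(2) \<beta>(2) triangle_free sym by blast+
    moreover have "\<not> E (\<phi> j) \<alpha>" "\<not> E (\<phi> j) \<beta>" if "2 * ?k \<le> j" "j < circ k" for j
      using \<alpha>R[OF that] \<beta>R[OF that] sym by blast+
    ultimately show "\<not> E x y" if "x \<in> insert \<alpha> (insert \<beta> (\<phi> ` {2 * ?k..<circ k}))"
        "y \<in> insert \<alpha> (insert \<beta> (\<phi> ` {2 * ?k..<circ k}))" for x y
      using that \<alpha>R \<beta>R embeds_arc_nonadj[OF e k] k by auto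
  qed simp
  then obtain \<gamma> where \<gamma>: "\<gamma> \<in> V" "E \<gamma> \<alpha>" "E \<gamma> \<beta>" "\<And>j. 2 * ?k \<le> j \<Longrightarrow> j < circ k \<Longrightarrow> E \<gamma> (\<phi> j)"
    by auto
  \<comment> \<open>\<gamma> goes between the first two arcs, \<alpha> between the last two and
    \<beta> to the end, so indices of the second arc rise by one and those of the third by
    two.\<close>
  define \<psi> where "\<psi> j = (if j < ?k then \<phi> j else if j = ?k then \<gamma> else if j \<le> 2 * ?k then \<phi> (j - 1)
      else if j = 2 * ?k + 1 then \<alpha> else if j \<le> 3 * ?k then \<phi> (j - 2) else \<beta>)" for j :: int
  have "embeds E V (Suc k) \<psi>"
  proof (rule embedsI)
    show "\<psi> i \<in> V" if "0 \<le> i" "i < circ (Suc k)" for i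
      using that k \<alpha>(1) \<beta>(1) \<gamma>(1) by (auto simp: \<psi>_def intro!: \<phi>V)
    fix i j assume "0 \<le> i" "i < circ (Suc k)" "0 \<le> j" "j < circ (Suc k)"
      "int (Suc k) \<le> j - i" "j - i \<le> 2 * int (Suc k) - 1"
    then have ij: "0 \<le> i" "j \<le> 3 * ?k + 1" "?k + 1 \<le> j - i" "j - i \<le> 2 * ?k + 1" by auto
    consider "j \<le> 2 * ?k" | "j = 2 * ?k + 1" | "2 * ?k + 2 \<le> j" "j \<le> 3 * ?k" | "j = 3 * ?k + 1"
      using ij by linarith
    then show "E (\<psi> i) (\<psi> j)"
    proof cases
      case 1
      have "E (\<phi> i) (\<phi> (j - 1))" using 1 ij k by (intro embeds_edge[OF e]) auto
      then show ?thesis using 1 ij k by (auto simp: \<psi>_def)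
    next
      case 2
      then have "\<psi> j = \<alpha>" "\<psi> i = (if i < ?k then \<phi> i else \<gamma>)" using ij k by (auto simp: \<psi>_def)
      then show ?thesis using \<alpha>(3)[of i] \<gamma>(2) sym ij by auto
    next
      case 3
      have j: "\<psi> j = \<phi> (j - 2)" using 3 k by (auto simp: \<psi>_def)
      consider "i < ?k" | "i = ?k" | "?k < i" "i \<le> 2 * ?k" using ij 3 by linarith
      then show ?thesis
      proof cases
        case 1
        then have "E (\<phi> i) (\<phi> (j - 2))" using 3 ij k by (intro embeds_edge[OF e]) auto
        then show ?thesis using 1 j by (simp add: \<psi>_def)
      next
        case 2 then show ?thesis using 3 j \<gamma>(4)[of "j - 2"] by (simp add: \<psi>_def)
      next
        case i: 3
        then have "E (\<phi> (i - 1)) (\<phi> (j - 2))" using 3 ij k by (intro embeds_edge[OF e]) auto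
        then show ?thesis using i j by (simp add: \<psi>_def)
      qed
    next
      case 4
      then have j: "\<psi> j = \<beta>" using k by (auto simp: \<psi>_def)
      have "?k \<le> i" "i \<le> 2 * ?k" using 4 ij by auto
      then show ?thesis using j \<gamma>(3) \<beta>(3)[of "i - 1"] sym by (auto simp: \<psi>_def)
    qed
  qed
  then show ?thesis by blast
qed

text \<open>In the rotated embedding the index 2k stands for the old index p+1, so the k-1 indices
  strictly between p and p+k become the last arc of \<open>extend_top\<close>.\<close>

lemma extend_arc:
  assumes e: "embeds E V k \<phi>" and k: "k \<ge> 1" and z: "z \<in> V" and p: "0 \<le> p" "p < int k"
    and arc: "\<And>j. 0 \<le> j \<Longrightarrow> j < circ k \<Longrightarrow> E z (\<phi> j) \<Longrightarrow> p < j \<and> j < p + int k"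
  shows "\<exists>\<psi>. embeds E V (Suc k) \<psi>"
proof (rule extend_top[OF embeds_rotate[OF e k, of "p + 1 - 2 * int k"] k z])
  fix j assume j: "0 \<le> j" "j < circ k" "E z (\<phi> ((j + (p + 1 - 2 * int k)) mod circ k))"
  let ?i = "(j + (p + 1 - 2 * int k)) mod circ k"
  have i: "p < ?i" "?i < p + int k" using arc[of ?i] j(3) k by auto
  show "2 * int k \<le> j"
  proof (rule ccontr)
    assume a: "\<not> ?thesis"
    show False
    proof (cases "0 \<le> j + (p + 1 - 2 * int k)")
      case True
      then have "?i = j + (p + 1 - 2 * int k)" using a p j by (intro mod_pos_pos_trivial) auto
      then show False using a i by linarith
    next
      case False
      have "?i = (j + (p + 1 - 2 * int k) + circ k) mod circ k" by (rule mod_add_self2[symmetric])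
      also have "\<dots> = j + (p + 1 - 2 * int k) + circ k"
        using False a p j by (intro mod_pos_pos_trivial) auto
      finally show False using i j by linarith
    qed
  qed
qed

text \<open>Replacing \<open>\<phi> m\<close> by a twin \<open>d\<close> adjacent to \<open>z\<close> turns a suitable common neighbour \<open>t\<close> of \<open>z\<close> and \<open>\<phi> m\<close>
  into a vertex whose neighbours lie on an arc of length \<open>k - 1\<close>.\<close>

lemma extend_gap:
  assumes e: "embeds E V k \<phi>" and k: "k \<ge> 1" and z: "z \<in> V" and m: "0 \<le> m" "m < int k" "\<not> E z (\<phi> m)"
    and arc: "\<And>j. 0 \<le> j \<Longrightarrow> j < circ k \<Longrightarrow> E z (\<phi> j) \<Longrightarrow> j < int k"
  shows "\<exists>\<psi>. embeds E V (Suc k) \<psi>"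
proof (cases "m = 0")
  case True
  have "0 < j \<and> j < 0 + int k" if "0 \<le> j" "j < circ k" "E z (\<phi> j)" for j
    using arc[OF that] that m(3) True by (cases "j = 0") auto
  then show ?thesis using extend_arc[OF e k z, of 0] k by auto
next
  case False
  let ?k = "int k"
  have \<phi>V: "\<phi> j \<in> V" if "0 \<le> j" "j < circ k" for j using e that unfolding embeds_def by auto
  have zz: "\<not> E z z" using triangle_free by blast
  have zj: "\<not> E z (\<phi> j)" "\<not> E (\<phi> j) z" if "?k \<le> j" "j < circ k" for j
    using arc[of j] that sym by auto
  have "\<exists>w\<in>V. \<forall>x\<in>insert z (\<phi> ` {m + ?k..<m + 2 * ?k}). E w x"
  proof (rule dominated)
    show "insert z (\<phi> ` {m + ?k..<m + 2 * ?k}) \<subseteq> V" using z m \<phi>V by auto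
    show "\<not> E x y" if "x \<in> insert z (\<phi> ` {m + ?k..<m + 2 * ?k})"
        "y \<in> insert z (\<phi> ` {m + ?k..<m + 2 * ?k})" for x y
      using that zz zj m embeds_arc_nonadj[OF e k] by auto
  qed simp
  then obtain d where d: "d \<in> V" "E d z" "\<And>j. m + ?k \<le> j \<Longrightarrow> j < m + 2 * ?k \<Longrightarrow> E d (\<phi> j)" by auto
  have "\<exists>w\<in>V. \<forall>x\<in>insert z (\<phi> ` insert m {?k..<m + ?k}). E w x"
  proof (rule dominated)
    show "insert z (\<phi> ` insert m {?k..<m + ?k}) \<subseteq> V" using z m \<phi>V by auto
    have zm: "\<not> E z (\<phi> m)" "\<not> E (\<phi> m) z" using m(3) sym by auto
    show "\<not> E x y" if "x \<in> insert z (\<phi> ` insert m {?k..<m + ?k})"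
        "y \<in> insert z (\<phi> ` insert m {?k..<m + ?k})" for x y
      using that zz zj zm m embeds_arc_nonadj[OF e k] by auto
  qed simp
  then obtain t where t: "t \<in> V" "E t z" "E t (\<phi> m)" "\<And>j. ?k \<le> j \<Longrightarrow> j < m + ?k \<Longrightarrow> E t (\<phi> j)" by auto
  let ?\<psi> = "\<phi>(m := d)"
  have "embeds E V k ?\<psi>"
  proof (rule embedsI)
    show "?\<psi> i \<in> V" if "0 \<le> i" "i < circ k" for i using that d(1) \<phi>V by auto
    fix i j assume ij: "0 \<le> i" "i < circ k" "0 \<le> j" "j < circ k" "?k \<le> j - i" "j - i \<le> 2 * ?k - 1"
    then have "j \<noteq> m" using m by auto
    then show "E (?\<psi> i) (?\<psi> j)" using ij d(3)[of j] embeds_edge[OF e ij] by auto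
  qed
  moreover have "m < j \<and> j < m + ?k" if j: "0 \<le> j" "j < circ k" "E t (?\<psi> j)" for j
  proof -
    have jm: "j \<noteq> m" using j(3) t(2) d(2) triangle_free by auto
    then have tj: "E t (\<phi> j)" using j(3) by simp
    have na: "\<not> (?k \<le> \<bar>j - i\<bar> \<and> \<bar>j - i\<bar> \<le> 2 * ?k - 1)" if "0 \<le> i" "i < circ k" "E t (\<phi> i)" for i
    proof
      assume a: "?k \<le> \<bar>j - i\<bar> \<and> \<bar>j - i\<bar> \<le> 2 * ?k - 1"
      then have "andrasfai_adj k j i" using that(1,2) j by (subst adj_abs) auto
      then have "E (\<phi> j) (\<phi> i)" using e that(1,2) j unfolding embeds_def by auto
      then show False using tj that(3) triangle_free by blast
    qed
    \<comment> \<open>Adjacency to \<open>\<phi> m\<close> and \<open>\<phi> (m + k - 1)\<close>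
      leaves only the indices from m to m+k-1 for \<open>t\<close>. Since m >= 1, the index m+k-1 is
      among those dominated by \<open>t\<close>; m itself is excluded by \<open>jm\<close>.\<close>
    have 1: "\<not> (?k \<le> \<bar>j - m\<bar> \<and> \<bar>j - m\<bar> \<le> 2 * ?k - 1)" using na[of m] m t(3) by auto
    have 2: "\<not> (?k \<le> \<bar>j - (m + ?k - 1)\<bar> \<and> \<bar>j - (m + ?k - 1)\<bar> \<le> 2 * ?k - 1)"
      using na[of "m + ?k - 1"] m False t(4)[of "m + ?k - 1"] by auto
    show ?thesis using 1 2 j(1,2) m jm by linarith
  qed
  ultimately show ?thesis using extend_arc[of k ?\<psi> t m] k t(1) m by blast
qed

theorem blow_up_andrasfai:
  assumes bound: "\<And>k \<phi>. k \<ge> 1 \<Longrightarrow> embeds E V k \<phi> \<Longrightarrow> k \<le> K"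
  shows "\<exists>k\<ge>1. blow_up E V (andrasfai_adj k) (andrasfai_verts k)"
proof -
  obtain v where v: "v \<in> V" using dominated[of "{}"] by auto
  obtain w where w: "w \<in> V" "E w v" using dominated[of "{v}"] v triangle_free by blast
  \<comment> \<open>\<open>circ 1 = 2\<close>: the smallest Andrasfai graph is a single
    edge.\<close>
  have "embeds E V 1 (\<lambda>i. if i = 0 then v else w)"
    using v w sym by (intro embedsI) auto
  then have ex: "\<exists>k. k \<ge> 1 \<and> (\<exists>\<phi>. embeds E V k \<phi>)" by fastforce
  define k where "k = (GREATEST k. k \<ge> 1 \<and> (\<exists>\<phi>. embeds E V k \<phi>))"
  have k': "k \<ge> 1 \<and> (\<exists>\<phi>. embeds E V k \<phi>)"
    unfolding k_def by (rule GreatestI_ex_nat[OF ex, of K]) (use bound in blast)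
  have max: "\<not> (\<exists>\<phi>. embeds E V (Suc k) \<phi>)"
  proof
    assume "\<exists>\<phi>. embeds E V (Suc k) \<phi>"
    then have "Suc k \<le> k"
      unfolding k_def using bound by (intro Greatest_le_nat[where b = K]) auto
    then show False by simp
  qed
  from k' obtain \<phi> where k: "k \<ge> 1" and e: "embeds E V k \<phi>" by blast
  have "\<exists>i\<in>{0..<circ k}. \<forall>j\<in>{0..<circ k}. E z (\<phi> j) \<longleftrightarrow> andrasfai_adj k i j" if z: "z \<in> V" for z
  proof -
    define T where "T = {j\<in>{0..<circ k}. E z (\<phi> j)}"
    have "\<forall>i\<in>T. \<forall>j\<in>T. \<not> andrasfai_adj k i j"
      using e triangle_free unfolding T_def embeds_def by blast
    moreover have "T \<subseteq> {0..<circ k}" by (auto simp: T_def)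
    ultimately obtain r where r: "\<forall>j\<in>T. in_arc k r j"
      using independent_in_arc[OF k] by blast
    define \<psi> where "\<psi> = (\<lambda>j. \<phi> ((j + r) mod circ k))"
    have \<psi>: "embeds E V k \<psi>" unfolding \<psi>_def by (rule embeds_rotate[OF e k])
    have low: "j < int k" if "0 \<le> j" "j < circ k" "E z (\<psi> j)" for j
    proof -
      have "(j + r) mod circ k \<in> T" using that k by (simp add: T_def \<psi>_def)
      then have "((j + r) mod circ k - r) mod circ k < int k" using r by (simp add: in_arc_def)
      moreover have "((j + r) mod circ k - r) mod circ k = j" using that(1,2) by (simp add: mod_simps)
      ultimately show ?thesis by simp
    qed
    \<comment> \<open>A gap in the trace of \<open>z\<close> on its arc would allow an embedding
      with parameter k+1.\<close>
    have full: "E z (\<psi> m)" if "0 \<le> m" "m < int k" for m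
      using extend_gap[OF \<psi> k z that] low max by blast
    have iff: "E z (\<phi> j) \<longleftrightarrow> in_arc k r j" if "j \<in> {0..<circ k}" for j
    proof
      assume "in_arc k r j"
      then have "E z (\<psi> ((j - r) mod circ k))" using full k by (simp add: in_arc_def)
      then show "E z (\<phi> j)" using that by (simp add: \<psi>_def mod_simps)
    qed (use r that in \<open>auto simp: T_def\<close>)
    have "andrasfai_adj k ((r + 2 * int k - 1) mod circ k) j \<longleftrightarrow> in_arc k r j" for j
      unfolding adj_iff_in_arc[OF k, symmetric] by (simp add: andrasfai_adj_def mod_simps)
    then show ?thesis using iff k by (intro bexI[of _ "(r + 2 * int k - 1) mod circ k"]) auto
  qed
  then obtain f where f: "\<And>z. z \<in> V \<Longrightarrow> f z \<in> {0..<circ k}"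
    "\<And>z j. z \<in> V \<Longrightarrow> j \<in> {0..<circ k} \<Longrightarrow> E z (\<phi> j) \<longleftrightarrow> andrasfai_adj k (f z) j"
    by metis
  have \<phi>V: "\<phi> j \<in> V" if "j \<in> {0..<circ k}" for j using e that unfolding embeds_def by auto
  have nonadj: "\<not> E u v" if uv: "u \<in> V" "v \<in> V" "\<not> andrasfai_adj k (f u) (f v)" for u v
  proof -
    obtain l where l: "l \<in> {0..<circ k}" "andrasfai_adj k l (f u)" "andrasfai_adj k l (f v)"
      using nonadj_common[OF k uv(3)] by blast
    then have "E u (\<phi> l)" "E v (\<phi> l)" using f uv adj_sym k by blast+
    then show ?thesis using common_nonadj sym by blast
  qed
  have adj: "E u v" if uv: "u \<in> V" "v \<in> V" "andrasfai_adj k (f u) (f v)" for u v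
  proof (rule ccontr)
    assume n: "\<not> E u v"
    have "\<not> E x y" if "x \<in> {u, v}" "y \<in> {u, v}" for x y
      using that n sym triangle_free by blast
    then obtain t where t: "t \<in> V" "E t u" "E t v" using dominated[of "{u, v}"] uv by auto
    \<comment> \<open>By contraposition of \<open>nonadj\<close>, the common neighbour completes a
      triangle in the Andrasfai graph, whose image is a triangle of \<open>E\<close>.\<close>
    have "andrasfai_adj k (f t) (f u)" "andrasfai_adj k (f t) (f v)" using nonadj t uv by blast+
    then have "E (\<phi> (f t)) (\<phi> (f u))" "E (\<phi> (f t)) (\<phi> (f v))" "E (\<phi> (f u)) (\<phi> (f v))"
      using e f(1) t(1) uv unfolding embeds_def by blast+
    then show False using triangle_free by blast
  qed
  have surj: "f (\<phi> j) = j" if j: "j \<in> {0..<circ k}" for j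
  proof (rule adj_inj[OF k f(1)[OF \<phi>V[OF j]] j])
    fix l assume l: "l \<in> {0..<circ k}"
    show "andrasfai_adj k (f (\<phi> j)) l \<longleftrightarrow> andrasfai_adj k j l"
      using f(2)[OF \<phi>V[OF j] l] e l j embeds_nonadj[OF e k j l] unfolding embeds_def by blast
  qed
  have "\<forall>v\<in>V. f v \<in> andrasfai_verts k" using f(1) by (simp add: andrasfai_verts_def)
  moreover have "\<forall>x\<in>andrasfai_verts k. \<exists>v\<in>V. f v = x"
    using surj \<phi>V unfolding andrasfai_verts_def by blast
  moreover have "\<forall>u\<in>V. \<forall>v\<in>V. E u v \<longleftrightarrow> andrasfai_adj k (f u) (f v)" using adj nonadj by blast
  ultimately have "blow_up E V (andrasfai_adj k) (andrasfai_verts k)" unfolding blow_up_def by blast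
  then show ?thesis using k by blast
qed

end

section \<open>Hexagons and the kinds of vertices\<close>

definition place :: "'a list \<Rightarrow> idx \<Rightarrow> 'a" where
  "place vs i = vs ! (case i of I0 \<Rightarrow> 0 | I1 \<Rightarrow> 1 | I2 \<Rightarrow> 2 | I3 \<Rightarrow> 3 | I4 \<Rightarrow> 4 | I5 \<Rightarrow> 5 | I6 \<Rightarrow> 6 | I7 \<Rightarrow> 7 | _ \<Rightarrow> 8)"

lemma place_simps [simp]:
  "place vs I0 = vs ! 0" "place vs I1 = vs ! 1" "place vs I2 = vs ! 2" "place vs I3 = vs ! 3"
  "place vs I4 = vs ! 4" "place vs I5 = vs ! 5" "place vs I6 = vs ! 6" "place vs I7 = vs ! 7"
  by (simp_all add: place_def)

lemma occurs_with_vertex: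
  "occurs E f (with_vertex z N M P) \<longleftrightarrow>
     occurs E f P \<and> (\<forall>i\<in>set N. E (f z) (f i)) \<and> (\<forall>i\<in>set M. \<not> E (f z) (f i))"
  by (auto simp: occurs_def with_vertex_def)

lemma occurs_grotzsch_upd:
  "occurs E (f(I11 := z)) grotzsch = occurs E f grotzsch"
  "occurs E (f(I12 := z)) grotzsch = occurs E f grotzsch"
  "occurs E (f(I13 := z)) grotzsch = occurs E f grotzsch"
  "occurs E (f(I14 := z)) grotzsch = occurs E f grotzsch"
  by (simp_all add: occurs_def grotzsch_def)

text \<open>A hexagon \<open>a v c u b w\<close> on which every vertex has at least two neighbours (the one neighbour left out
  in the six assumptions varies), such that the vertices attached like \<open>a\<close> and like \<open>u\<close> are
  non-adjacent, and likewise for \<open>b\<close>, \<open>v\<close> and \<open>c\<close>, \<open>w\<close>.\<close>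

locale hexframe = dense_maximal_graph E for E :: "'a \<Rightarrow> 'a \<Rightarrow> bool" +
  fixes a b c u v w :: 'a
  assumes av: "E a v" and vc: "E v c" and cu: "E c u" and ub: "E u b" and bw: "E b w" and wa: "E w a"
    and two_a: "E z b \<or> E z c \<or> E z u \<or> E z v \<or> E z w"
    and two_b: "E z a \<or> E z c \<or> E z u \<or> E z v \<or> E z w"
    and two_c: "E z a \<or> E z b \<or> E z u \<or> E z v \<or> E z w"
    and two_u: "E z a \<or> E z b \<or> E z c \<or> E z v \<or> E z w"
    and two_v: "E z a \<or> E z b \<or> E z c \<or> E z u \<or> E z w"
    and two_w: "E z a \<or> E z b \<or> E z c \<or> E z u \<or> E z v"
    and cross_a: "E s v \<Longrightarrow> E s w \<Longrightarrow> \<not> E s u \<Longrightarrow> E t b \<Longrightarrow> E t c \<Longrightarrow> \<not> E t a \<Longrightarrow> \<not> E s t"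
    and cross_b: "E s u \<Longrightarrow> E s w \<Longrightarrow> \<not> E s v \<Longrightarrow> E t a \<Longrightarrow> E t c \<Longrightarrow> \<not> E t b \<Longrightarrow> \<not> E s t"
    and cross_c: "E s u \<Longrightarrow> E s v \<Longrightarrow> \<not> E s w \<Longrightarrow> E t a \<Longrightarrow> E t b \<Longrightarrow> \<not> E t c \<Longrightarrow> \<not> E s t"
    and au: "\<not> E a u" and bv: "\<not> E b v" and cw: "\<not> E c w"

text \<open>Together with \<open>swapped\<close> this generates all permutations of the three
  opposite pairs, used to renumber the ranges in \<open>centred_exists\<close>. Both keep the colour
  class of \<open>a\<close>, \<open>b\<close>, \<open>c\<close>.\<close>

lemma (in hexframe) rotated: "hexframe E b c a v w u"
proof (unfold_locales, goal_cases)
  case 1 show ?case by (rule bw)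
next
  case 2 show ?case by (rule wa)
next
  case 3 show ?case by (rule av)
next
  case 4 show ?case by (rule vc)
next
  case 5 show ?case by (rule cu)
next
  case 6 show ?case by (rule ub)
next
  case (7 z) show ?case using two_b[of z] by blast
next
  case (8 z) show ?case using two_c[of z] by blast
next
  case (9 z) show ?case using two_a[of z] by blast
next
  case (10 z) show ?case using two_v[of z] by blast
next
  case (11 z) show ?case using two_w[of z] by blast
next
  case (12 z) show ?case using two_u[of z] by blast
next
  case (13 s t) then show ?case using cross_b[of s t] by blast
next
  case (14 s t) then show ?case using cross_c[of s t] by blast
next
  case (15 s t) then show ?case using cross_a[of s t] by blast
qed (rule bv cw au)+

lemma (in hexframe) swapped: "hexframe E b a c v u w"
proof (unfold_locales, goal_cases)
  case 1 show ?case by (rule sym[OF ub])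
next
  case 2 show ?case by (rule sym[OF cu])
next
  case 3 show ?case by (rule sym[OF vc])
next
  case 4 show ?case by (rule sym[OF av])
next
  case 5 show ?case by (rule sym[OF wa])
next
  case 6 show ?case by (rule sym[OF bw])
next
  case (7 z) show ?case using two_b[of z] by blast
next
  case (8 z) show ?case using two_a[of z] by blast
next
  case (9 z) show ?case using two_c[of z] by blast
next
  case (10 z) show ?case using two_v[of z] by blast
next
  case (11 z) show ?case using two_u[of z] by blast
next
  case (12 z) show ?case using two_w[of z] by blast
next
  case (13 s t) then show ?case using cross_b[of s t] by blast
next
  case (14 s t) then show ?case using cross_a[of s t] by blast
next
  case (15 s t) then show ?case using cross_c[of s t] by blast
qed (rule bv au cw)+

section \<open>Finding a suitable hexagon\<close>

context dense_maximal_graph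
begin

lemma no_cube:
  assumes "E v1 u2" "E v1 u3" "E v1 u4" "E v2 u1" "E v2 u3" "E v2 u4"
    "E v3 u1" "E v3 u2" "E v3 u4" "E v4 u1" "E v4 u2" "E v4 u3"
    "\<not> E v1 u1" "\<not> E v2 u2" "\<not> E v3 u3" "\<not> E v4 u4"
  shows False
proof -
  have "occurs E (place [v1, v2, v3, v4, u1, u2, u3, u4]) cube"
    using assms by (simp add: occurs_def cube_def)
  then show False using avoids_cube by (simp add: avoids_def)
qed

text \<open>For each element of a larger independent set, induction supplies a vertex adjacent to
  all the others. If nothing dominates the whole set, four elements and the four vertices so
  obtained form a cube.\<close>

lemma finite_dominated:
  assumes trip: "\<And>x y z. \<not> E x y \<Longrightarrow> \<not> E x z \<Longrightarrow> \<not> E y z \<Longrightarrow> \<exists>t. E t x \<and> E t y \<and> E t z"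
  shows "finite I \<Longrightarrow> (\<And>x y. x \<in> I \<Longrightarrow> y \<in> I \<Longrightarrow> \<not> E x y) \<Longrightarrow> \<exists>t. \<forall>x\<in>I. E t x"
proof (induction "card I" arbitrary: I rule: less_induct)
  case less
  show ?case
  proof (cases "card I \<le> 3")
    case True
    have "\<exists>xs. set xs = I \<and> length xs = card I" using less.prems(1) by (metis distinct_card finite_distinct_list)
    then obtain xs where xs: "set xs = I" "length xs \<le> 3" using True by auto
    show ?thesis
    proof (cases "xs = []")
      case True then show ?thesis using xs by auto
    next
      case False
      then obtain x y z where "set xs = {x, y, z}"
        using xs(2) by (cases xs; cases "tl xs"; cases "tl (tl xs)") (auto simp: insert_commute)
      then have I: "I = {x, y, z}" using xs by simp
      then show ?thesis using trip[of x y z] less.prems(2) by auto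
    qed
  next
    case False
    then obtain T where T: "T \<subseteq> I" "card T = 4" using obtain_subset_with_card_n[of 4 I] by auto
    then obtain v1 v2 v3 v4 where vs: "T = {v1, v2, v3, v4}" and d: "v1 \<noteq> v2" "v1 \<noteq> v3" "v1 \<noteq> v4" "v2 \<noteq> v3" "v2 \<noteq> v4" "v3 \<noteq> v4"
      by (auto simp: card_Suc_eq numeral_eq_Suc)
    have "\<exists>t. \<forall>x\<in>I - {y}. E t x" if "y \<in> I" for y
      using less.hyps[of "I - {y}"] less.prems that by (metis Diff_iff card_Diff1_less finite_Diff)
    then obtain r where r: "\<And>y x. y \<in> I \<Longrightarrow> x \<in> I \<Longrightarrow> x \<noteq> y \<Longrightarrow> E (r y) x"
      by (metis Diff_iff singletonD)
    show ?thesis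
    proof (rule ccontr)
      assume no: "\<not> ?thesis"
      have n: "\<not> E (r y) y" if "y \<in> I" for y using no r that by metis
      have vI: "v1 \<in> I" "v2 \<in> I" "v3 \<in> I" "v4 \<in> I" using T vs by auto
      show False
        by (rule no_cube[of v1 "r v2" "r v3" "r v4" v2 "r v1" v3 v4])
          (use r n vI d sym in blast)+
    qed
  qed
qed

text \<open>Pairwise common neighbours complete the triple to a hexagon. Its opposite vertices are
  non-adjacent, since otherwise one of the new vertices would dominate the triple.\<close>

lemma undominated_triple_grotzsch:
  assumes "\<not> E x y" "\<not> E x z" "\<not> E y z" "\<not> (\<exists>t. E t x \<and> E t y \<and> E t z)"
  shows "\<not> avoids E grotzsch"
proof
  assume g: "avoids E grotzsch"
  obtain p where p: "E p y" "E p z" using common[OF assms(3)] by blast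
  obtain q where q: "E q x" "E q z" using common[OF assms(2)] by blast
  obtain r where r: "E r x" "E r y" using common[OF assms(1)] by blast
  have n: "\<not> E x p" "\<not> E y q" "\<not> E z r" using assms(4) p q r sym by blast+
  have "occurs E (place [x, y, z, p, q, r]) hexagon"
    using p q r n sym by (simp add: occurs_def hexagon_def)
  moreover have "undominated (place [x, y, z, p, q, r] ` set [I0, I1, I2])"
    using assms(4) by (simp add: undominated_def)
  ultimately show False
    using refutes_sound[OF refutes_hexagon, of "place [x, y, z, p, q, r]"]
      avoids_petersen_minus_vertex avoids_cube g by (simp add: hexagon_def)
qed

lemma hexframe_grotzsch_plus_two:
  assumes g: "occurs E g grotzsch_plus_two"
  shows "hexframe E (g I0) (g I1) (g I3) (g I2) (g I9) (g I10)"
proof -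
  have gg: "occurs E g grotzsch" using g by (simp add: grotzsch_plus_two_def occurs_with_vertex)
  have K: "occurs E (g(I13 := z)) grotzsch_plus_two" "occurs E (g(I13 := z, I14 := t)) grotzsch_plus_two" for z t
    using g by (auto simp: grotzsch_plus_two_def occurs_with_vertex occurs_grotzsch_upd)
  note few = avoids_few_A_a avoids_few_A_b avoids_few_A_c avoids_few_A_u avoids_few_A_v avoids_few_A_w
  note few' = few[unfolded avoids_def few_A_a_def few_A_b_def few_A_c_def few_A_u_def few_A_v_def few_A_w_def occurs_with_vertex]
  note cr = avoids_cross_A_a avoids_cross_A_b avoids_cross_A_c
  note cr' = cr[unfolded avoids_def cross_A_a_def cross_A_b_def cross_A_c_def occurs_with_vertex]
  have edges: "E (g I0) (g I9)" "E (g I9) (g I3)" "E (g I3) (g I2)" "E (g I2) (g I1)" "E (g I1) (g I10)" "E (g I10) (g I0)"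
    using gg sym by (auto simp: occurs_def grotzsch_def)
  have non: "\<not> E (g I0) (g I2)" "\<not> E (g I1) (g I9)" "\<not> E (g I3) (g I10)"
    using gg triangle_free sym unfolding occurs_def grotzsch_def by simp_all blast+
  show ?thesis
  proof (unfold_locales, goal_cases)
    case (7 z) show ?case using few'(1)[rule_format, of "g(I13 := z)"] K(1)[of z] by auto
  next
    case (8 z) show ?case using few'(2)[rule_format, of "g(I13 := z)"] K(1)[of z] by auto
  next
    case (9 z) show ?case using few'(3)[rule_format, of "g(I13 := z)"] K(1)[of z] by auto
  next
    case (10 z) show ?case using few'(4)[rule_format, of "g(I13 := z)"] K(1)[of z] by auto
  next
    case (11 z) show ?case using few'(5)[rule_format, of "g(I13 := z)"] K(1)[of z] by auto
  next
    case (12 z) show ?case using few'(6)[rule_format, of "g(I13 := z)"] K(1)[of z] by auto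
  next
    case (13 s t)
    then show ?case using cr'(1)[rule_format, of "g(I13 := s, I14 := t)"] K(2)[of s t] sym[of s t] by auto
  next
    case (14 s t)
    then show ?case using cr'(2)[rule_format, of "g(I13 := s, I14 := t)"] K(2)[of s t] sym[of s t] by auto
  next
    case (15 s t)
    then show ?case using cr'(3)[rule_format, of "g(I13 := s, I14 := t)"] K(2)[of s t] sym[of s t] by auto
  qed (use edges non in blast)+
qed

text \<open>Two of the five rotated copies of this set at distance two on the pentagon are dominated simultaneously
  only if \<^const>\<open>grotzsch_plus_two\<close> occurs.\<close>

definition corner :: "(idx \<Rightarrow> 'a) \<Rightarrow> 'a set" where
  "corner g = {g I1, g I6, g I8, g I9}"

definition spin :: "idx \<Rightarrow> idx" where
  "spin i = (case i of I1 \<Rightarrow> I2 | I2 \<Rightarrow> I3 | I3 \<Rightarrow> I4 | I4 \<Rightarrow> I5 | I5 \<Rightarrow> I1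
     | I6 \<Rightarrow> I7 | I7 \<Rightarrow> I8 | I8 \<Rightarrow> I9 | I9 \<Rightarrow> I10 | I10 \<Rightarrow> I6 | _ \<Rightarrow> i)"

lemma spin_simps [simp]:
  "spin I0 = I0" "spin I1 = I2" "spin I2 = I3" "spin I3 = I4" "spin I4 = I5" "spin I5 = I1"
  "spin I6 = I7" "spin I7 = I8" "spin I8 = I9" "spin I9 = I10" "spin I10 = I6"
  by (simp_all add: spin_def)

lemma occurs_grotzsch_spin: "occurs E g grotzsch \<Longrightarrow> occurs E (g \<circ> spin) grotzsch"
  using sym by (auto simp: occurs_def grotzsch_def)

lemma opposite_corners:
  assumes K: "avoids E grotzsch_plus_two" and g: "occurs E g grotzsch"
  shows "undominated (corner g) \<or> undominated (corner (g \<circ> spin \<circ> spin))"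
proof (rule ccontr)
  assume "\<not> ?thesis"
  then obtain p q where p: "\<forall>x\<in>corner g. E p x" and q: "\<forall>x\<in>corner (g \<circ> spin \<circ> spin). E q x"
    by (auto simp: undominated_def)
  have "occurs E (g(I11 := p, I12 := q)) grotzsch_plus_two"
    using p q g by (auto simp: grotzsch_plus_two_def occurs_with_vertex occurs_grotzsch_upd corner_def)
  then show False using K by (auto simp: avoids_def)
qed

text \<open>Number the rotations modulo five. Dominated corners never differ by two, so there are at
  most two of them, consecutive if there are two; three consecutive rotations remain
  undominated.\<close>

lemma exists_good_spin:
  assumes K: "avoids E grotzsch_plus_two" and g: "occurs E g grotzsch"
  shows "\<exists>h. occurs E h grotzsch \<and> undominated (corner (h \<circ> spin)) \<and>
    undominated (corner (h \<circ> spin \<circ> spin)) \<and> undominated (corner (h \<circ> spin \<circ> spin \<circ> spin))"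
proof -
  let ?g1 = "g \<circ> spin" let ?g2 = "?g1 \<circ> spin" let ?g3 = "?g2 \<circ> spin" let ?g4 = "?g3 \<circ> spin"
  have o: "occurs E ?g1 grotzsch" "occurs E ?g2 grotzsch" "occurs E ?g3 grotzsch" "occurs E ?g4 grotzsch"
    using g occurs_grotzsch_spin by blast+
  have c: "corner (?g4 \<circ> spin) = corner g" "corner (?g4 \<circ> spin \<circ> spin) = corner ?g1"
      "corner (?g4 \<circ> spin \<circ> spin \<circ> spin) = corner ?g2" by (auto simp: corner_def)
  note n = opposite_corners[OF K g] opposite_corners[OF K o(1)] opposite_corners[OF K o(2)]
    opposite_corners[OF K o(3)] opposite_corners[OF K o(4)]
  have c': "corner (?g3 \<circ> spin \<circ> spin) = corner g" "corner (?g3 \<circ> spin \<circ> spin \<circ> spin) = corner ?g1"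
      "corner (?g2 \<circ> spin \<circ> spin \<circ> spin) = corner g"  by (auto simp: corner_def)
  define P where "P h \<longleftrightarrow> undominated (corner (h \<circ> spin)) \<and> undominated (corner (h \<circ> spin \<circ> spin)) \<and>
    undominated (corner (h \<circ> spin \<circ> spin \<circ> spin))" for h
  have "P g \<or> P ?g1 \<or> P ?g2 \<or> P ?g3 \<or> P ?g4"
    using n unfolding P_def c c' by blast
  then have "\<exists>h. occurs E h grotzsch \<and> P h" using g o by blast
  then show ?thesis by (simp only: P_def)
qed

lemma hexframe_no_plus_two:
  assumes K: "avoids E grotzsch_plus_two" and g: "occurs E g grotzsch"
    and u: "undominated (corner (g \<circ> spin))" "undominated (corner (g \<circ> spin \<circ> spin))"
      "undominated (corner (g \<circ> spin \<circ> spin \<circ> spin))"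
  shows "hexframe E (g I0) (g I1) (g I4) (g I5) (g I8) (g I7)"
proof -
  have G: "occurs E (g(I11 := z)) grotzsch" "occurs E (g(I11 := z, I12 := t)) grotzsch" for z t
    using g by (auto simp: occurs_grotzsch_upd)
  \<comment> \<open>The lists are the corners after one, two and three rotations; \<open>I11\<close>
    and \<open>I12\<close> are reserved for the added vertices.\<close>
  have us: "\<forall>U\<in>set [[I2, I7, I9, I10], [I3, I8, I10, I6], [I4, I9, I6, I7]]. undominated (f ` set U)"
    if "\<And>i. i \<noteq> I11 \<Longrightarrow> i \<noteq> I12 \<Longrightarrow> f i = g i" for f
    using u that by (simp add: corner_def insert_commute)
  note av = avoids_cube avoids_petersen_minus_vertex avoids_type_s0_s1 avoids_type_s0_s1_s2 avoids_type_s0_s1_s2_s3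
    avoids_type_s0_s1_s3 avoids_type_s0_s2 avoids_type_c0_s0 avoids_type_c0_c2 avoids_type_s0 avoids_type_c0
    avoids_type_empty avoids_type_o avoids_type_c0_s0_s2[OF K] avoids_type_c0_c2_s0[OF K] avoids_type_o_c0[OF K] K
  note defs = few_B_a_def few_B_b_def few_B_c_def few_B_u_def few_B_v_def few_B_w_def
    cross_B_a_def cross_B_b_def cross_B_c_def
  have us1: "\<forall>U\<in>set [[I2, I7, I9, I10], [I3, I8, I10, I6], [I4, I9, I6, I7]]. undominated ((g(I11 := z)) ` set U)"
    for z by (rule us) simp_all
  have us2: "\<forall>U\<in>set [[I2, I7, I9, I10], [I3, I8, I10, I6], [I4, I9, I6, I7]].
      undominated ((g(I11 := z, I12 := t)) ` set U)" for z t by (rule us) simp_all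
  have few_a: "\<not> occurs E (g(I11 := z)) few_B_a" for z
    by (rule refutes_sound[OF refutes_few_B_a _ _ _ us1]) (simp_all add: av defs with_vertex_def grotzsch_def)
  have few_b: "\<not> occurs E (g(I11 := z)) few_B_b" for z
    by (rule refutes_sound[OF refutes_few_B_b _ _ _ us1]) (simp_all add: av defs with_vertex_def grotzsch_def)
  have few_c: "\<not> occurs E (g(I11 := z)) few_B_c" for z
    by (rule refutes_sound[OF refutes_few_B_c _ _ _ us1]) (simp_all add: av defs with_vertex_def grotzsch_def)
  have few_u: "\<not> occurs E (g(I11 := z)) few_B_u" for z
    by (rule refutes_sound[OF refutes_few_B_u _ _ _ us1]) (simp_all add: av defs with_vertex_def grotzsch_def)
  have few_v: "\<not> occurs E (g(I11 := z)) few_B_v" for z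
    by (rule refutes_sound[OF refutes_few_B_v _ _ _ us1]) (simp_all add: av defs with_vertex_def grotzsch_def)
  have few_w: "\<not> occurs E (g(I11 := z)) few_B_w" for z
    by (rule refutes_sound[OF refutes_few_B_w _ _ _ us1]) (simp_all add: av defs with_vertex_def grotzsch_def)
  have cross_a: "\<not> occurs E (g(I11 := s, I12 := t)) cross_B_a" for s t
    by (rule refutes_sound[OF refutes_cross_B_a _ _ _ us2]) (simp_all add: av defs with_vertex_def grotzsch_def)
  have cross_b: "\<not> occurs E (g(I11 := s, I12 := t)) cross_B_b" for s t
    by (rule refutes_sound[OF refutes_cross_B_b _ _ _ us2]) (simp_all add: av defs with_vertex_def grotzsch_def)
  have cross_c: "\<not> occurs E (g(I11 := s, I12 := t)) cross_B_c" for s t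
    by (rule refutes_sound[OF refutes_cross_B_c _ _ _ us2]) (simp_all add: av defs with_vertex_def grotzsch_def)
  note few = few_a few_b few_c few_u few_v few_w
  note cr = cross_a cross_b cross_c
  note few' = few[unfolded defs occurs_with_vertex]
  note cr' = cr[unfolded defs occurs_with_vertex]
  have edges: "E (g I0) (g I8)" "E (g I8) (g I4)" "E (g I4) (g I5)" "E (g I5) (g I1)" "E (g I1) (g I7)" "E (g I7) (g I0)"
    using g sym by (auto simp: occurs_def grotzsch_def)
  have non: "\<not> E (g I0) (g I5)" "\<not> E (g I1) (g I8)" "\<not> E (g I4) (g I7)"
    using g triangle_free sym unfolding occurs_def grotzsch_def by simp_all blast+
  show ?thesis
  proof (unfold_locales, goal_cases)
    case (7 z) show ?case using few'(1)[of z] G(1)[of z] by auto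
  next
    case (8 z) show ?case using few'(2)[of z] G(1)[of z] by auto
  next
    case (9 z) show ?case using few'(3)[of z] G(1)[of z] by auto
  next
    case (10 z) show ?case using few'(4)[of z] G(1)[of z] by auto
  next
    case (11 z) show ?case using few'(5)[of z] G(1)[of z] by auto
  next
    case (12 z) show ?case using few'(6)[of z] G(1)[of z] by auto
  next
    case (13 s t) then show ?case using cr'(1)[of s t] G(2)[of s t] sym[of s t] by auto
  next
    case (14 s t) then show ?case using cr'(2)[of s t] G(2)[of s t] sym[of s t] by auto
  next
    case (15 s t) then show ?case using cr'(3)[of s t] G(2)[of s t] sym[of s t] by auto
  qed (use edges non in blast)+
qed

text \<open>The additional vertex \<open>t\<close> will become \<open>Vx\<close>, which every Vega
  graph contains, in contrast to \<open>Vy\<close>.\<close>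

theorem hexframe_exists:
  assumes "\<not> E x y" "\<not> E x z" "\<not> E y z" "\<not> (\<exists>t. E t x \<and> E t y \<and> E t z)"
  shows "\<exists>a b c u v w t. hexframe E a b c u v w \<and> E t a \<and> E t b \<and> E t c"
proof -
  obtain g where g: "occurs E g grotzsch"
    using undominated_triple_grotzsch[OF assms] by (auto simp: avoids_def)
  show ?thesis
  proof (cases "avoids E grotzsch_plus_two")
    case True
    obtain h where h: "occurs E h grotzsch" "hexframe E (h I0) (h I1) (h I4) (h I5) (h I8) (h I7)"
      using exists_good_spin[OF True g] hexframe_no_plus_two[OF True] by blast
    have "E (h I10) (h I0)" "E (h I10) (h I1)" "E (h I10) (h I4)"
      using h(1) sym by (auto simp: occurs_def grotzsch_def)
    then show ?thesis using h(2) by blast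
  next
    case False
    then obtain h where h: "occurs E h grotzsch_plus_two" by (auto simp: avoids_def)
    have "E (h I7) (h I0)" "E (h I7) (h I1)" "E (h I7) (h I3)"
      using h sym by (auto simp: occurs_def grotzsch_def grotzsch_plus_two_def with_vertex_def)
    then show ?thesis using hexframe_grotzsch_plus_two[OF h] by blast
  qed
qed

end

section \<open>Kinds of vertices and adjacencies between them\<close>

datatype spot = Ha | Hb | Hc | Hu | Hv | Hw

datatype kind = K1 | K2 | K3 | KA | KB | KC | KU | KV | KW | KX | KY

text \<open>The neighbours on the hexagon of a vertex of each kind: \<open>K1\<close>, \<open>K2\<close>, \<open>K3\<close> are the three ranges of the
  circular part of a Vega graph, \<open>KA\<close> to \<open>KY\<close> the twins of its vertices \<open>Va\<close> to \<open>Vy\<close>.\<close>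

fun spots :: "kind \<Rightarrow> spot set" where
  "spots K1 = {Ha, Hu}" | "spots K2 = {Hb, Hv}" | "spots K3 = {Hc, Hw}"
| "spots KA = {Hv, Hw}" | "spots KB = {Hu, Hw}" | "spots KC = {Hu, Hv}"
| "spots KU = {Hb, Hc}" | "spots KV = {Ha, Hc}" | "spots KW = {Ha, Hb}"
| "spots KX = {Ha, Hb, Hc}" | "spots KY = {Hu, Hv, Hw}"

text \<open>Adjacent vertices share no neighbour on the hexagon. The six pairs taken out share none
  either, but are ruled out by \<open>cross_a\<close>, \<open>cross_b\<close> and
  \<open>cross_c\<close>.\<close>

definition compat :: "kind \<Rightarrow> kind \<Rightarrow> bool" where
  "compat k l \<longleftrightarrow> spots k \<inter> spots l = {} \<and>
     (k, l) \<notin> {(KA, KU), (KU, KA), (KB, KV), (KV, KB), (KC, KW), (KW, KC)}"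

definition cyclic :: "kind \<Rightarrow> bool" where
  "cyclic k \<longleftrightarrow> k = K1 \<or> k = K2 \<or> k = K3"

lemma cyclic_simps [simp]:
  "cyclic K1" "cyclic K2" "cyclic K3" "\<not> cyclic KA" "\<not> cyclic KB" "\<not> cyclic KC" "\<not> cyclic KU"
  "\<not> cyclic KV" "\<not> cyclic KW" "\<not> cyclic KX" "\<not> cyclic KY"
  by (simp_all add: cyclic_def)

lemma compat_simps [simp]:
  "compat K1 l \<longleftrightarrow> l \<in> {K2, K3, KA, KU}" "compat K2 l \<longleftrightarrow> l \<in> {K1, K3, KB, KV}"
  "compat K3 l \<longleftrightarrow> l \<in> {K1, K2, KC, KW}" "compat KA l \<longleftrightarrow> l \<in> {K1, KV, KW, KX}"
  "compat KU l \<longleftrightarrow> l \<in> {K1, KB, KC, KY}" "compat KB l \<longleftrightarrow> l \<in> {K2, KU, KW, KX}"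
  "compat KV l \<longleftrightarrow> l \<in> {K2, KA, KC, KY}" "compat KC l \<longleftrightarrow> l \<in> {K3, KU, KV, KX}"
  "compat KW l \<longleftrightarrow> l \<in> {K3, KA, KB, KY}" "compat KX l \<longleftrightarrow> l \<in> {KA, KB, KC, KY}"
  "compat KY l \<longleftrightarrow> l \<in> {KU, KV, KW, KX}"
  by (cases l; simp add: compat_def)+

lemma compat_triangle:
  "compat k l \<Longrightarrow> compat t k \<Longrightarrow> compat t l \<Longrightarrow> cyclic k \<and> cyclic l"
  by (cases t) auto

definition third :: "kind \<Rightarrow> kind \<Rightarrow> kind \<Rightarrow> bool" where
  "third i j k \<longleftrightarrow> (i, j, k) \<in> {(K1, K2, K3), (K1, K3, K2), (K2, K1, K3), (K2, K3, K1), (K3, K1, K2), (K3, K2, K1)}"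

lemma third_simps [simp]:
  "third K1 K2 K3" "third K1 K3 K2" "third K2 K1 K3" "third K2 K3 K1" "third K3 K1 K2" "third K3 K2 K1"
  by (simp_all add: third_def)

context hexframe
begin

definition kind :: "'a \<Rightarrow> kind" where
  "kind z = (if E z a \<and> E z u then K1 else if E z b \<and> E z v then K2 else if E z c \<and> E z w then K3
     else if E z a \<and> E z b \<and> E z c then KX else if E z u \<and> E z v \<and> E z w then KY
     else if E z v \<and> E z w then KA else if E z b \<and> E z c then KU
     else if E z u \<and> E z w then KB else if E z a \<and> E z c then KV
     else if E z u \<and> E z v then KC else KW)"

lemma spots_kind:
  "E z a \<longleftrightarrow> Ha \<in> spots (kind z)" "E z b \<longleftrightarrow> Hb \<in> spots (kind z)" "E z c \<longleftrightarrow> Hc \<in> spots (kind z)"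
  "E z u \<longleftrightarrow> Hu \<in> spots (kind z)" "E z v \<longleftrightarrow> Hv \<in> spots (kind z)" "E z w \<longleftrightarrow> Hw \<in> spots (kind z)"
proof -
  have t: "\<not> (E z a \<and> E z v)" "\<not> (E z v \<and> E z c)" "\<not> (E z c \<and> E z u)"
    "\<not> (E z u \<and> E z b)" "\<not> (E z b \<and> E z w)" "\<not> (E z w \<and> E z a)"
    using triangle_free av vc cu ub bw wa by blast+
  have "(E z a \<longleftrightarrow> Ha \<in> spots (kind z)) \<and> (E z b \<longleftrightarrow> Hb \<in> spots (kind z)) \<and> (E z c \<longleftrightarrow> Hc \<in> spots (kind z)) \<and>
    (E z u \<longleftrightarrow> Hu \<in> spots (kind z)) \<and> (E z v \<longleftrightarrow> Hv \<in> spots (kind z)) \<and> (E z w \<longleftrightarrow> Hw \<in> spots (kind z))"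
    using t two_a[of z] two_b[of z] two_c[of z] two_u[of z] two_v[of z] two_w[of z]
    by (cases "E z a"; cases "E z b"; cases "E z c"; cases "E z u"; cases "E z v"; cases "E z w"; simp add: kind_def)
  then show "E z a \<longleftrightarrow> Ha \<in> spots (kind z)" "E z b \<longleftrightarrow> Hb \<in> spots (kind z)" "E z c \<longleftrightarrow> Hc \<in> spots (kind z)"
    "E z u \<longleftrightarrow> Hu \<in> spots (kind z)" "E z v \<longleftrightarrow> Hv \<in> spots (kind z)" "E z w \<longleftrightarrow> Hw \<in> spots (kind z)"
    by blast+
qed

lemma kind_K: "kind z = K1 \<longleftrightarrow> E z a \<and> E z u" "kind z = K2 \<longleftrightarrow> E z b \<and> E z v" "kind z = K3 \<longleftrightarrow> E z c \<and> E z w"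
  unfolding spots_kind by (cases "kind z"; simp)+

lemma kind_vertex [simp]:
  "kind a = KA" "kind b = KB" "kind c = KC" "kind u = KU" "kind v = KV" "kind w = KW"
proof -
  note s = av vc cu ub bw wa sym[OF av] sym[OF vc] sym[OF cu] sym[OF ub] sym[OF bw] sym[OF wa]
  have n: "\<not> E a u" "\<not> E u a" "\<not> E b v" "\<not> E v b" "\<not> E c w" "\<not> E w c" using au bv cw sym by blast+
  show "kind a = KA" using s n unfolding spots_kind by (cases "kind a") auto
  show "kind b = KB" using s n unfolding spots_kind by (cases "kind b") auto
  show "kind c = KC" using s n unfolding spots_kind by (cases "kind c") auto
  show "kind u = KU" using s n unfolding spots_kind by (cases "kind u") auto
  show "kind v = KV" using s n unfolding spots_kind by (cases "kind v") auto
  show "kind w = KW" using s n unfolding spots_kind by (cases "kind w") auto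
qed

lemma compat_of_edge:
  assumes e: "E p q"
  shows "compat (kind p) (kind q)"
proof -
  have share: "\<not> (E p h \<and> E q h)" for h using e triangle_free by blast
  have "spots (kind p) \<inter> spots (kind q) = {}"
  proof -
    have "h \<notin> spots (kind p) \<or> h \<notin> spots (kind q)" for h
      using share[of a] share[of b] share[of c] share[of u] share[of v] share[of w]
      unfolding spots_kind by (cases h) auto
    then show ?thesis by blast
  qed
  moreover have "\<not> (kind p = KA \<and> kind q = KU)" "\<not> (kind p = KU \<and> kind q = KA)"
    "\<not> (kind p = KB \<and> kind q = KV)" "\<not> (kind p = KV \<and> kind q = KB)"
    "\<not> (kind p = KC \<and> kind q = KW)" "\<not> (kind p = KW \<and> kind q = KC)"
    using cross_a[of p q] cross_a[of q p] cross_b[of p q] cross_b[of q p] cross_c[of p q] cross_c[of q p]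
      e sym[OF e] unfolding spots_kind by auto
  ultimately show ?thesis by (auto simp: compat_def)
qed

text \<open>A compatible but non-adjacent pair has a common neighbour, which completes a triangle of
  kinds; the only such triangle consists of the three ranges.\<close>

lemma edge_of_compat:
  assumes "compat (kind p) (kind q)" "\<not> (cyclic (kind p) \<and> cyclic (kind q))"
  shows "E p q"
proof (rule ccontr)
  assume "\<not> E p q"
  then obtain t where "E t p" "E t q" using common by blast
  then show False using compat_triangle[OF assms(1)] compat_of_edge assms(2) by blast
qed

lemma edge_iff_compat:
  "\<not> (cyclic (kind p) \<and> cyclic (kind q)) \<Longrightarrow> E p q \<longleftrightarrow> compat (kind p) (kind q)"
  using compat_of_edge edge_of_compat by blast

text \<open>No kind besides the third range is compatible with two given ranges.\<close>

lemma common_third: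
  assumes "third (kind p) (kind q) k" "\<not> E p q"
  shows "\<exists>t. kind t = k \<and> E t p \<and> E t q"
proof -
  obtain t where t: "E t p" "E t q" using common[OF assms(2)] by blast
  then have "compat (kind p) (kind t)" "compat (kind q) (kind t)" using compat_of_edge sym by blast+
  then have "kind t = k"
    using assms(1) unfolding third_def by auto
  then show ?thesis using t by blast
qed

text \<open>If both edges in the conclusion were missing, the pairs \<open>p\<close>,
  \<open>r'\<close> and \<open>p'\<close>, \<open>r\<close> and \<open>x'\<close>, \<open>x\<close>
  and \<open>y'\<close>, \<open>y\<close> would be the antipodes of a cube.\<close>

lemma crown_aux:
  assumes "E p x" "E p y" "E p' x" "E p' y" "E r x'" "E r y'" "E r' x'" "E r' y'"
    "E x' y" "E y' x" "\<not> E x' x" "\<not> E y' y" "E p r" "E p' r'"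
  shows "E p r' \<or> E p' r"
  using no_cube[of p r x y p' r' x' y'] assms sym by blast

lemma crown:
  assumes "cyclic (kind p)" "cyclic (kind r)" "kind p \<noteq> kind r" "kind p' = kind p" "kind r' = kind r"
    and "E p r" "E p' r'"
  shows "E p r' \<or> E p' r"
proof -
  have 12: "E p r' \<or> E p' r" if k: "kind p = K1" "kind p' = K1" "kind r = K2" "kind r' = K2" and e: "E p r" "E p' r'"
    for p p' r r'
  proof (rule crown_aux[of p a u p' r b v r'])
    show "E b u" "E v a" "\<not> E b a" "\<not> E v u" by (simp_all add: edge_iff_compat)
  qed (use k e in \<open>simp_all add: spots_kind\<close>)
  have 13: "E p r' \<or> E p' r" if k: "kind p = K1" "kind p' = K1" "kind r = K3" "kind r' = K3" and e: "E p r" "E p' r'"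
    for p p' r r'
  proof (rule crown_aux[of p a u p' r c w r'])
    show "E c u" "E w a" "\<not> E c a" "\<not> E w u" by (simp_all add: edge_iff_compat)
  qed (use k e in \<open>simp_all add: spots_kind\<close>)
  have 23: "E p r' \<or> E p' r" if k: "kind p = K2" "kind p' = K2" "kind r = K3" "kind r' = K3" and e: "E p r" "E p' r'"
    for p p' r r'
  proof (rule crown_aux[of p b v p' r c w r'])
    show "E c v" "E w b" "\<not> E c b" "\<not> E w v" by (simp_all add: edge_iff_compat)
  qed (use k e in \<open>simp_all add: spots_kind\<close>)
  have s: "E r p" "E r' p'" using assms(6,7) sym by blast+
  have "kind p \<in> {K1, K2, K3}" "kind r \<in> {K1, K2, K3}" using assms(1,2) by (simp_all add: cyclic_def)
  then have "(E p r' \<or> E p' r) \<or> (E r p' \<or> E r' p)"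
    using 12[of p p' r r'] 13[of p p' r r'] 23[of p p' r r'] 12[of r r' p p'] 13[of r r' p p'] 23[of r r' p p']
      assms s by auto
  then show ?thesis using sym by blast
qed

text \<open>By \<open>crown\<close>, the neighbourhoods of the vertices of one range within another range form a chain.\<close>

lemma chain_min:
  assumes "finite S" "S \<noteq> {}" "\<forall>s\<in>S. kind s = i" "cyclic i" "cyclic j" "i \<noteq> j"
  shows "\<exists>s\<in>S. \<forall>s'\<in>S. \<forall>r. kind r = j \<longrightarrow> E r s \<longrightarrow> E r s'"
  using assms(1-3)
proof (induction S rule: finite_ne_induct)
  case (insert x F)
  then obtain s where s: "s \<in> F" "\<And>s' r. s' \<in> F \<Longrightarrow> kind r = j \<Longrightarrow> E r s \<Longrightarrow> E r s'" by auto
  show ?case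
  proof (cases "\<forall>r. kind r = j \<longrightarrow> E r s \<longrightarrow> E r x")
    case True then show ?thesis using s by (intro bexI[of _ s]) auto
  next
    case False
    then obtain r0 where r0: "kind r0 = j" "E r0 s" "\<not> E r0 x" by blast
    have "E r s'" if r: "kind r = j" "E r x" "s' \<in> F" for r s'
    proof -
      have "E r0 x \<or> E r s"
        using crown[of r0 s r x] r0 r assms(4-6) insert.prems s(1) by auto
      then show ?thesis using r0 s(2) r by blast
    qed
    then show ?thesis by (intro bexI[of _ x]) auto
  qed
qed auto

lemma chain_min_filtered:
  assumes "finite I" "p \<in> I" "kind p = i" "cyclic i" "cyclic j" "i \<noteq> j"
  shows "\<exists>s\<in>I. kind s = i \<and> (\<forall>s'\<in>I. \<forall>r. kind s' = i \<longrightarrow> kind r = j \<longrightarrow> E r s \<longrightarrow> E r s')"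
proof -
  have "finite {x\<in>I. kind x = i}" "{x\<in>I. kind x = i} \<noteq> {}" "\<forall>s\<in>{x\<in>I. kind x = i}. kind s = i"
    using assms by auto
  from chain_min[OF this assms(4-6)] show ?thesis by blast
qed

text \<open>In each of the two chains take the vertex with the least neighbourhood in the third
  range. These two are non-adjacent, and their common neighbour lies in the third range, hence is
  adjacent to all of both chains.\<close>

lemma dominated_two:
  assumes "finite I" "\<And>x y. x \<in> I \<Longrightarrow> y \<in> I \<Longrightarrow> \<not> E x y"
    and p: "p \<in> I" "kind p = i" and q: "q \<in> I" "kind q = j" and k: "third i j k"
  shows "\<exists>t. kind t = k \<and> (\<forall>x\<in>I. kind x = i \<or> kind x = j \<longrightarrow> E t x)"
proof -
  have c: "cyclic i" "cyclic j" "cyclic k" "i \<noteq> k" "j \<noteq> k"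
    using k by (auto simp: third_def)
  obtain s where s: "s \<in> I" "kind s = i" "\<forall>s'\<in>I. \<forall>r. kind s' = i \<longrightarrow> kind r = k \<longrightarrow> E r s \<longrightarrow> E r s'"
    using chain_min_filtered[OF assms(1) p c(1,3,4)] by blast
  obtain s1 where s1: "s1 \<in> I" "kind s1 = j" "\<forall>s'\<in>I. \<forall>r. kind s' = j \<longrightarrow> kind r = k \<longrightarrow> E r s1 \<longrightarrow> E r s'"
    using chain_min_filtered[OF assms(1) q c(2,3,5)] by blast
  have "third (kind s) (kind s1) k" "\<not> E s s1" using k s s1 assms(2) by auto
  then obtain t where "kind t = k" "E t s" "E t s1" using common_third by blast
  then show ?thesis using s(3) s1(3) by blast
qed

text \<open>Pairwise common neighbours lie in the respective third ranges and form a hexagon with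
  \<open>p\<close>, \<open>q\<close>, \<open>r\<close>. One colour class is dominated by
  \<open>triple_common\<close>, but no kind is compatible with all three ranges.\<close>

lemma no_independent_three:
  assumes k: "kind p = K1" "kind q = K2" "kind r = K3" and n: "\<not> E p q" "\<not> E p r" "\<not> E q r"
  shows False
proof -
  obtain p' where p': "kind p' = K1" "E p' q" "E p' r" using common_third[of q r K1] k n by auto
  obtain q' where q': "kind q' = K2" "E q' p" "E q' r" using common_third[of p r K2] k n by auto
  obtain r' where r': "kind r' = K3" "E r' p" "E r' q" using common_third[of p q K3] k n by auto
  have no: False if "E t x" "E t y" "E t z" "kind x = K1" "kind y = K2" "kind z = K3" for t x y z
    using compat_of_edge[OF that(1)] compat_of_edge[OF that(2)] compat_of_edge[OF that(3)] that(4-6)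
    by (cases "kind t") auto
  have "(\<exists>t. E t p \<and> E t q \<and> E t r) \<or> (\<exists>t. E t p' \<and> E t q' \<and> E t r')"
    using triple_common[of p q' r' q p' r] p' q' r' sym by blast
  then show False using no k p' q' r' by blast
qed

end

text \<open>Some vertex of the range of \<open>b\<close>, \<open>v\<close> has no neighbour in the range of \<open>a\<close>, \<open>u\<close>. In a Vega graph this
  happens for some pairs of ranges; the ranges are renumbered to avoid it where it matters.\<close>

definition lacking :: "('a \<Rightarrow> 'a \<Rightarrow> bool) \<Rightarrow> 'a \<Rightarrow> 'a \<Rightarrow> 'a \<Rightarrow> 'a \<Rightarrow> bool" where
  "lacking E b v a u \<longleftrightarrow> (\<exists>p. E p b \<and> E p v \<and> \<not> (\<exists>q. E q a \<and> E q u \<and> E q p))"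

context hexframe
begin

text \<open>The two witnesses would close a hexagon with colour classes {a, u, p} and {b, v, q}; a
  vertex dominating either class contradicts the choice of p or q.\<close>

lemma lacking_sym: "\<not> (lacking E b v a u \<and> lacking E a u b v)"
proof
  assume "lacking E b v a u \<and> lacking E a u b v"
  then obtain p q where p: "E p b" "E p v" "\<not> (\<exists>t. E t a \<and> E t u \<and> E t p)"
    and q: "E q a" "E q u" "\<not> (\<exists>t. E t b \<and> E t v \<and> E t q)"
    unfolding lacking_def by blast
  have "E a v" "E a q" "E u b" "E u q" "E p b" "E p v" using av ub p q sym by blast+
  then show False using triple_common[of a v q u b p] p(3) q(3) by blast
qed

text \<open>The two witnesses are non-adjacent by the choice of the second, so they have a common
  neighbour in the range of \<open>a\<close>, \<open>u\<close>, against the choice of the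
  first.\<close>

lemma lacking_path: "\<not> (lacking E b v a u \<and> lacking E c w b v)"
proof
  assume "lacking E b v a u \<and> lacking E c w b v"
  then obtain p q where p: "E p b" "E p v" "\<not> (\<exists>t. E t a \<and> E t u \<and> E t p)"
    and q: "E q c" "E q w" "\<not> (\<exists>t. E t b \<and> E t v \<and> E t q)"
    unfolding lacking_def by blast
  have k: "kind p = K2" "kind q = K3" using p q kind_K by auto
  have "\<not> E p q" using p q by blast
  then obtain t where "kind t = K1" "E t p" "E t q" using common_third[of p q K1] k by auto
  then show False using p(3) kind_K by blast
qed

end

locale centred = hexframe +
  assumes near21: "kind p = K2 \<Longrightarrow> \<exists>q. kind q = K1 \<and> E q p"
    and near31: "kind p = K3 \<Longrightarrow> \<exists>q. kind q = K1 \<and> E q p"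
    and near32: "kind p = K3 \<Longrightarrow> \<exists>q. kind q = K2 \<and> E q p"

lemma (in hexframe) centredI:
  assumes "\<not> lacking E b v a u" "\<not> lacking E c w a u" "\<not> lacking E c w b v"
  shows "centred E a b c u v w"
proof (unfold_locales, goal_cases)
  case (1 p) then show ?case using assms(1) unfolding kind_K lacking_def by blast
next
  case (2 p) then show ?case using assms(2) unfolding kind_K lacking_def by blast
next
  case (3 p) then show ?case using assms(3) unfolding kind_K lacking_def by blast
qed

text \<open>On the three ranges \<open>lacking\<close> has neither 2-cycles nor paths of length two.
  Being acyclic, it admits an order in which no range lacks an earlier one. The set {a, b, c} is
  kept so that a vertex dominating it still does so after renumbering.\<close>

lemma (in hexframe) centred_exists:
  "\<exists>a' b' c' u' v' w'. centred E a' b' c' u' v' w' \<and> {a', b', c'} = {a, b, c}"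
proof -
  interpret r: hexframe E b c a v w u by (rule rotated)
  interpret rr: hexframe E c a b w u v by (rule r.rotated)
  interpret s: hexframe E b a c v u w by (rule swapped)
  interpret sr: hexframe E a c b u w v by (rule s.rotated)
  interpret srr: hexframe E c b a w v u by (rule sr.rotated)
  have "(\<not> lacking E b v a u \<and> \<not> lacking E c w a u \<and> \<not> lacking E c w b v) \<or>
     (\<not> lacking E c w b v \<and> \<not> lacking E a u b v \<and> \<not> lacking E a u c w) \<or>
     (\<not> lacking E a u c w \<and> \<not> lacking E b v c w \<and> \<not> lacking E b v a u) \<or>
     (\<not> lacking E a u b v \<and> \<not> lacking E c w b v \<and> \<not> lacking E c w a u) \<or>
     (\<not> lacking E c w a u \<and> \<not> lacking E b v a u \<and> \<not> lacking E b v c w) \<or>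
     (\<not> lacking E b v c w \<and> \<not> lacking E a u c w \<and> \<not> lacking E a u b v)"
    using lacking_sym r.lacking_sym rr.lacking_sym lacking_path r.lacking_path rr.lacking_path
      s.lacking_path sr.lacking_path srr.lacking_path by argo
  then have "centred E a b c u v w \<or> centred E b c a v w u \<or> centred E c a b w u v \<or>
     centred E b a c v u w \<or> centred E a c b u w v \<or> centred E c b a w v u"
  proof (elim disjE conjE, goal_cases)
    case 1
    then have "centred E a b c u v w" by (intro centredI)
    then show ?case by (simp only: simp_thms)
  next
    case 2
    then have "centred E b c a v w u" by (intro r.centredI)
    then show ?case by (simp only: simp_thms)
  next
    case 3
    then have "centred E c a b w u v" by (intro rr.centredI)
    then show ?case by (simp only: simp_thms)
  next
    case 4
    then have "centred E b a c v u w" by (intro s.centredI)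
    then show ?case by (simp only: simp_thms)
  next
    case 5
    then have "centred E a c b u w v" by (intro sr.centredI)
    then show ?case by (simp only: simp_thms)
  next
    case 6
    then have "centred E c b a w v u" by (intro srr.centredI)
    then show ?case by (simp only: simp_thms)
  qed
  moreover have "{b, c, a} = {a, b, c}" "{c, a, b} = {a, b, c}" "{b, a, c} = {a, b, c}"
    "{a, c, b} = {a, b, c}" "{c, b, a} = {a, b, c}" by auto
  ultimately show ?thesis by blast
qed

section \<open>Domination inside the core\<close>

context centred
begin

text \<open>Without the twins of \<open>Vc\<close>, \<open>Vv\<close>, \<open>Vx\<close>, \<open>Vy\<close> a Vega graph is a blow-up of an Andrasfai graph.\<close>

definition core :: "'a set" where
  "core = {z. kind z \<in> {K1, K2, K3, KA, KB, KU, KW}}"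

lemma dominates:
  assumes "\<And>x. x \<in> I \<Longrightarrow> compat (kind t) (kind x) \<and> \<not> (cyclic (kind t) \<and> cyclic (kind x)) \<or> E t x"
  shows "\<forall>x\<in>I. E t x"
  using assms edge_of_compat by blast

text \<open>If \<open>I\<close> meets both ranges, \<open>dominated_two\<close> applies. If it meets
  one, the least vertex of that chain has a neighbour in the first range by \<open>near21\<close> or
  \<open>near31\<close>.\<close>

lemma near_K1:
  assumes fin: "finite I" and ind: "\<And>x y. x \<in> I \<Longrightarrow> y \<in> I \<Longrightarrow> \<not> E x y"
  shows "\<exists>t. kind t = K1 \<and> (\<forall>x\<in>I. kind x = K2 \<or> kind x = K3 \<longrightarrow> E t x)"
proof -
  have one: "\<exists>t. kind t = K1 \<and> (\<forall>x\<in>I. kind x = i \<longrightarrow> E t x)" if i: "i = K2 \<or> i = K3" for i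
  proof (cases "\<exists>x\<in>I. kind x = i")
    case True
    then obtain p where p: "p \<in> I" "kind p = i" by blast
    have c: "cyclic i" "i \<noteq> K1" using i by auto
    obtain s where s: "s \<in> I" "kind s = i" "\<forall>s'\<in>I. \<forall>r. kind s' = i \<longrightarrow> kind r = K1 \<longrightarrow> E r s \<longrightarrow> E r s'"
      using chain_min_filtered[OF fin p c(1) cyclic_simps(1) c(2)] by blast
    obtain t where "kind t = K1" "E t s" using near21[of s] near31[of s] s(2) i by blast
    then show ?thesis using s(3) by blast
  next
    case False
    obtain t where "E t a" "E t u" using common[OF au] by blast
    then show ?thesis using False kind_K by blast
  qed
  show ?thesis
  proof (cases "(\<exists>x\<in>I. kind x = K2) \<and> (\<exists>x\<in>I. kind x = K3)")
    case True
    then obtain p q where "p \<in> I" "kind p = K2" "q \<in> I" "kind q = K3" by blast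
    then show ?thesis using dominated_two[OF fin ind, of p K2 q K3 K1] by auto
  next
    case False then show ?thesis using one[of K2] one[of K3] by auto
  qed
qed

text \<open>Compatible kinds that are not both ranges cannot occur together in \<open>I\<close>. The
  kinds present outside the ranges therefore exclude so many others that one of \<open>a\<close>,
  \<open>b\<close>, \<open>u\<close>, \<open>w\<close> or a vertex of some range is adjacent to all
  of \<open>I\<close>. If only ranges occur, \<open>no_independent_three\<close> excludes having all
  three.\<close>

lemma core_dominated:
  assumes fin: "finite I" and I: "I \<subseteq> core" and ind: "\<And>x y. x \<in> I \<Longrightarrow> y \<in> I \<Longrightarrow> \<not> E x y"
  shows "\<exists>t\<in>core. \<forall>x\<in>I. E t x"
proof -
  have kI: "kind x \<in> {K1, K2, K3, KA, KB, KU, KW}" if "x \<in> I" for x using I that by (auto simp: core_def)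
  have ex: "kind y \<noteq> l" if "x \<in> I" "kind x = k" "compat k l" "\<not> (cyclic k \<and> cyclic l)" "y \<in> I" for x y k l
    using edge_of_compat[of x y] ind that by auto
  have wit: ?thesis if "kind t \<in> {K1, K2, K3, KA, KB, KU, KW}"
    "\<And>x. x \<in> I \<Longrightarrow> compat (kind t) (kind x) \<and> \<not> (cyclic (kind t) \<and> cyclic (kind x)) \<or> E t x" for t
    using dominates[of I t] that by (intro bexI[of _ t]) (auto simp: core_def)
  let ?has = "\<lambda>k. \<exists>x\<in>I. kind x = k"
  have two: "\<exists>t. kind t = k \<and> (\<forall>x\<in>I. kind x = i \<or> kind x = j \<longrightarrow> E t x)"
    if "?has i" "?has j" "third i j k" for i j k
    using dominated_two[OF fin ind] that by blast
  obtain t1 where t1: "kind t1 = K1" "\<And>x. x \<in> I \<Longrightarrow> kind x = K2 \<or> kind x = K3 \<Longrightarrow> E t1 x"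
    using near_K1[OF fin ind] by blast
  consider "?has KW" | "\<not> ?has KW" "?has KB" "?has KA \<or> ?has KU" | "\<not> ?has KW" "\<not> ?has KB" "?has KA \<or> ?has KU"
    | "\<not> ?has KW" "\<not> ?has KA" "\<not> ?has KU" "?has KB"
    | "\<not> ?has KW" "\<not> ?has KA" "\<not> ?has KU" "\<not> ?has KB"
    by blast
  then show ?thesis
  proof cases
    case 1
    then have n: "kind x \<notin> {KA, KB, K3}" if "x \<in> I" for x using ex[of _ KW _ x] that by auto
    show ?thesis
    proof (cases "?has K1")
      case False
      show ?thesis by (rule wit[of b]) (use kI n False in fastforce)+
    next
      case True
      then have nU: "kind x \<noteq> KU" if "x \<in> I" for x using ex[of _ K1 KU x] that by auto
      show ?thesis
      proof (cases "?has K2")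
        case False
        show ?thesis by (rule wit[of a]) (use kI n nU False in fastforce)+
      next
        case 2: True
        obtain t where t: "kind t = K3" "\<forall>x\<in>I. kind x = K1 \<or> kind x = K2 \<longrightarrow> E t x"
          using two[OF True 2, of K3] by auto
        show ?thesis by (rule wit[of t]) (use kI n nU t in fastforce)+
      qed
    qed
  next
    case 2
    then have n: "kind x \<notin> {KU, K2, KW}" if "x \<in> I" for x using ex[of _ KB _ x] that by auto
    then have "?has KA" using 2(3) by blast
    then have n': "kind x \<noteq> K1" if "x \<in> I" for x using ex[of _ KA K1 x] that by auto
    show ?thesis by (rule wit[of w]) (use kI n n' in fastforce)+
  next
    case 3
    then have n': "kind x \<noteq> K1" if "x \<in> I" for x using ex[of _ KA K1 x] ex[of _ KU K1 x] that by auto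
    \<comment> \<open>\<open>t1\<close> lies in the first range, which is compatible with
      \<open>KA\<close> and \<open>KU\<close>.\<close>
    show ?thesis by (rule wit[of t1]) (use kI n' 3 t1 in fastforce)+
  next
    case 4
    then have n: "kind x \<noteq> K2" if "x \<in> I" for x using ex[of _ KB K2 x] that by auto
    show ?thesis
    proof (cases "?has K1 \<and> ?has K3")
      case True
      then obtain t where t: "kind t = K2" "\<forall>x\<in>I. kind x = K1 \<or> kind x = K3 \<longrightarrow> E t x"
        using two[of K1 K3 K2] by auto
      show ?thesis by (rule wit[of t]) (use kI n 4 t in fastforce)+
    next
      case False
      show ?thesis
      proof (cases "?has K1")
        case True
        then have "\<not> ?has K3" using False by blast
        then show ?thesis using wit[of u] kI n 4 by fastforce
      next
        case f: False
        then show ?thesis using wit[of w] kI n 4 by fastforce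
      qed
    qed
  next
    case 5
    have cyc: "kind x \<in> {K1, K2, K3}" if "x \<in> I" for x using kI[OF that] 5 that by auto
    have not3: "\<not> (?has K1 \<and> ?has K2 \<and> ?has K3)" using no_independent_three ind by blast
    consider "\<not> ?has K1" | "\<not> ?has K2" "?has K1" "?has K3" | "\<not> ?has K3" "?has K1" "?has K2"
      | "\<not> ?has K2" "\<not> ?has K3" using not3 by blast
    then show ?thesis
    proof cases
      case 1 then show ?thesis using wit[of t1] cyc t1 by fastforce
    next
      case 2
      then obtain t where t: "kind t = K2" "\<forall>x\<in>I. kind x = K1 \<or> kind x = K3 \<longrightarrow> E t x"
        using two[of K1 K3 K2] by auto
      then show ?thesis using wit[of t] cyc 2(1) by fastforce
    next
      case 3
      then obtain t where t: "kind t = K3" "\<forall>x\<in>I. kind x = K1 \<or> kind x = K2 \<longrightarrow> E t x"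
        using two[of K1 K2 K3] by auto
      then show ?thesis using wit[of t] cyc 3(1) by fastforce
    next
      case 4 then show ?thesis using wit[of a] cyc by fastforce
    qed
  qed
qed

lemma core_dominated_graph: "dominated_graph E core"
  using sym triangle_free core_dominated by unfold_locales blast+

end

section \<open>Assembling the Vega graph\<close>

context centred
begin

definition position :: "nat \<Rightarrow> ('a \<Rightarrow> int) \<Rightarrow> bool" where
  "position k f \<longleftrightarrow> (\<forall>z\<in>core. f z \<in> {0..<circ k}) \<and> (\<forall>x\<in>{0..<circ k}. \<exists>z\<in>core. f z = x) \<and>
     (\<forall>y\<in>core. \<forall>z\<in>core. E y z \<longleftrightarrow> andrasfai_adj k (f y) (f z))"

lemma position_shift:
  assumes "position k f" "k \<ge> 1"
  shows "position k (\<lambda>z. (f z + s) mod circ k)"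
  unfolding position_def
proof (intro conjI ballI)
  fix x assume x: "x \<in> {0..<circ k}"
  have "(x - s) mod circ k \<in> {0..<circ k}" using assms(2) by simp
  then obtain z where "z \<in> core" "f z = (x - s) mod circ k" using assms(1) unfolding position_def by blast
  then show "\<exists>z\<in>core. (f z + s) mod circ k = x" using x by (intro bexI[of _ z]) (auto simp: mod_simps)
qed (use assms in \<open>auto simp: position_def adj_shift\<close>)

lemma position_reflect:
  assumes "position k f" "k \<ge> 1"
  shows "position k (\<lambda>z. (- f z) mod circ k)"
  unfolding position_def
proof (intro conjI ballI)
  fix x assume x: "x \<in> {0..<circ k}"
  have "(- x) mod circ k \<in> {0..<circ k}" using assms(2) by simp
  then obtain z where "z \<in> core" "f z = (- x) mod circ k" using assms(1) unfolding position_def by blast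
  then show "\<exists>z\<in>core. (- f z) mod circ k = x" using x by (intro bexI[of _ z]) (auto simp: mod_simps)
next
  fix y z assume "y \<in> core" "z \<in> core"
  then have "E y z \<longleftrightarrow> andrasfai_adj k (f z) (f y)"
    using assms adj_sym unfolding position_def by blast
  also have "\<dots> \<longleftrightarrow> andrasfai_adj k ((- f y) mod circ k) ((- f z) mod circ k)"
    by (simp add: andrasfai_adj_def mod_simps)
  finally show "E y z \<longleftrightarrow> andrasfai_adj k ((- f y) mod circ k) ((- f z) mod circ k)" .
qed (use assms(2) in auto)

lemma vertices_core [simp]: "a \<in> core" "b \<in> core" "u \<in> core" "w \<in> core"
  by (simp_all add: core_def)

text \<open>Core vertices of equal kind outside the ranges are twins, and an Andrasfai graph has no
  two vertices with the same neighbourhood.\<close>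

lemma same_position:
  assumes p: "position k f" and k: "k \<ge> 1" and z: "z \<in> core" "z' \<in> core" "kind z = kind z'" "\<not> cyclic (kind z)"
  shows "f z = f z'"
proof (rule adj_inj[OF k])
  show "f z \<in> {0..<circ k}" "f z' \<in> {0..<circ k}" using p z unfolding position_def by blast+
  fix l assume "l \<in> {0..<circ k}"
  then obtain y where y: "y \<in> core" "f y = l" using p unfolding position_def by blast
  have "E z y \<longleftrightarrow> E z' y" using z edge_iff_compat by auto
  then show "andrasfai_adj k (f z) l \<longleftrightarrow> andrasfai_adj k (f z') l"
    using p y z unfolding position_def by blast
qed

lemma kind_KW: "z \<in> core \<Longrightarrow> E z a \<Longrightarrow> E z b \<Longrightarrow> kind z = KW"
  unfolding spots_kind core_def by (cases "kind z") auto

text \<open>Vertices at distance d <= k-1 have k-d common neighbours in the Andrasfai graph. For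
  \<open>a\<close> and \<open>b\<close> these all come from twins of \<open>w\<close>, which share
  one position, so d = k-1. A rotation then brings \<open>a\<close> to 2k-1.\<close>

lemma normal_position_aux:
  assumes p: "position k f" and k: "k \<ge> 1" and d: "(f b - f a) mod circ k \<le> int k - 1"
  shows "\<exists>g. position k g \<and> g w = int k - 1 \<and> g a = 2 * int k - 1 \<and> g b = 3 * int k - 2"
proof -
  define d where "d = (f b - f a) mod circ k"
  have d0: "0 \<le> d" "d \<le> int k - 1" using d k by (simp_all add: d_def)
  have uniq: "(f a + e) mod circ k = f w" if e: "int k + d \<le> e" "e \<le> 2 * int k - 1" for e
  proof -
    let ?l = "(f a + e) mod circ k"
    have l: "?l \<in> {0..<circ k}" using k by simp
    then obtain z where z: "z \<in> core" "f z = ?l" using p unfolding position_def by blast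
    have "(?l - f a) mod circ k = e"
      using e d0 k by (simp add: mod_simps mod_pos_pos_trivial)
    then have 1: "andrasfai_adj k (f z) (f a)" using e d0 z by (simp add: andrasfai_adj_def)
    have "(?l - f b) mod circ k = (e - (f b - f a)) mod circ k" by (simp add: mod_simps algebra_simps)
    also have "\<dots> = (e - d) mod circ k" unfolding d_def by (rule mod_diff_right_eq[symmetric])
    also have "\<dots> = e - d" using e d0 by (intro mod_pos_pos_trivial) auto
    finally have 2: "andrasfai_adj k (f z) (f b)" using e d0 z by (simp add: andrasfai_adj_def)
    have "E z a" "E z b" using 1 2 p z unfolding position_def by auto
    then have "kind z = kind w" using kind_KW z by simp
    then show ?thesis using same_position[OF p k z(1), of w] z \<open>kind z = kind w\<close> by simp
  qed
  have dk: "d = int k - 1"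
  proof (rule ccontr)
    assume "d \<noteq> int k - 1"
    then have lt: "d \<le> int k - 2" using d0 by linarith
    have "(f a + (2 * int k - 1)) mod circ k = (f a + (2 * int k - 2)) mod circ k"
      using uniq[of "2 * int k - 1"] uniq[of "2 * int k - 2"] lt d0 by simp
    then have "circ k dvd (f a + (2 * int k - 1)) - (f a + (2 * int k - 2))"
      by (simp only: mod_eq_dvd_iff)
    then have "circ k dvd 1" by simp
    then show False using k by simp
  qed
  define g where "g z = (f z + (2 * int k - 1 - f a)) mod circ k" for z
  have "position k g" unfolding g_def by (rule position_shift[OF p k])
  moreover have "g a = 2 * int k - 1" using k by (simp add: g_def mod_pos_pos_trivial)
  moreover have "g b = 3 * int k - 2"
  proof -
    have "g b = ((f b - f a) + (2 * int k - 1)) mod circ k" by (simp add: g_def algebra_simps)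
    also have "\<dots> = (d + (2 * int k - 1)) mod circ k" unfolding d_def by (rule mod_add_left_eq[symmetric])
    also have "\<dots> = 3 * int k - 2" using dk k by (simp add: mod_pos_pos_trivial)
    finally show ?thesis .
  qed
  moreover have "g w = int k - 1"
  proof -
    have w: "f w = (f a + (2 * int k - 1)) mod circ k" using uniq[of "2 * int k - 1"] d0 by simp
    have "g w = ((f a + (2 * int k - 1)) + (2 * int k - 1 - f a)) mod circ k"
      unfolding g_def w by (rule mod_add_left_eq)
    \<comment> \<open>From the position 2k-1 of \<open>a\<close>, another 2k-1 leads to 4k-2, which
      is k-1 modulo 3k-1.\<close>
    also have "\<dots> = (int k - 1 + circ k) mod circ k" by (simp add: algebra_simps)
    also have "\<dots> = (int k - 1) mod circ k" by (rule mod_add_self2)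
    also have "\<dots> = int k - 1" using k by (intro mod_pos_pos_trivial) auto
    finally show ?thesis .
  qed
  ultimately show ?thesis by blast
qed

lemma normal_position:
  assumes p: "position k f" and k: "k \<ge> 1"
  shows "\<exists>g. position k g \<and> g w = int k - 1 \<and> g a = 2 * int k - 1 \<and> g b = 3 * int k - 2"
proof (cases "(f b - f a) mod circ k \<le> int k - 1")
  case True then show ?thesis using normal_position_aux[OF p k] by blast
next
  case False
  define d where "d = (f b - f a) mod circ k"
  have d: "int k \<le> d" "d < circ k" using False k by (simp_all add: d_def)
  have "\<not> E b a" using edge_iff_compat[of b a] by simp
  then have "\<not> andrasfai_adj k (f b) (f a)" using p unfolding position_def by auto
  then have d2: "2 * int k \<le> d" using d by (simp add: andrasfai_adj_def d_def)
  have "((- f b) mod circ k - (- f a) mod circ k) mod circ k = (- (f b - f a)) mod circ k"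
    by (simp add: mod_simps)
  also have "\<dots> = (- d) mod circ k" unfolding d_def by (rule mod_minus_eq[symmetric])
  also have "\<dots> = (- d + circ k) mod circ k" by (rule mod_add_self2[symmetric])
  also have "\<dots> = circ k - d" using d d2 by (subst mod_pos_pos_trivial) auto
  finally show ?thesis using normal_position_aux[OF position_reflect[OF p k] k] d2 by simp
qed

end

section \<open>From positions to a Vega graph\<close>

definition place_kind :: "kind \<Rightarrow> int \<Rightarrow> vega_vertex" where
  "place_kind l p = (case l of KA \<Rightarrow> Va | KB \<Rightarrow> Vb | KC \<Rightarrow> Vc | KU \<Rightarrow> Vu | KV \<Rightarrow> Vv | KW \<Rightarrow> Vw
     | KX \<Rightarrow> Vx | KY \<Rightarrow> Vy | _ \<Rightarrow> Cyc p)"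

definition in_range :: "nat \<Rightarrow> kind \<Rightarrow> int \<Rightarrow> bool" where
  "in_range i l p \<longleftrightarrow> (l = K1 \<longrightarrow> 0 \<le> p \<and> p \<le> int i - 1) \<and> (l = K2 \<longrightarrow> int i \<le> p \<and> p \<le> 2 * int i - 1) \<and>
     (l = K3 \<longrightarrow> 2 * int i \<le> p \<and> p \<le> 3 * int i - 2)"

lemma vega_adj_place_kind:
  assumes "in_range i l p" "in_range i m q" "\<not> (cyclic l \<and> cyclic m)"
  shows "vega_adj i (place_kind l p) (place_kind m q) \<longleftrightarrow> compat l m"
  using assms by (cases l; cases m; simp add: vega_adj_def place_kind_def in_range_def)

text \<open>Deleting the positions \<open>k - 1\<close>, \<open>2 * k - 1\<close>, \<open>3 * k - 2\<close> of \<open>w\<close>, \<open>a\<close>, \<open>b\<close> from the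
  Andrasfai graph with parameter \<open>k\<close> leaves the one with parameter \<open>k - 1\<close>.\<close>

lemma adj_remove_three:
  fixes k p q p' q' :: int
  assumes k: "k \<ge> 3"
    and p: "0 \<le> p \<and> p \<le> k - 2 \<and> p' = p \<or> k \<le> p \<and> p \<le> 2 * k - 2 \<and> p' = p - 1 \<or>
      2 * k \<le> p \<and> p \<le> 3 * k - 3 \<and> p' = p - 2"
    and q: "0 \<le> q \<and> q \<le> k - 2 \<and> q' = q \<or> k \<le> q \<and> q \<le> 2 * k - 2 \<and> q' = q - 1 \<or>
      2 * k \<le> q \<and> q \<le> 3 * k - 3 \<and> q' = q - 2"
  shows "k - 1 \<le> \<bar>p' - q'\<bar> \<and> \<bar>p' - q'\<bar> \<le> 2 * (k - 1) - 1 \<longleftrightarrow> k \<le> \<bar>p - q\<bar> \<and> \<bar>p - q\<bar> \<le> 2 * k - 1"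
  using p q k by (elim disjE conjE) (smt (verit))+

text \<open>The positions of \<open>w\<close>, \<open>a\<close>, \<open>b\<close> carry no vertex of
  a range; deleting them leaves parameter i = k-1. In a Vega graph without c, v, x, y the vertices u
  and 2i-1 are twins. Hence \<open>u\<close> occupies the last position 2k-2 of the second range
  whether or not 2i-1 is present, which \<open>nu\<close> records; \<open>mu\<close> records the
  presence of y.\<close>

lemma (in centred) blow_up_vega:
  assumes x: "E x a" "E x b" "E x c" and k: "k \<ge> 1" and p: "position k pos"
    and pw: "pos w = int k - 1" and pa: "pos a = 2 * int k - 1" and pb: "pos b = 3 * int k - 2"
  shows "\<exists>i\<ge>2. \<exists>mu\<in>{0, 1}. \<exists>nu\<in>{0, 1}. blow_up E UNIV (vega_adj i) (vega_verts i mu nu)"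
proof -
  have rng: "0 \<le> pos z" "pos z \<le> 3 * int k - 2" if "z \<in> core" for z
    using p that unfolding position_def by fastforce+
  have surj: "\<exists>z\<in>core. pos z = q" if "0 \<le> q" "q \<le> 3 * int k - 2" for q
    using p that unfolding position_def by auto
  have Eadj: "E y z \<longleftrightarrow> int k \<le> \<bar>pos y - pos z\<bar> \<and> \<bar>pos y - pos z\<bar> \<le> 2 * int k - 1"
    if "y \<in> core" "z \<in> core" for y z
  proof -
    have "\<bar>pos y - pos z\<bar> < circ k" using rng[OF that(1)] rng[OF that(2)] by linarith
    then show ?thesis using p that adj_abs unfolding position_def by blast
  qed
  have Ew: "E z w \<longleftrightarrow> 2 * int k - 1 \<le> pos z" and Ea: "E z a \<longleftrightarrow> pos z \<le> int k - 1"
    and Eb: "E z b \<longleftrightarrow> int k - 1 \<le> pos z \<and> pos z \<le> 2 * int k - 2" if "z \<in> core" for z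
    using Eadj[OF that vertices_core(4)] Eadj[OF that vertices_core(1)] Eadj[OF that vertices_core(2)]
      rng[OF that] k unfolding pw pa pb by linarith+
  have same: "pos z = pos z'" if "z \<in> core" "z' \<in> core" "kind z = kind z'" "\<not> cyclic (kind z)" for z z'
    by (rule same_position[OF p k that])
  have K_core: "z \<in> core" if "kind z = K1 \<or> kind z = K2 \<or> kind z = K3" for z
    using that by (auto simp: core_def)
  have pKW: "pos z = int k - 1" if "z \<in> core" "kind z = KW" for z using same[OF that(1), of w] that pw by simp
  have pKA: "pos z = 2 * int k - 1" if "z \<in> core" "kind z = KA" for z using same[OF that(1), of a] that pa by simp
  have pKB: "pos z = 3 * int k - 2" if "z \<in> core" "kind z = KB" for z using same[OF that(1), of b] that pb by simp
  have r1: "0 \<le> pos z \<and> pos z \<le> int k - 2" if "kind z = K1" for z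
  proof -
    have z: "z \<in> core" using K_core that by blast
    have "E z a" "\<not> E z b" using that by (simp_all add: spots_kind)
    then show ?thesis using Ea[OF z] Eb[OF z] rng[OF z] by auto
  qed
  have r2: "int k \<le> pos z \<and> pos z \<le> 2 * int k - 2" if "kind z = K2" for z
  proof -
    have z: "z \<in> core" using K_core that by blast
    have "E z b" "\<not> E z a" using that by (simp_all add: spots_kind)
    then show ?thesis using Ea[OF z] Eb[OF z] rng[OF z] by auto
  qed
  have r3: "2 * int k \<le> pos z \<and> pos z \<le> 3 * int k - 3" if K: "kind z = K3" for z
  proof -
    have z: "z \<in> core" using K_core K by blast
    have "E z w" using K by (simp add: spots_kind)
    then have lo: "2 * int k - 1 \<le> pos z" using Ew[OF z] by simp
    \<comment> \<open>At the position of \<open>a\<close>, \<open>z\<close> would share its core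
      neighbours with \<open>a\<close>, but its neighbour in the second range given by
      \<open>near32\<close> is not adjacent to \<open>a\<close>.\<close>
    moreover have "pos z \<noteq> 2 * int k - 1"
    proof
      assume e: "pos z = 2 * int k - 1"
      obtain q where q: "kind q = K2" "E q z" using near32[OF K] by blast
      have "q \<in> core" using K_core q by blast
      then have "E q a" using Eadj[of q z] Eadj[of q a] z q(2) e pa by simp
      then show False using q(1) by (simp add: spots_kind)
    qed
    \<comment> \<open>At the position of \<open>b\<close>, \<open>z\<close> would be adjacent to
      \<open>u\<close>, which is incompatible with the third range.\<close>
    moreover have "pos z \<noteq> 3 * int k - 2"
    proof
      assume e: "pos z = 3 * int k - 2"
      have "E u z" using Eadj[of u z] Eadj[of u b] ub z e pb by simp
      then show False using edge_iff_compat[of u z] K by simp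
    qed
    ultimately show ?thesis using rng[OF z] by linarith
  qed
  obtain t3 where "kind t3 = K3" using common[OF cw] kind_K by blast
  \<comment> \<open>The third range is non-empty and fits between 2k and 3k-3.\<close>
  then have k3: "k \<ge> 3" using r3[of t3] by linarith
  have is1: "kind z = K1" if z: "z \<in> core" "pos z \<le> int k - 2" for z
  proof -
    have "E z a" "kind z \<noteq> KW" using Ea[OF z(1)] pKW[OF z(1)] z(2) by auto
    then show ?thesis using z(1) unfolding spots_kind core_def by (cases "kind z") auto
  qed
  have is2: "kind z = K2 \<or> kind z = KU" if z: "z \<in> core" "int k \<le> pos z" "pos z \<le> 2 * int k - 2" for z
  proof -
    have "E z b" "kind z \<noteq> KW" using Eb[OF z(1)] pKW[OF z(1)] z by auto
    then show ?thesis using z(1) unfolding spots_kind core_def by (cases "kind z") auto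
  qed
  have is3: "kind z = K3" if z: "z \<in> core" "2 * int k \<le> pos z" "pos z \<le> 3 * int k - 3" for z
  proof -
    have "E z w" "kind z \<noteq> KA" "kind z \<noteq> KB" using Ew[OF z(1)] pKA[OF z(1)] pKB[OF z(1)] z by auto
    then show ?thesis using z(1) unfolding spots_kind core_def by (cases "kind z") auto
  qed
  have pKU: "pos z = 2 * int k - 2" if z: "z \<in> core" "kind z = KU" for z
  proof -
    have "E z b" using z(2) by (simp add: spots_kind)
    then have "pos z \<le> 2 * int k - 2" using Eb[OF z(1)] by simp
    \<comment> \<open>Position k-2 belongs to the first range; adjacency to it pushes
      \<open>z\<close> up to 2k-2.\<close>
    moreover obtain y where y: "y \<in> core" "pos y = int k - 2" using surj[of "int k - 2"] k3 by auto
    then have "kind y = K1" using is1 by simp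
    then have "E z y" using z(2) edge_iff_compat[of z y] by simp
    then have "int k \<le> \<bar>pos z - (int k - 2)\<bar>" using Eadj[OF z(1) y(1)] y(2) by simp
    ultimately show ?thesis using rng[OF z(1)] by linarith
  qed
  define i where "i = k - 1"
  have i: "int i = int k - 1" "i \<ge> 2" using k3 by (auto simp: i_def)
  \<comment> \<open>One deleted position precedes the second range, two precede the third.\<close>
  define g where "g z = (if kind z = K1 then pos z else if kind z = K2 then pos z - 1 else pos z - 2)" for z
  define f where "f z = place_kind (kind z) (g z)" for z
  define mu :: nat where "mu = (if \<exists>z. kind z = KY then 0 else 1)"
  \<comment> \<open>Position 2k-2 is shifted to 2k-3 = 2i-1.\<close>
  define nu :: nat where "nu = (if \<exists>z. kind z = K2 \<and> pos z = 2 * int k - 2 then 0 else 1)"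
  have ir: "in_range i (kind z) (g z)" for z
    using r1[of z] r2[of z] r3[of z] by (auto simp: in_range_def g_def i)
  have shape: "0 \<le> pos z \<and> pos z \<le> int k - 2 \<and> g z = pos z \<or>
      int k \<le> pos z \<and> pos z \<le> 2 * int k - 2 \<and> g z = pos z - 1 \<or>
      2 * int k \<le> pos z \<and> pos z \<le> 3 * int k - 3 \<and> g z = pos z - 2" if "cyclic (kind z)" for z
  proof -
    consider "kind z = K1" | "kind z = K2" | "kind z = K3" using \<open>cyclic (kind z)\<close> unfolding cyclic_def by blast
    then show ?thesis
    proof cases
      case 1 then show ?thesis using r1[OF 1] by (simp add: g_def)
    next
      case 2 then show ?thesis using r2[OF 2] by (simp add: g_def)
    next
      case 3 then show ?thesis using r3[OF 3] by (simp add: g_def)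
    qed
  qed
  have "f z \<in> vega_verts i mu nu" for z
  proof -
    have "f z \<noteq> Vy" if "mu = 1" using that by (cases "kind z") (auto simp: f_def place_kind_def mu_def split: if_splits)
    moreover have "f z \<noteq> Cyc (2 * int i - 1)" if "nu = 1"
    proof
      assume e: "f z = Cyc (2 * int i - 1)"
      then have g: "g z = 2 * int i - 1" and c: "cyclic (kind z)"
        by (cases "kind z"; simp add: f_def place_kind_def)+
      have "kind z = K2"
        using ir[of z] g c i by (auto simp: in_range_def cyclic_def)
      then have "pos z = 2 * int k - 2" using g i by (simp add: g_def)
      then show False using \<open>kind z = K2\<close> that by (auto simp: nu_def split: if_splits)
    qed
    moreover have "f z \<in> Cyc ` {0..<3 * int i - 1} \<union> {Va, Vb, Vc, Vu, Vv, Vw, Vx, Vy}"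
      using ir[of z] i by (cases "kind z") (auto simp: f_def place_kind_def in_range_def)
    ultimately show ?thesis by (auto simp: vega_verts_def mu_def nu_def split: if_splits)
  qed
  moreover have "\<exists>z. f z = y" if y: "y \<in> vega_verts i mu nu" for y
  proof (cases y)
    case (Cyc q)
    then have q: "0 \<le> q" "q \<le> 3 * int i - 2" and nq: "nu = 1 \<Longrightarrow> q \<noteq> 2 * int i - 1"
      using y by (auto simp: vega_verts_def split: if_splits)
    consider "q \<le> int i - 1" | "int i \<le> q" "q \<le> 2 * int i - 2" | "q = 2 * int i - 1" | "2 * int i \<le> q" by linarith
    then show ?thesis
    proof cases
      case 1
      then obtain z where z: "z \<in> core" "pos z = q" using surj[of q] q i by auto
      then have "kind z = K1" using is1[of z] 1 i by simp
      then show ?thesis using z Cyc by (intro exI[of _ z]) (simp add: f_def place_kind_def g_def)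
    next
      case 2
      then obtain z where z: "z \<in> core" "pos z = q + 1" using surj[of "q + 1"] q i by auto
      then have "kind z = K2" using is2[of z] pKU[of z] 2 i by auto
      then show ?thesis using z Cyc by (intro exI[of _ z]) (simp add: f_def place_kind_def g_def)
    next
      case 3
      then have "nu \<noteq> 1" using nq by blast
      then have "\<exists>z. kind z = K2 \<and> pos z = 2 * int k - 2" unfolding nu_def by presburger
      then obtain z where "kind z = K2" "pos z = 2 * int k - 2" by blast
      then show ?thesis using Cyc 3 i by (intro exI[of _ z]) (simp add: f_def place_kind_def g_def)
    next
      case 4
      then obtain z where z: "z \<in> core" "pos z = q + 2" using surj[of "q + 2"] q i by auto
      then have "kind z = K3" using is3[of z] 4 q i by simp
      then show ?thesis using z Cyc by (intro exI[of _ z]) (simp add: f_def place_kind_def g_def)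
    qed
  next
    case Va then show ?thesis by (intro exI[of _ a]) (simp add: f_def place_kind_def)
  next
    case Vb then show ?thesis by (intro exI[of _ b]) (simp add: f_def place_kind_def)
  next
    case Vc then show ?thesis by (intro exI[of _ c]) (simp add: f_def place_kind_def)
  next
    case Vu then show ?thesis by (intro exI[of _ u]) (simp add: f_def place_kind_def)
  next
    case Vv then show ?thesis by (intro exI[of _ v]) (simp add: f_def place_kind_def)
  next
    case Vw then show ?thesis by (intro exI[of _ w]) (simp add: f_def place_kind_def)
  next
    case Vx
    have "kind x = KX" using x unfolding spots_kind by (cases "kind x") auto
    then show ?thesis using Vx by (intro exI[of _ x]) (simp add: f_def place_kind_def)
  next
    case Vy
    then have "mu = 0" using y by (auto simp: vega_verts_def split: if_splits)
    then obtain z where "kind z = KY" by (auto simp: mu_def split: if_splits)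
    then show ?thesis using Vy by (intro exI[of _ z]) (simp add: f_def place_kind_def)
  qed
  moreover have "E y z \<longleftrightarrow> vega_adj i (f y) (f z)" for y z
  proof (cases "cyclic (kind y) \<and> cyclic (kind z)")
    case False
    then show ?thesis using edge_iff_compat vega_adj_place_kind[OF ir[of y] ir[of z]] by (simp add: f_def)
  next
    case True
    then have c: "y \<in> core" "z \<in> core" using K_core by (auto simp: cyclic_def)
    have fy: "f y = Cyc (g y)" "f z = Cyc (g z)" using True by (auto simp: f_def place_kind_def cyclic_def)
    have gr: "0 \<le> g y" "g y \<le> 3 * int i - 2" "0 \<le> g z" "g z \<le> 3 * int i - 2"
      using ir[of y] ir[of z] True i by (auto simp: in_range_def cyclic_def)
    have "vega_adj i (f y) (f z) \<longleftrightarrow> int i \<le> \<bar>g y - g z\<bar> \<and> \<bar>g y - g z\<bar> \<le> 2 * int i - 1"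
      using gr adj_abs[of "g y" "g z" i] adj_abs[of "g z" "g y" i] unfolding fy
      by (auto simp: vega_adj_def abs_minus_commute)
    also have "\<dots> \<longleftrightarrow> int k \<le> \<bar>pos y - pos z\<bar> \<and> \<bar>pos y - pos z\<bar> \<le> 2 * int k - 1"
    proof -
      have "int k \<ge> 3" using k3 by simp
      from adj_remove_three[OF this shape shape] True show ?thesis unfolding i(1) by blast
    qed
    finally show ?thesis using Eadj[OF c] by blast
  qed
  ultimately have "blow_up E UNIV (vega_adj i) (vega_verts i mu nu)" unfolding blow_up_def by blast
  moreover have "mu \<in> {0, 1}" "nu \<in> {0, 1}" by (auto simp: mu_def nu_def)
  ultimately show ?thesis using i(2) by blast
qed

text \<open>An embedding into the core is also one into the whole graph, so one bound
  \<open>K\<close> serves both uses of Pach's theorem.\<close>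

theorem (in dense_maximal_graph) andrasfai_or_vega:
  assumes bound: "\<And>k \<phi>. k \<ge> 1 \<Longrightarrow> embeds E UNIV k \<phi> \<Longrightarrow> k \<le> K"
  shows "(\<exists>k\<ge>1. blow_up E UNIV (andrasfai_adj k) (andrasfai_verts k)) \<or>
    (\<exists>i\<ge>2. \<exists>mu\<in>{0, 1}. \<exists>nu\<in>{0, 1}. blow_up E UNIV (vega_adj i) (vega_verts i mu nu))"
proof (cases "\<forall>x y z. \<not> E x y \<longrightarrow> \<not> E x z \<longrightarrow> \<not> E y z \<longrightarrow> (\<exists>t. E t x \<and> E t y \<and> E t z)")
  case True
  interpret dominated_graph E UNIV
  proof
    show "\<exists>w\<in>UNIV. \<forall>x\<in>I. E w x" if "finite I" "\<And>x y. x \<in> I \<Longrightarrow> y \<in> I \<Longrightarrow> \<not> E x y" for I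
      using finite_dominated[OF _ that] True by blast
  qed (use sym triangle_free in blast)+
  show ?thesis using blow_up_andrasfai[of K] bound by blast
next
  case False
  then obtain a b c u v w t where "hexframe E a b c u v w" and t: "E t a" "E t b" "E t c"
    using hexframe_exists by blast
  then interpret h: hexframe E a b c u v w by blast
  obtain a' b' c' u' v' w' where C: "centred E a' b' c' u' v' w'" and s: "{a', b', c'} = {a, b, c}"
    using h.centred_exists by blast
  interpret c: centred E a' b' c' u' v' w' by (rule C)
  have "E t y" if "y \<in> {a', b', c'}" for y using that t unfolding s by blast
  then have t': "E t a'" "E t b'" "E t c'" by blast+
  interpret d: dominated_graph E c.core by (rule c.core_dominated_graph)
  have core_bound: "k \<le> K" if "k \<ge> 1" "embeds E c.core k \<phi>" for k \<phi>
    using bound[OF that(1), of \<phi>] that(2) by (simp add: embeds_def)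
  have "\<exists>k\<ge>1. blow_up E c.core (andrasfai_adj k) (andrasfai_verts k)"
    by (rule d.blow_up_andrasfai) (rule core_bound)
  then obtain k f where k: "k \<ge> 1" and f: "c.position k f"
    unfolding blow_up_def c.position_def andrasfai_verts_def by blast
  obtain g where "c.position k g" "g w' = int k - 1" "g a' = 2 * int k - 1" "g b' = 3 * int k - 2"
    using c.normal_position[OF f k] by blast
  then show ?thesis using c.blow_up_vega[OF t' k] by blast
qed

lemma arc_card:
  assumes k: "k \<ge> 1" and T: "T \<subseteq> {0..<circ k}" and ind: "\<forall>i\<in>T. \<forall>j\<in>T. \<not> andrasfai_adj k i j"
  shows "card T \<le> k"
proof -
  obtain r where r: "\<forall>j\<in>T. in_arc k r j" using independent_in_arc[OF assms] by blast
  have "inj_on (\<lambda>j. (j - r) mod circ k) T"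
  proof (rule inj_onI)
    fix i j assume ij: "i \<in> T" "j \<in> T" "(i - r) mod circ k = (j - r) mod circ k"
    then have "circ k dvd (i - r) - (j - r)" by (simp only: mod_eq_dvd_iff)
    then have "i mod circ k = j mod circ k" by (simp add: mod_eq_dvd_iff)
    then show "i = j" using ij T by (auto simp: mod_pos_pos_trivial subset_iff)
  qed
  moreover have "(\<lambda>j. (j - r) mod circ k) ` T \<subseteq> {0..<int k}" using r k by (auto simp: in_arc_def)
  ultimately have "card T \<le> card {0..<int k}" by (rule card_inj_on_le) simp
  then show ?thesis by simp
qed

section \<open>Lower densities\<close>

text \<open>Double counting between \<open>L\<close> and {1..n}: as \<open>L\<close> is finite, a
  single n makes the relative degrees of all its entries exceed r, and some w <= n is adjacent to at
  least the average number of entries.\<close>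

lemma average_neighbour:
  fixes E :: "nat \<Rightarrow> nat \<Rightarrow> bool" and r :: real
  assumes dens: "\<And>v. v \<ge> 1 \<Longrightarrow> r < lower_deg E v" and sym: "\<And>u v. E u v \<Longrightarrow> E v u"
    and L: "L \<noteq> []" "\<forall>v\<in>set L. v \<ge> 1"
  shows "\<exists>w\<ge>1. r * length L < length (filter (E w) L)"
proof (rule ccontr)
  assume no: "\<not> ?thesis"
  let ?c = "\<lambda>n v. card {w. 1 \<le> w \<and> w \<le> n \<and> E v w}"
  have "eventually (\<lambda>n. r < real (?c n v) / real n) sequentially" if "v \<in> set L" for v
    using less_LiminfD[of "ereal r" sequentially "\<lambda>n. ereal (real (?c n v) / real n)"] dens[of v] L(2) that
    by (simp add: lower_deg_def)
  then have "eventually (\<lambda>n. \<forall>v\<in>set L. r < real (?c n v) / real n) sequentially"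
    by (intro eventually_ball_finite) auto
  then have "eventually (\<lambda>n. (\<forall>v\<in>set L. r < real (?c n v) / real n) \<and> n \<ge> 1) sequentially"
    using eventually_ge_at_top[of 1] by (rule eventually_conj)
  then obtain n where n: "\<forall>v\<in>set L. r < real (?c n v) / real n" "n \<ge> 1"
    using eventually_happens'[OF sequentially_bot] by blast
  have "real n * r < ?c n v" if "v \<in> set L" for v
    using n that by (simp add: field_simps)
  then have "(\<Sum>v\<leftarrow>L. real n * r) < (\<Sum>v\<leftarrow>L. real (?c n v))"
    using L(1) by (intro sum_list_strict_mono) auto
  also have "(\<Sum>v\<leftarrow>L. real (?c n v)) = (\<Sum>w\<in>{1..n}. real (length (filter (E w) L)))"
  proof (induction L)
    case (Cons v L)
    have "real (?c n v) = (\<Sum>w\<in>{1..n}. if E w v then 1 else 0)"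
    proof -
      have "{w. 1 \<le> w \<and> w \<le> n \<and> E v w} = {w\<in>{1..n}. E w v}" using sym by auto
      then show ?thesis by (simp add: sum.If_cases Int_def)
    qed
    then show ?case using Cons by (simp add: sum.distrib[symmetric] if_distrib cong: if_cong sum.cong) (intro sum.cong; simp)
  qed simp
  also have "\<dots> \<le> (\<Sum>w\<in>{1..n}. r * length L)"
    by (intro sum_mono) (use no in \<open>auto simp: not_less\<close>)
  finally show False by (simp add: sum_list_triv mult.commute mult.left_commute)
qed

theorem theorem5p4:
  fixes E :: "nat \<Rightarrow> nat \<Rightarrow> bool"
  assumes "pos_graph E"
    and "maximal_triangle_free E"
    and "(INF v\<in>{1..}. lower_deg E v) > 1/3"
  shows "(\<exists>k\<ge>1. blow_up E {1..} (andrasfai_adj k) (andrasfai_verts k))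
       \<or> (\<exists>i\<ge>2. \<exists>mu\<in>{0,1}. \<exists>nu\<in>{0,1}. blow_up E {1..} (vega_adj i) (vega_verts i mu nu))"
proof -
  \<comment> \<open>The shift makes every natural number a vertex, because
    \<open>dense_maximal_graph\<close> lives on a whole type.\<close>
  define F where "F p q = E (Suc p) (Suc q)" for p q
  have E_sym: "E p q \<Longrightarrow> E q p" for p q using assms(1) by (simp add: pos_graph_def)
  have tri: "E p q \<Longrightarrow> E q t \<Longrightarrow> E p t \<Longrightarrow> False" for p q t
    using assms(2) unfolding maximal_triangle_free_def by blast
  have "ereal (1/3) < (INF v\<in>{1..}. lower_deg E v)" using assms(3) by (simp add: one_ereal_def numeral_eq_ereal)
  then obtain r :: real where r: "ereal (1/3) < ereal r" "ereal r < (INF v\<in>{1..}. lower_deg E v)"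
    using ereal_dense2 by blast
  have dens: "ereal r < lower_deg E v" if "v \<ge> 1" for v
    using r(2) INF_lower[of v "{1..}" "lower_deg E"] that by (meson atLeast_iff less_le_trans)
  have avg: "\<exists>t. r * length L < length (filter (F t) L)" if L: "L \<noteq> []" for L
  proof -
    obtain t where t: "t \<ge> 1" "r * length (map Suc L) < length (filter (E t) (map Suc L))"
      using average_neighbour[OF dens E_sym, of "map Suc L"] L by auto
    obtain t' where "t = Suc t'" using t(1) by (cases t) auto
    then show ?thesis using t(2) by (intro exI[of _ t']) (simp add: filter_map o_def F_def[abs_def])
  qed
  interpret G: dense_maximal_graph F
  proof
    show "F q p" if "F p q" for p q using that E_sym by (simp add: F_def)
    show False if "F p q" "F q t" "F p t" for p q t using that tri by (auto simp: F_def)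
    show ex: "\<exists>t. length L < 3 * length (filter (F t) L)" if L: "L \<noteq> []" for L
    proof -
      obtain t where t: "r * length L < length (filter (F t) L)" using avg[OF L] by blast
      have "1/3 * real (length L) \<le> r * length L" using r(1) by (intro mult_right_mono) auto
      then have "real (length L) < real (3 * length (filter (F t) L))" using t by simp
      then show ?thesis by (metis of_nat_less_iff)
    qed
    show "\<exists>t. F t p \<and> F t q" if n: "\<not> F p q" for p q
    proof (cases "p = q")
      case True
      \<comment> \<open>Maximality speaks of distinct vertices; for a single vertex, averaging over
        \<open>[p]\<close> yields a neighbour.\<close>
      then show ?thesis using ex[of "[p]"] by (auto split: if_splits)
    next
      case False
      then obtain t where t: "1 \<le> t" "E (Suc p) t" "E (Suc q) t"
        using assms(2) n unfolding maximal_triangle_free_def F_def by (metis Suc_inject le_add1 plus_1_eq_Suc)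
      then show ?thesis using E_sym by (intro exI[of _ "t - 1"]) (auto simp: F_def)
    qed
  qed
  \<comment> \<open>Some vertex is adjacent to more than r(3k-1) of the 3k-1 images, counted by
    index. Its indices are independent, hence at most k by \<open>arc_card\<close>. Solving r(3k-1)
    < k gives the constant, with 3r-1 > 0 as r > 1/3.\<close>
  have bound: "k \<le> nat \<lceil>r / (3 * r - 1)\<rceil>" if k: "k \<ge> 1" and e: "embeds F UNIV k \<phi>" for k \<phi>
  proof -
    let ?L = "map \<phi> [0..circ k - 1]"
    have len: "length ?L = nat (circ k)" by simp
    then have "?L \<noteq> []" using k by auto
    from avg[OF this] obtain t where t: "r * length ?L < length (filter (F t) ?L)" by blast
    define T where "T = {j\<in>{0..<circ k}. F t (\<phi> j)}"
    have "length (filter (F t) ?L) = length (filter (\<lambda>j. F t (\<phi> j)) [0..circ k - 1])"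
      by (simp add: filter_map o_def)
    also have "\<dots> = card T"
      unfolding T_def by (subst distinct_length_filter) (auto intro: arg_cong[where f = card])
    also have "card T \<le> k"
    proof (rule arc_card[OF k])
      show "\<forall>i\<in>T. \<forall>j\<in>T. \<not> andrasfai_adj k i j"
        using e G.triangle_free unfolding T_def embeds_def by blast
    qed (auto simp: T_def)
    finally have "real (length (filter (F t) ?L)) \<le> k" by (rule of_nat_mono)
    then have "r * length ?L < k" using t by linarith
    then have "r * nat (circ k) < k" by (simp only: len)
    then have "r * (3 * real k - 1) < k" using k by simp
    then have "real k * (3 * r - 1) < r" by (simp add: algebra_simps)
    then have "real k < r / (3 * r - 1)" using r(1) by (simp add: field_simps)
    then show ?thesis by linarith
  qed
  have shift: "blow_up E {1..} H VH" if B: "blow_up F UNIV H VH" for H :: "'b \<Rightarrow> 'b \<Rightarrow> bool" and VH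
  proof -
    obtain f where f: "\<forall>v. f v \<in> VH" "\<forall>x\<in>VH. \<exists>v. f v = x" "\<forall>p q. F p q \<longleftrightarrow> H (f p) (f q)"
      using B unfolding blow_up_def by auto
    have "\<forall>x\<in>VH. \<exists>v\<in>{1..}. f (v - 1) = x"
      using f(2) by (metis atLeast_iff diff_Suc_1 le_add1 plus_1_eq_Suc)
    moreover have "\<forall>p\<in>{1..}. \<forall>q\<in>{1..}. E p q \<longleftrightarrow> H (f (p - 1)) (f (q - 1))"
    proof (intro ballI)
      fix p q :: nat assume "p \<in> {1..}" "q \<in> {1..}"
      then obtain p' q' where "p = Suc p'" "q = Suc q'" by (cases p; cases q) auto
      then show "E p q \<longleftrightarrow> H (f (p - 1)) (f (q - 1))" using f(3) by (simp add: F_def)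
    qed
    ultimately show ?thesis using f(1) unfolding blow_up_def by (intro exI[of _ "\<lambda>v. f (v - 1)"]) blast
  qed
  consider k where "k \<ge> 1" "blow_up F UNIV (andrasfai_adj k) (andrasfai_verts k)"
    | i mu nu where "i \<ge> 2" "mu \<in> {0, 1}" "nu \<in> {0, 1}" "blow_up F UNIV (vega_adj i) (vega_verts i mu nu)"
  proof -
    have "(\<exists>k\<ge>1. blow_up F UNIV (andrasfai_adj k) (andrasfai_verts k)) \<or>
    (\<exists>i\<ge>2. \<exists>mu\<in>{0, 1}. \<exists>nu\<in>{0, 1}. blow_up F UNIV (vega_adj i) (vega_verts i mu nu))"
      by (rule G.andrasfai_or_vega) (rule bound)
    then show ?thesis using that by (elim disjE exE conjE bexE) blast+
  qed
  then show ?thesis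
  proof cases
    case 1
    from 1(1) shift[OF 1(2)] show ?thesis by blast
  next
    case 2
    from 2(1-3) shift[OF 2(4)] show ?thesis by blast
  qed
qed

end
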